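(* Let $M_i,L_i\ge0$ and suppose each $Q_i$ ($1\le i\le n$) is monotone and $M_i$-Lipschitz on $\mathcal Z$ with respect to $\|\cdot\|_{\mathbf P}$, and that the functions $p_i$ satisfy the stochastic first-order oracle assumption of the context with constants $L_i,\sigma_i$. Let $\mathcal Z$ be bounded and let $0<\Omega<\infty$ be deterministic with $\sup_{z\in\mathcal Z}\|z_{\mathrm{in}}-z\|_{\mathbf P}^2\le\Omega$ almost surely. Let $T_1,\dots,T_n$ be positive integers, $A_i:=\prod_{j=1}^iT_j$, choose $$\tau_i=\sigma_iA_i^{3/2}2^{-i}\Omega^{-1/2},$$ assume $L_i+\tau_i+M_i>0$ for all $i$, and run the stochastic Sliding Algorithm (described in the context) with $\alpha_0=1$, $\alpha_{t+1}=2/(1+\sqrt{1+4/\alpha_t^2})$ and $\eta^k_{\mathbf t}=(L_k+\tau_k)\prod_{\ell=1}^k\alpha_{t_\ell}+M_k\prod_{\ell=1}^k\alpha_{t_\ell}/\alpha_{T_\ell-1}$ from an $\mathcal F_0$-measurable input $z_{\mathrm{in}}$. Then $$\mathbb E\Big[\sup_{z\in\mathcal Z}\{p(z_{\mathrm{out}})-p(z)+\langle Q(z),z_{\mathrm{out}}-z\rangle\}\Big]\le\sum_{i=1}^n\frac{2^{2i-1}L_i\Omega}{A_i^2}+\sum_{i=1}^n\frac{2^{i-1}M_i\Omega}{A_i}+\sum_{i=1}^n\frac{(2^i+2^{i/2})\sigma_i\sqrt\Omega}{\sqrt{A_i}}.$$ Consequently, there is a constant $c_n>0$ depending only on $n$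 such that, for every $\varepsilon>0$, the left-hand side is at most $\varepsilon$ whenever $$A_i\ge c_n\left(1+\sqrt{\frac{L_i\Omega}{\varepsilon}}+\frac{M_i\Omega}{\varepsilon}+\frac{\sigma_i^2\Omega}{\varepsilon^2}\right)\quad\text{for all }i,$$ and, after relabeling the component pairs so that these target budgets are nondecreasing in $i$, positive integers $T_j$ exist for which these conditions hold with $A_i$ equal to the bracketed quantity up to a factor depending only on $n$. In particular, for the stochastic bilinear problem of the context (degenerate regime $\delta_x=\delta_y=0$, $\mathcal Z=\mathcal X\times\mathcal Y$ bounded, $\Omega:=\sup_{z\in\mathcal Z}\|z^0-z\|^2$), uniform expected gap at most $\varepsilon$ is attained with $\mathcal O\big(\sqrt{L_x\Omega/\varepsilon}+\sigma_x^2\Omega/\varepsilon^2\big)$ samples of $\nabla f$, $\mathcal O\big(\sqrt{L_y\Omega/\varepsilon}+\sigma_y^2\Omega/\varepsilon^2\big)$ samples of $\nabla g$, and $\mathcal O(L_{xy}\Omega/\varepsilon)$ products with $\mathbf B,\mathbf B^\top$ (as $\varepsilon\downarrow0$).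
   Context: Setting. $\mathcal Z\subseteq\mathbb R^{d_z}$ is nonempty, closed and convex; $p=\sum_{i=1}^np_i$, $Q=\sum_{i=1}^nQ_i$, with $p_i:\mathcal Z\to\mathbb R$ convex and $Q_i:\mathcal Z\to\mathbb R^{d_z}$ continuous and monotone. $\mathbf P$ is symmetric positive definite, $\|z\|_{\mathbf P}=\langle\mathbf Pz,z\rangle^{1/2}$, $\|s\|_{\mathbf P,*}=\|s\|_{\mathbf P^{-1}}=\langle s,\mathbf P^{-1}s\rangle^{1/2}$. $G$ is monotone if $\langle G(u)-G(v),u-v\rangle\ge0$, and $M$-Lipschitz with respect to $\|\cdot\|_{\mathbf P}$ if $\|G(u)-G(v)\|_{\mathbf P^{-1}}\le M\|u-v\|_{\mathbf P}$. Stochastic Sliding Algorithm. Oracle-call nodes are $\nu=(k,\mathbf t)$ with $1\le k\le n$, $\mathbf t=(t_1,\dots,t_k)$, $0\le t_\ell<T_\ell$; at node $\nu$ a fresh sample $\xi_\nu$ is drawn. Set $z^k_{(0,\dots,0)}=z_{\mathrm{in}}\in\mathcal Z$ ($k$ zeros), $k=1,\dots,n$; output $z_{\mathrm{out}}=\mathrm{Rec}(0,\varnothing)$, where $\mathrm{Rec}(k,\mathbf t)$, $\mathbf t=(t_1,\dots,t_k)$, is: (a) If $k=n$, return $\operatorname{argmin}_{z\in\mathcal Z}\sum_{i=1}^n\{\langle G_i(w^i_{(t_1,\dots,t_i)},\xi_{(i,(t_1,\dots,t_i))})+Q_i(z^i_{(t_1,\dots,t_i)}),z\rangle+\tfrac12\eta^i_{(t_1,\dots,t_i)}\|z-z^i_{(t_1,\dots,t_i)}\|_{\mathbf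 P}^2\}$. (b) If $k<n$, set $\bar z^{k+1}_{(\mathbf t,0)}=z^{k+1}_{(\mathbf t,0)}$. For $j=0,\dots,T_{k+1}-1$, with $\mathbf t'=(\mathbf t,j)$, $\mathbf t''=(\mathbf t,j+1)$: evaluate $G_{k+1}(w^{k+1}_{\mathbf t'},\xi_{(k+1,\mathbf t')})$ once; $\tilde z^{k+1}_{\mathbf t'}=\mathrm{Rec}(k+1,\mathbf t')$; $\bar z^{k+1}_{\mathbf t''}=\alpha_j\tilde z^{k+1}_{\mathbf t'}+(1-\alpha_j)\bar z^{k+1}_{\mathbf t'}$; $z^{k+1}_{\mathbf t''}=\operatorname{argmin}_{z\in\mathcal Z}\{\langle Q_{k+1}(\tilde z^{k+1}_{\mathbf t'})-Q_{k+1}(z^{k+1}_{\mathbf t'}),z\rangle+\tfrac12\eta^{k+1}_{\mathbf t'}\|z-\tilde z^{k+1}_{\mathbf t'}\|_{\mathbf P}^2\}$; for $\ell=k+2,\dots,n$, $z^\ell_{(\mathbf t'',0,\dots,0)}=z^\ell_{(\mathbf t',T_{k+2},0,\dots,0)}$ (zero-padded to length $\ell$). Return $\bar z^{k+1}_{(\mathbf t,T_{k+1})}$. Here $w^i_{(t_1,\dots,t_i)}=(a_1\circ\cdots\circ a_i)(z^i_{(t_1,\dots,t_i)})$, $a_\ell(z)=\alpha_{t_\ell}z+(1-\alpha_{t_\ell})\bar z^\ell_{(t_1,\dots,t_\ell)}$. Filtration. Enumerate the nodes $\nu_1,\dots,\nu_N$ in execution order; $\mathcal F_0=\sigma(z_{\mathrm{in}})$,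 $\mathcal F_m=\mathcal F_0\vee\sigma(\xi_{\nu_1},\dots,\xi_{\nu_m})$, and $\mathcal F_{\nu_m}:=\mathcal F_{m-1}$ is the history before the call at $\nu_m$. Stochastic first-order oracle assumption. For every $i$, $p_i$ is convex and differentiable on $\mathcal Z$ with $L_i$-Lipschitz gradient with respect to $\|\cdot\|_{\mathbf P}$, hence $0\le p_i(u)-p_i(v)-\langle\nabla p_i(v),u-v\rangle\le\frac{L_i}2\|u-v\|_{\mathbf P}^2$ for $u,v\in\mathcal Z$; and there is a measurable map $G_i$ such that, with $\varepsilon_i(v,\xi)=G_i(v,\xi)-\nabla p_i(v)$, for every node $\nu$ and every $\mathcal F_\nu$-measurable $v\in\mathcal Z$, almost surely $\mathbb E[\varepsilon_i(v,\xi_\nu)\mid\mathcal F_\nu]=0$ and $\mathbb E[\|\varepsilon_i(v,\xi_\nu)\|_{\mathbf P,*}^2\mid\mathcal F_\nu]\le\sigma_i^2$. Stochastic bilinear problem (degenerate regime). $\min_{x\in\mathcal X}\max_{y\in\mathcal Y}f(x)+\langle y,\mathbf Bx\rangle-g(y)$ with $\mathcal X,\mathcal Y$ nonempty, closed, convex and bounded; $f,g$ convex and $L_x$-, $L_y$-smooth ($L_x,L_y>0$), $\|\mathbf B\|\le L_{xy}$, $L_{xy}>0$; no curvature is used (effective strong convexity parameters $\delta_x=\delta_y=0$). The gradients of $f$ and $g$ are accessed through measurable stochastic oracles $G_f(x,\xi)$ and $G_g(y,\xi)$ such that, for every node $\nu$ at which the respective oracle is called and all $\mathcal F_\nu$-measurable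 $x\in\mathcal X$, $y\in\mathcal Y$, almost surely $\mathbb E[G_f(x,\xi_\nu)-\nabla f(x)\mid\mathcal F_\nu]=0$ and $\mathbb E[\|G_f(x,\xi_\nu)-\nabla f(x)\|^2\mid\mathcal F_\nu]\le\sigma_x^2$, respectively $\mathbb E[G_g(y,\xi_\nu)-\nabla g(y)\mid\mathcal F_\nu]=0$ and $\mathbb E[\|G_g(y,\xi_\nu)-\nabla g(y)\|^2\mid\mathcal F_\nu]\le\sigma_y^2$, where $\|\cdot\|$ is the Euclidean norm; the bilinear products are exact. One uses $n=3$, $\mathbf P=\mathbf I$, $z_{\mathrm{in}}=z^0$ deterministic, components $p_1(x,y)=f(x)$, $p_2(x,y)=g(y)$, $p_3\equiv0$, $Q_1=Q_2=0$, $Q_3(x,y)=(\mathbf B^\top y,-\mathbf Bx)$ (up to relabeling), so that $(L,M,\sigma)$ are $(L_x,0,\sigma_x)$, $(L_y,0,\sigma_y)$, $(0,L_{xy},0)$. The uniform expected gap is $\mathbb E[\sup_{z\in\mathcal Z}\{p(z_{\mathrm{out}})-p(z)+\langle Q(z),z_{\mathrm{out}}-z\rangle\}]$. *)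

theory Defs
  imports "HOL-Probability.Probability"
begin

section \<open>Geometry and problem classes\<close>

definition sym_pos_def :: "('z::euclidean_space \<Rightarrow> 'z) \<Rightarrow> bool" where
  "sym_pos_def P \<longleftrightarrow> linear P \<and> (\<forall>u v. P u \<bullet> v = u \<bullet> P v) \<and> (\<forall>u. u \<noteq> 0 \<longrightarrow> P u \<bullet> u > 0)"

definition pnorm :: "('z::euclidean_space \<Rightarrow> 'z) \<Rightarrow> 'z \<Rightarrow> real" where
  "pnorm P z = sqrt (P z \<bullet> z)"

definition dual_pnorm :: "('z::euclidean_space \<Rightarrow> 'z) \<Rightarrow> 'z \<Rightarrow> real" where
  "dual_pnorm P s = sqrt (s \<bullet> inv P s)"

definition monotone_op :: "'z::euclidean_space set \<Rightarrow> ('z \<Rightarrow> 'z) \<Rightarrow> bool" where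
  "monotone_op Z G \<longleftrightarrow> (\<forall>u\<in>Z. \<forall>v\<in>Z. (G u - G v) \<bullet> (u - v) \<ge> 0)"

definition lipschitz_op ::
  "('z::euclidean_space \<Rightarrow> 'z) \<Rightarrow> 'z set \<Rightarrow> real \<Rightarrow> ('z \<Rightarrow> 'z) \<Rightarrow> bool" where
  "lipschitz_op P Z M G \<longleftrightarrow> (\<forall>u\<in>Z. \<forall>v\<in>Z. dual_pnorm P (G u - G v) \<le> M * pnorm P (u - v))"

text \<open>
  The gradient is a parameter \<open>grad\<close>: \<open>Z\<close> may have empty interior, where differentiability
  within \<open>Z\<close> does not determine it.
\<close>
definition convex_smooth ::
  "('z::euclidean_space \<Rightarrow> 'z) \<Rightarrow> 'z set \<Rightarrow> real \<Rightarrow> ('z \<Rightarrow> real) \<Rightarrow> ('z \<Rightarrow> 'z) \<Rightarrow> bool" where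
  "convex_smooth P Z L f grad \<longleftrightarrow>
     convex_on Z f \<and>
     (\<forall>v\<in>Z. (f has_derivative (\<lambda>h. grad v \<bullet> h)) (at v within Z)) \<and>
     lipschitz_op P Z L grad"

text \<open>
  The gap is taken for \<open>p = p\<^sub>1 + \<dots> + p\<^sub>n\<close> and \<open>Q = Q\<^sub>1 + \<dots> + Q\<^sub>n\<close>.
\<close>
definition gap ::
  "nat \<Rightarrow> 'z::euclidean_space set \<Rightarrow> (nat \<Rightarrow> 'z \<Rightarrow> real) \<Rightarrow> (nat \<Rightarrow> 'z \<Rightarrow> 'z) \<Rightarrow> 'z \<Rightarrow> real" where
  "gap n Z p Q u =
     (SUP z\<in>Z. (\<Sum>i=1..n. p i u) - (\<Sum>i=1..n. p i z) + (\<Sum>i=1..n. Q i z) \<bullet> (u - z))"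


section \<open>The Sliding Algorithm\<close>

text \<open>
  An index \<open>\<^bold>t = (t\<^sub>1,\<dots>,t\<^sub>k)\<close> is a list of length \<open>k\<close>, so \<open>t\<^sub>l = t ! (l - 1)\<close>. The level of an
  iterate, and of a node, is the length of its index: \<open>zs t\<close> is the iterate \<open>z\<^sup>k\<close> at index \<open>\<^bold>t\<close> and
  the node \<open>(k, \<^bold>t)\<close> is just \<open>t\<close>. The iteration numbers \<open>T\<close> are indexed by \<open>1,\<dots>,n\<close>.

  The state stores each oracle answer at the node where it is computed, since the final proximal
  step reuses \<open>G\<^sub>i(w\<^sup>i,\<xi>)\<close> and \<open>Q\<^sub>i(z\<^sup>i)\<close> of the enclosing nodes without calling the oracles again.
  The two counters record how often \<open>G\<^sub>i\<close> and \<open>Q\<^sub>i\<close> have been evaluated.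
\<close>
record 'z sliding_state =
  zs :: "nat list \<Rightarrow> 'z"
  zbars :: "nat list \<Rightarrow> 'z"
  Gvals :: "nat list \<Rightarrow> 'z"
  Qvals :: "nat list \<Rightarrow> 'z"
  Gcount :: "nat \<Rightarrow> nat"
  Qcount :: "nat \<Rightarrow> nat"

text \<open>Only entries at all-zero indices of \<open>zs\<close> are ever read before being overwritten.\<close>
definition init_state :: "'z::euclidean_space \<Rightarrow> 'z sliding_state" where
  "init_state zin = \<lparr>zs = (\<lambda>_. zin), zbars = (\<lambda>_. zin), Gvals = (\<lambda>_. 0), Qvals = (\<lambda>_. 0),
     Gcount = (\<lambda>_. 0), Qcount = (\<lambda>_. 0)\<rparr>"

context
  fixes n :: nat
    and T :: "nat \<Rightarrow> nat"
    and Z :: "'z::euclidean_space set"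
    and P :: "'z \<Rightarrow> 'z"
    and Q :: "nat \<Rightarrow> 'z \<Rightarrow> 'z"
    and \<alpha> :: "nat \<Rightarrow> real"
    and \<eta> :: "nat list \<Rightarrow> real"
    and Gs :: "nat list \<Rightarrow> 'z \<Rightarrow> 'z" \<comment> \<open>\<open>Gs t\<close> is \<open>G\<^sub>k(\<cdot>, \<xi>\<^sub>t)\<close>, \<open>k\<close> the length of \<open>t\<close>\<close>
begin

text \<open>\<open>w\<^sub>t = (a\<^sub>1 \<circ> \<dots> \<circ> a\<^sub>k)(z\<^sub>t)\<close>\<close>
definition sliding_w :: "'z sliding_state \<Rightarrow> nat list \<Rightarrow> 'z" where
  "sliding_w s t =
     foldr (\<lambda>l v. \<alpha> (t ! (l - 1)) *\<^sub>R v + (1 - \<alpha> (t ! (l - 1))) *\<^sub>R zbars s (take l t))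
       [1..<Suc (length t)] (zs s t)"

definition leaf_step :: "'z sliding_state \<Rightarrow> nat list \<Rightarrow> 'z" where
  "leaf_step s t =
     arg_min_on (\<lambda>z. \<Sum>i=1..n. (Gvals s (take i t) + Qvals s (take i t)) \<bullet> z
                     + 1/2 * \<eta> (take i t) * (pnorm P (z - zs s (take i t)))\<^sup>2) Z"

text \<open>The oracle calls made on entering the node \<open>t'\<close>.\<close>
definition node_calls :: "nat list \<Rightarrow> 'z sliding_state \<Rightarrow> 'z sliding_state" where
  "node_calls t' s = (let i = length t' in
     s\<lparr>Gvals := (Gvals s)(t' := Gs t' (sliding_w s t')),
       Qvals := (Qvals s)(t' := Q i (zs s t')),
       Gcount := (Gcount s)(i := Suc (Gcount s i)),
       Qcount := (Qcount s)(i := Suc (Qcount s i))\<rparr>)"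

text \<open>
  The updates after \<open>zt\<close> has been returned from the node \<open>t' = (t,j)\<close> of level \<open>i = k + 1\<close>; the
  \<open>fold\<close> copies the iterates of the levels \<open>i + 1,\<dots>,n\<close>.
\<close>
definition node_update :: "nat list \<Rightarrow> nat \<Rightarrow> 'z \<Rightarrow> 'z sliding_state \<Rightarrow> 'z sliding_state" where
  "node_update t j zt s = (let t' = t @ [j]; t'' = t @ [Suc j]; i = length t' in
     s\<lparr>zbars := (zbars s)(t'' := \<alpha> j *\<^sub>R zt + (1 - \<alpha> j) *\<^sub>R zbars s t'),
       zs := fold (\<lambda>l z. z(t'' @ replicate (l - i) 0 :=
                           z (t' @ [T (Suc i)] @ replicate (l - Suc i) 0)))
               [Suc i..<Suc n]
               ((zs s)(t'' := arg_min_on (\<lambda>z. (Q i zt - Qvals s t') \<bullet> z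
                                + 1/2 * \<eta> t' * (pnorm P (z - zt))\<^sup>2) Z)),
       Qcount := (Qcount s)(i := Suc (Qcount s i))\<rparr>)"

text \<open>\<open>Rec(k, t)\<close> with \<open>k\<close> the length of \<open>t\<close>; the first argument is \<open>n - k\<close>.\<close>
primrec sliding_rec :: "nat \<Rightarrow> nat list \<Rightarrow> 'z sliding_state \<Rightarrow> 'z \<times> 'z sliding_state" where
  "sliding_rec 0 t s = (leaf_step s t, s)"
| "sliding_rec (Suc d) t s =
     (let s' = fold (\<lambda>j s. let (zt, s1) = sliding_rec d (t @ [j]) (node_calls (t @ [j]) s)
                            in node_update t j zt s1)
                 [0..<T (Suc (length t))]
                 (s\<lparr>zbars := (zbars s)(t @ [0] := zs s (t @ [0]))\<rparr>)
      in (zbars s' (t @ [T (Suc (length t))]), s'))"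

definition sliding_run :: "'z \<Rightarrow> 'z \<times> 'z sliding_state" where
  "sliding_run zin = sliding_rec n [] (init_state zin)"

end

primrec step_alpha :: "nat \<Rightarrow> real" where
  "step_alpha 0 = 1"
| "step_alpha (Suc t) = 2 / (1 + sqrt (1 + 4 / (step_alpha t)\<^sup>2))"

definition level_budget :: "(nat \<Rightarrow> nat) \<Rightarrow> nat \<Rightarrow> nat" where
  "level_budget T i = (\<Prod>j=1..i. T j)"

definition noise_tau :: "(nat \<Rightarrow> nat) \<Rightarrow> (nat \<Rightarrow> real) \<Rightarrow> real \<Rightarrow> nat \<Rightarrow> real" where
  "noise_tau T \<sigma> \<Omega> i =
     \<sigma> i * real (level_budget T i) powr (3/2) * 2 powr (- real i) * \<Omega> powr (- 1/2)"

definition step_eta ::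
  "(nat \<Rightarrow> nat) \<Rightarrow> (nat \<Rightarrow> real) \<Rightarrow> (nat \<Rightarrow> real) \<Rightarrow> (nat \<Rightarrow> real) \<Rightarrow> real \<Rightarrow> nat list \<Rightarrow> real" where
  "step_eta T L M \<sigma> \<Omega> t = (let k = length t in
     (L k + noise_tau T \<sigma> \<Omega> k) * (\<Prod>l=1..k. step_alpha (t ! (l - 1)))
     + M k * (\<Prod>l=1..k. step_alpha (t ! (l - 1)) / step_alpha (T l - 1)))"

text \<open>The run with these step sizes, on the realisation \<open>x\<close> of the samples.\<close>
definition tuned_run ::
  "nat \<Rightarrow> (nat \<Rightarrow> nat) \<Rightarrow> 'z::euclidean_space set \<Rightarrow> ('z \<Rightarrow> 'z) \<Rightarrow> (nat \<Rightarrow> 'z \<Rightarrow> 'z) \<Rightarrow>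
   (nat \<Rightarrow> 'z \<Rightarrow> 's \<Rightarrow> 'z) \<Rightarrow> (nat \<Rightarrow> real) \<Rightarrow> (nat \<Rightarrow> real) \<Rightarrow> (nat \<Rightarrow> real) \<Rightarrow> real \<Rightarrow>
   'z \<Rightarrow> (nat list \<Rightarrow> 's) \<Rightarrow> 'z \<times> 'z sliding_state" where
  "tuned_run n T Z P Q G L M \<sigma> \<Omega> zin x =
     sliding_run n T Z P Q step_alpha (step_eta T L M \<sigma> \<Omega>) (\<lambda>t v. G (length t) v (x t)) zin"


section \<open>Nodes, filtration and stochastic oracles\<close>

definition nodes :: "nat \<Rightarrow> (nat \<Rightarrow> nat) \<Rightarrow> nat list set" where
  "nodes n T = {t. 1 \<le> length t \<and> length t \<le> n \<and> (\<forall>l\<in>{1..length t}. t ! (l - 1) < T l)}"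

text \<open>The nodes below \<open>t\<close> in execution order; the first argument is \<open>n\<close> minus the length of \<open>t\<close>.\<close>
primrec nodes_below :: "(nat \<Rightarrow> nat) \<Rightarrow> nat \<Rightarrow> nat list \<Rightarrow> nat list list" where
  "nodes_below T 0 t = []"
| "nodes_below T (Suc d) t =
     concat (map (\<lambda>j. (t @ [j]) # nodes_below T d (t @ [j])) [0..<T (Suc (length t))])"

definition execution_order :: "nat \<Rightarrow> (nat \<Rightarrow> nat) \<Rightarrow> nat list list" where
  "execution_order n T = nodes_below T n []"

lemma set_nodes_below:
  "set (nodes_below T d t) =
     {t @ u | u. 1 \<le> length u \<and> length u \<le> d \<and>
        (\<forall>l<length u. u ! l < T (Suc (length t + l)))}"
proof (induction d arbitrary: t)
  case (Suc d)
  show ?case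
  proof (intro equalityI subsetI)
    fix x assume "x \<in> set (nodes_below T (Suc d) t)"
    then obtain j where j: "j < T (Suc (length t))"
      and "x = t @ [j] \<or> x \<in> set (nodes_below T d (t @ [j]))" by auto
    then obtain u where x: "x = t @ j # u" and "length u \<le> d"
      "\<forall>l<length u. u ! l < T (Suc (Suc (length t + l)))"
      unfolding Suc.IH by fastforce
    with j show "x \<in> {t @ u | u. 1 \<le> length u \<and> length u \<le> Suc d \<and>
        (\<forall>l<length u. u ! l < T (Suc (length t + l)))}"
      by (auto simp: nth_Cons split: nat.splits intro!: exI[of _ "j # u"])
  next
    fix x assume "x \<in> {t @ u | u. 1 \<le> length u \<and> length u \<le> Suc d \<and>
        (\<forall>l<length u. u ! l < T (Suc (length t + l)))}"
    then obtain v where v: "x = t @ v" "1 \<le> length v" "length v \<le> Suc d"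
      "\<forall>l<length v. v ! l < T (Suc (length t + l))" by blast
    then obtain j u where vu: "v = j # u" by (cases v) auto
    have j: "j < T (Suc (length t))" using v(4) vu by auto
    have u: "\<forall>l<length u. u ! l < T (Suc (Suc (length t + l)))" using v(4) vu by auto
    show "x \<in> set (nodes_below T (Suc d) t)"
    proof (cases "u = []")
      case True
      then show ?thesis using v vu j by auto
    next
      case False
      then have "1 \<le> length u" by (cases u) auto
      then have "x \<in> set (nodes_below T d (t @ [j]))"
        unfolding Suc.IH using u v vu by auto
      then show ?thesis using j by auto
    qed
  qed
qed auto

lemma set_execution_order: "set (execution_order n T) = nodes n T"
proof -
  have "(\<forall>l<k. P (Suc l)) \<longleftrightarrow> (\<forall>l\<in>{1..k}. P l)" for k and P :: "nat \<Rightarrow> bool"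
    by (metis Suc_le_D Suc_le_eq atLeastAtMost_iff One_nat_def Suc_le_mono le0)
  from this[of "length t" "\<lambda>l. t ! (l - 1) < T l" for t] show ?thesis
    by (simp add: execution_order_def nodes_def set_nodes_below)
qed

text \<open>\<open>\<F>\<^sub>\<nu>\<close>: the \<open>\<sigma>\<close>-algebra generated by the input and the samples of all nodes executed before \<open>\<nu>\<close>.\<close>
definition node_history ::
  "nat \<Rightarrow> (nat \<Rightarrow> nat) \<Rightarrow> 'w measure \<Rightarrow> 's measure \<Rightarrow> ('w \<Rightarrow> 'z::euclidean_space) \<Rightarrow>
   (nat list \<Rightarrow> 'w \<Rightarrow> 's) \<Rightarrow> nat list \<Rightarrow> 'w measure" where
  "node_history n T Pr S zin \<xi> \<nu> =
     sigma (space Pr)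
       ({zin -` A \<inter> space Pr | A. A \<in> sets borel} \<union>
        {\<xi> \<mu> -` A \<inter> space Pr | \<mu> A.
           \<mu> \<in> set (takeWhile (\<lambda>\<mu>. \<mu> \<noteq> \<nu>) (execution_order n T)) \<and> A \<in> sets S})"

text \<open>
  The conditional mean is taken coordinatewise. The conditional second moment is the one of
  nonnegative functions, so its bound makes the error square integrable.
\<close>
definition unbiased_oracle ::
  "'w measure \<Rightarrow> 'w measure \<Rightarrow> ('v \<Rightarrow> real) \<Rightarrow> real \<Rightarrow> 'v::euclidean_space set \<Rightarrow> ('v \<Rightarrow> 'v) \<Rightarrow>
   ('v \<Rightarrow> 's \<Rightarrow> 'v) \<Rightarrow> ('w \<Rightarrow> 's) \<Rightarrow> bool" where
  "unbiased_oracle Pr F nrm \<sigma> V grad G x \<longleftrightarrow>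
     (\<forall>v \<in> borel_measurable F. (\<forall>\<omega>\<in>space Pr. v \<omega> \<in> V) \<longrightarrow>
        (\<forall>b\<in>Basis. AE \<omega> in Pr.
           real_cond_exp Pr F (\<lambda>\<omega>. (G (v \<omega>) (x \<omega>) - grad (v \<omega>)) \<bullet> b) \<omega> = 0) \<and>
        (AE \<omega> in Pr.
           nn_cond_exp Pr F (\<lambda>\<omega>. ennreal ((nrm (G (v \<omega>) (x \<omega>) - grad (v \<omega>)))\<^sup>2)) \<omega>
             \<le> ennreal (\<sigma>\<^sup>2)))"

locale stochastic_sliding = prob_space Pr
  for Pr :: "'w measure" +
  fixes n :: nat
    and T :: "nat \<Rightarrow> nat"
    and Z :: "'z::euclidean_space set"
    and P :: "'z \<Rightarrow> 'z"
    and p :: "nat \<Rightarrow> 'z \<Rightarrow> real"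
    and gradp :: "nat \<Rightarrow> 'z \<Rightarrow> 'z"
    and Q :: "nat \<Rightarrow> 'z \<Rightarrow> 'z"
    and L :: "nat \<Rightarrow> real"
    and M :: "nat \<Rightarrow> real"
    and \<sigma> :: "nat \<Rightarrow> real"
    and \<Omega> :: real
    and S :: "'s measure"
    and G :: "nat \<Rightarrow> 'z \<Rightarrow> 's \<Rightarrow> 'z"
    and \<xi> :: "nat list \<Rightarrow> 'w \<Rightarrow> 's"
    and zin :: "'w \<Rightarrow> 'z"
  assumes n_pos: "1 \<le> n"
    and T_pos: "\<And>i. i \<in> {1..n} \<Longrightarrow> 0 < T i"
    and Z_nonempty: "Z \<noteq> {}"
    and Z_closed: "closed Z"
    and Z_convex: "convex Z"
    and Z_bounded: "bounded Z"
    and P_spd: "sym_pos_def P"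
    and L_nonneg: "\<And>i. i \<in> {1..n} \<Longrightarrow> 0 \<le> L i"
    and M_nonneg: "\<And>i. i \<in> {1..n} \<Longrightarrow> 0 \<le> M i"
    and \<sigma>_nonneg: "\<And>i. i \<in> {1..n} \<Longrightarrow> 0 \<le> \<sigma> i"
    and Q_monotone: "\<And>i. i \<in> {1..n} \<Longrightarrow> monotone_op Z (Q i)"
    and Q_lipschitz: "\<And>i. i \<in> {1..n} \<Longrightarrow> lipschitz_op P Z (M i) (Q i)"
    and p_smooth: "\<And>i. i \<in> {1..n} \<Longrightarrow> convex_smooth P Z (L i) (p i) (gradp i)"
    and G_measurable: "\<And>i. i \<in> {1..n} \<Longrightarrow>
          (\<lambda>(v, x). G i v x) \<in> borel_measurable (restrict_space borel Z \<Otimes>\<^sub>M S)"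
    and \<xi>_measurable: "\<And>\<nu>. \<nu> \<in> nodes n T \<Longrightarrow> \<xi> \<nu> \<in> measurable Pr S"
    and oracle_unbiased: "\<And>i \<nu>. i \<in> {1..n} \<Longrightarrow> \<nu> \<in> nodes n T \<Longrightarrow>
          unbiased_oracle Pr (node_history n T Pr S zin \<xi> \<nu>) (dual_pnorm P) (\<sigma> i) Z
            (gradp i) (G i) (\<xi> \<nu>)"
    and zin_measurable: "zin \<in> borel_measurable Pr"
    and zin_in_Z: "\<And>\<omega>. \<omega> \<in> space Pr \<Longrightarrow> zin \<omega> \<in> Z"
    and \<Omega>_pos: "0 < \<Omega>"
    and \<Omega>_bound: "AE \<omega> in Pr. (SUP z\<in>Z. (pnorm P (zin \<omega> - z))\<^sup>2) \<le> \<Omega>"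
    and moduli_pos: "\<And>i. i \<in> {1..n} \<Longrightarrow> 0 < L i + noise_tau T \<sigma> \<Omega> i + M i"


section \<open>Budgets\<close>

definition target_budget :: "real \<Rightarrow> real \<Rightarrow> real \<Rightarrow> real \<Rightarrow> real \<Rightarrow> real" where
  "target_budget L M \<sigma> \<Omega> \<epsilon> = 1 + sqrt (L * \<Omega> / \<epsilon>) + M * \<Omega> / \<epsilon> + \<sigma>\<^sup>2 * \<Omega> / \<epsilon>\<^sup>2"

text \<open>
  A witness for the constant \<open>c\<^sub>n\<close>. An existential quantifier inside a theorem about the
  type variables of the space and of the samples would allow a constant depending on these types,
  in particular on the dimension; a closed term depends on \<open>n\<close> only. The value makes each of the
  \<open>3n\<close> terms of the error bound at most \<open>\<epsilon>/(3n)\<close>.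
\<close>
definition budget_const :: "nat \<Rightarrow> real" where
  "budget_const n = 36 * (real n)\<^sup>2 * 4 ^ n"


section \<open>The stochastic bilinear saddle point problem\<close>

text \<open>Components 1, 2, 3 carry \<open>f\<close>, \<open>g\<close> and the bilinear coupling.\<close>

definition bil_const :: "real \<Rightarrow> real \<Rightarrow> real \<Rightarrow> nat \<Rightarrow> real" where
  "bil_const a b c i = (if i = 1 then a else if i = 2 then b else c)"

definition bil_p :: "('x \<Rightarrow> real) \<Rightarrow> ('y \<Rightarrow> real) \<Rightarrow> nat \<Rightarrow> 'x \<times> 'y \<Rightarrow> real" where
  "bil_p f g i z = (if i = 1 then f (fst z) else if i = 2 then g (snd z) else 0)"

definition bil_Q ::
  "('x::euclidean_space \<Rightarrow> 'y::euclidean_space) \<Rightarrow> nat \<Rightarrow> 'x \<times> 'y \<Rightarrow> 'x \<times> 'y" where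
  "bil_Q B i z = (if i = 3 then (adjoint B (snd z), - B (fst z)) else 0)"

definition bil_G ::
  "('x::euclidean_space \<Rightarrow> 's \<Rightarrow> 'x) \<Rightarrow> ('y::euclidean_space \<Rightarrow> 's \<Rightarrow> 'y) \<Rightarrow>
   nat \<Rightarrow> 'x \<times> 'y \<Rightarrow> 's \<Rightarrow> 'x \<times> 'y" where
  "bil_G Gf Gg i z x =
     (if i = 1 then (Gf (fst z) x, 0) else if i = 2 then (0, Gg (snd z) x) else 0)"

definition sq_radius :: "'z::euclidean_space set \<Rightarrow> 'z \<Rightarrow> real" where
  "sq_radius Z z0 = (SUP z\<in>Z. (norm (z0 - z))\<^sup>2)"

locale stochastic_bilinear =
  fixes X :: "'x::euclidean_space set"
    and Y :: "'y::euclidean_space set"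
    and f :: "'x \<Rightarrow> real" and gradf :: "'x \<Rightarrow> 'x"
    and g :: "'y \<Rightarrow> real" and gradg :: "'y \<Rightarrow> 'y"
    and B :: "'x \<Rightarrow> 'y"
    and Lx Ly Lxy \<sigma>x \<sigma>y :: real
    and S :: "'s measure"
    and Gf :: "'x \<Rightarrow> 's \<Rightarrow> 'x" and Gg :: "'y \<Rightarrow> 's \<Rightarrow> 'y"
    and z0 :: "'x \<times> 'y"
  assumes X: "X \<noteq> {}" "closed X" "convex X" "bounded X"
    and Y: "Y \<noteq> {}" "closed Y" "convex Y" "bounded Y"
    and constants: "0 < Lx" "0 < Ly" "0 < Lxy" "0 \<le> \<sigma>x" "0 \<le> \<sigma>y"
    and f_smooth: "convex_smooth id X Lx f gradf"
    and g_smooth: "convex_smooth id Y Ly g gradg"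
    and B: "linear B" "onorm B \<le> Lxy"
    and Gf_measurable: "(\<lambda>(v, x). Gf v x) \<in> borel_measurable (restrict_space borel X \<Otimes>\<^sub>M S)"
    and Gg_measurable: "(\<lambda>(v, x). Gg v x) \<in> borel_measurable (restrict_space borel Y \<Otimes>\<^sub>M S)"
    and z0: "z0 \<in> X \<times> Y"
    and radius_pos: "0 < sq_radius (X \<times> Y) z0"

text \<open>
  The samples of a run with iteration numbers \<open>T\<close> in which the component at level \<open>i\<close> is number
  \<open>\<pi> i\<close>. Each gradient oracle is constrained only at the nodes where it is called.
\<close>
definition bilinear_samples ::
  "'w measure \<Rightarrow> (nat list \<Rightarrow> 'w \<Rightarrow> 's) \<Rightarrow> (nat \<Rightarrow> nat) \<Rightarrow> (nat \<Rightarrow> nat) \<Rightarrow>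
   'x::euclidean_space set \<Rightarrow> 'y::euclidean_space set \<Rightarrow> ('x \<Rightarrow> 'x) \<Rightarrow> ('y \<Rightarrow> 'y) \<Rightarrow>
   real \<Rightarrow> real \<Rightarrow> 's measure \<Rightarrow> ('x \<Rightarrow> 's \<Rightarrow> 'x) \<Rightarrow> ('y \<Rightarrow> 's \<Rightarrow> 'y) \<Rightarrow> 'x \<times> 'y \<Rightarrow> bool" where
  "bilinear_samples Pr \<xi> \<pi> T X Y gradf gradg \<sigma>x \<sigma>y S Gf Gg z0 \<longleftrightarrow>
     prob_space Pr \<and>
     (\<forall>\<nu>\<in>nodes 3 T. \<xi> \<nu> \<in> measurable Pr S) \<and>
     (\<forall>\<nu>\<in>nodes 3 T. \<pi> (length \<nu>) = 1 \<longrightarrow>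
        unbiased_oracle Pr (node_history 3 T Pr S (\<lambda>_. z0) \<xi> \<nu>) norm \<sigma>x X gradf Gf (\<xi> \<nu>)) \<and>
     (\<forall>\<nu>\<in>nodes 3 T. \<pi> (length \<nu>) = 2 \<longrightarrow>
        unbiased_oracle Pr (node_history 3 T Pr S (\<lambda>_. z0) \<xi> \<nu>) norm \<sigma>y Y gradg Gg (\<xi> \<nu>))"

definition bilinear_run ::
  "(nat \<Rightarrow> nat) \<Rightarrow> (nat \<Rightarrow> nat) \<Rightarrow> 'x::euclidean_space set \<Rightarrow> 'y::euclidean_space set \<Rightarrow>
   ('x \<Rightarrow> 'y) \<Rightarrow> ('x \<Rightarrow> 's \<Rightarrow> 'x) \<Rightarrow> ('y \<Rightarrow> 's \<Rightarrow> 'y) \<Rightarrow>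
   real \<Rightarrow> real \<Rightarrow> real \<Rightarrow> real \<Rightarrow> real \<Rightarrow> 'x \<times> 'y \<Rightarrow> (nat list \<Rightarrow> 's) \<Rightarrow>
   ('x \<times> 'y) \<times> ('x \<times> 'y) sliding_state" where
  "bilinear_run \<pi> T X Y B Gf Gg Lx Ly Lxy \<sigma>x \<sigma>y z0 x =
     tuned_run 3 T (X \<times> Y) id (bil_Q B \<circ> \<pi>) (bil_G Gf Gg \<circ> \<pi>)
       (bil_const Lx Ly 0 \<circ> \<pi>) (bil_const 0 0 Lxy \<circ> \<pi>) (bil_const \<sigma>x \<sigma>y 0 \<circ> \<pi>)
       (sq_radius (X \<times> Y) z0) z0 x"

definition f_samples :: "(nat \<Rightarrow> nat) \<Rightarrow> 'z sliding_state \<Rightarrow> nat" where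
  "f_samples \<pi> s = Gcount s (inv \<pi> 1)"

definition g_samples :: "(nat \<Rightarrow> nat) \<Rightarrow> 'z sliding_state \<Rightarrow> nat" where
  "g_samples \<pi> s = Gcount s (inv \<pi> 2)"

text \<open>One evaluation of the coupling operator is a product with \<open>B\<close> and one with its adjoint.\<close>
definition B_products :: "(nat \<Rightarrow> nat) \<Rightarrow> 'z sliding_state \<Rightarrow> nat" where
  "B_products \<pi> s = 2 * Qcount s (inv \<pi> 3)"

text \<open>
  The absolute constant hidden in the complexity bounds, named for the same reason as
  \<^const>\<open>budget_const\<close>.
\<close>
definition bilinear_const :: real where
  "bilinear_const = 8 * (3 * budget_const 3 + 1)"

end

theory Submission
  imports Defs "HOL-Library.Sublist"
begin

text \<open>
  The run is analysed in two stages: a deterministic inequality for each realisation of the oracle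
  answers, and its expectation.

  Put \<open>\<theta>\<^sub>t = 1/\<alpha>\<^sub>t\<close>, so that \<open>\<theta>\<^sub>t\<^sub>+\<^sub>1\<^sup>2 - \<theta>\<^sub>t\<^sub>+\<^sub>1 = \<theta>\<^sub>t\<^sup>2\<close> and \<open>\<Sum>\<^sub>t\<^sub><\<^sub>T \<theta>\<^sub>t = \<theta>\<^sub>T\<^sub>-\<^sub>1\<^sup>2\<close>. The point returned at a node
  is the mean of the points returned by its children with weights \<open>\<theta>\<^sub>t / \<theta>\<^sub>T\<^sub>-\<^sub>1\<^sup>2\<close>; multiplying along
  the index gives \<open>weight\<close>, and the output is the weighted mean over any level. For the smooth part,
  each loop is an accelerated gradient scheme for the composition of \<open>p\<^sub>i\<close> with the averaging maps
  of the enclosing loops (\<open>smooth_descent\<close>), which produces the factor \<open>rate i ^ 2\<close>, where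
  \<open>rate i\<close> is the product of the \<open>1/\<theta>\<close> at the ends of the loops \<open>1,\<dots>,i\<close>. For the operator part,
  each proximal step at a node is an extragradient step. The optimality conditions of all leaf steps
  are averaged and, by Jensen's inequality, pushed up to the level of each component
  (\<open>sum_residual\<close>). The step sizes make \<open>weight t * \<eta> t\<close> equal to a constant \<open>modulus i\<close> on
  level \<open>i\<close>, and the copying of iterates strings the iterates of a level together into one sequence, so
  the distances to a competitor telescope over the whole level (\<open>telescope_level\<close>). What remains
  is \<open>modulus i / 2\<close> times the initial squared distance, and the noise (\<open>gap_term_bound\<close>).

  The share \<open>\<tau>\<^sub>i\<close> of the modulus pays for the correlation of an error with the step that it causes.
  The rest of the noise splits into a martingale part, which has mean zero because the iterates are
  adapted (\<open>iterates_measurable\<close>), and the pairing of the competitor with the single vector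
  \<open>\<Sum>\<^sub>t weight t \<epsilon>\<^sub>t\<close>, which is bounded uniformly in the competitor by the dual norm of this vector.
  Its second moment is \<open>\<sigma>\<^sub>i\<^sup>2 \<Sum>\<^sub>t (weight t)\<^sup>2\<close> at most, as errors at different nodes are
  uncorrelated (\<open>weighted_noise_second_moment\<close>). The given \<open>\<tau>\<^sub>i\<close> balances its two contributions
  (\<open>level_error_bound\<close>).

  Budgets that are nondecreasing in the level are realised by integers chosen greedily
  (\<open>ex_iteration_numbers\<close>), and the bilinear problem is an instance once functions of one block of
  variables are pulled back to the product space.
\<close>

section \<open>The geometry of a positive definite form\<close>

lemma pnorm_sq:
  assumes "sym_pos_def P"
  shows "(pnorm P u)\<^sup>2 = P u \<bullet> u" and "0 \<le> P u \<bullet> u"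
proof -
  show nn: "0 \<le> P u \<bullet> u"
    using assms by (cases "u = 0") (auto simp: sym_pos_def_def less_imp_le)
  then show "(pnorm P u)\<^sup>2 = P u \<bullet> u" by (simp add: pnorm_def)
qed

lemma pnorm_nonneg [simp]: "sym_pos_def P \<Longrightarrow> 0 \<le> pnorm P u"
  using pnorm_sq(2)[of P u] by (simp add: pnorm_def)

lemma sym_pos_def_linear: "sym_pos_def P \<Longrightarrow> linear P"
  and sym_pos_def_sym: "sym_pos_def P \<Longrightarrow> P u \<bullet> v = u \<bullet> P v"
  by (auto simp: sym_pos_def_def)

lemma sym_pos_def_inv:
  assumes "sym_pos_def P"
  shows "P (inv P s) = s" and "inv P (P s) = s" and "linear (inv P)"
proof -
  have lin: "linear P" using assms by (rule sym_pos_def_linear)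
  have "inj P"
    using assms by (subst linear_injective_0[OF lin]) (force simp: sym_pos_def_def)
  then have "surj P" using linear_injective_imp_surjective[OF lin] by auto
  show "P (inv P s) = s" by (rule surj_f_inv_f[OF \<open>surj P\<close>])
  show "inv P (P s) = s" by (rule inv_f_f[OF \<open>inj P\<close>])
  show "linear (inv P)"
    using lin \<open>inj P\<close> \<open>surj P\<close> bij_def inj_linear_imp_inv_linear by blast
qed

lemma dual_pnorm_eq: "sym_pos_def P \<Longrightarrow> dual_pnorm P s = pnorm P (inv P s)"
  by (simp add: dual_pnorm_def pnorm_def sym_pos_def_inv)

lemma dual_pnorm_sq:
  assumes "sym_pos_def P"
  shows "(dual_pnorm P s)\<^sup>2 = s \<bullet> inv P s"
  using pnorm_sq[OF assms, of "inv P s"] assms by (simp add: dual_pnorm_eq sym_pos_def_inv)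

lemma dual_pnorm_nonneg [simp]: "sym_pos_def P \<Longrightarrow> 0 \<le> dual_pnorm P u"
  by (simp add: dual_pnorm_eq)

lemma pnorm_minus_commute: "sym_pos_def P \<Longrightarrow> pnorm P (u - v) = pnorm P (v - u)"
  by (simp add: pnorm_def linear_diff[OF sym_pos_def_linear] algebra_simps inner_diff_left inner_diff_right)

lemma pnorm_scaleR: "sym_pos_def P \<Longrightarrow> pnorm P (c *\<^sub>R u) = \<bar>c\<bar> * pnorm P u"
  by (simp add: pnorm_def linear_scale[OF sym_pos_def_linear] real_sqrt_mult)

lemma pnorm_sq_add:
  assumes "sym_pos_def P"
  shows "(pnorm P (u + v))\<^sup>2 = (pnorm P u)\<^sup>2 + 2 * (P u \<bullet> v) + (pnorm P v)\<^sup>2"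
proof -
  have "P v \<bullet> u = P u \<bullet> v" using sym_pos_def_sym[OF assms, of v u] by (simp add: inner_commute)
  then show ?thesis
    by (simp add: pnorm_sq[OF assms] linear_add[OF sym_pos_def_linear[OF assms]] inner_add_left inner_add_right)
qed

lemma pnorm_sq_scaleR: "sym_pos_def P \<Longrightarrow> (pnorm P (c *\<^sub>R u))\<^sup>2 = c\<^sup>2 * (pnorm P u)\<^sup>2"
  by (simp add: pnorm_scaleR power_mult_distrib)

lemma pnorm_dual_Young:
  assumes P: "sym_pos_def P" and a: "0 < a"
  shows "s \<bullet> h \<le> (dual_pnorm P s)\<^sup>2 / (2 * a) + a / 2 * (pnorm P h)\<^sup>2"
proof -
  \<comment> \<open>the square of \<open>P\<^sup>-\<^sup>1 s - a h\<close>\<close>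
  have "0 \<le> (pnorm P (inv P s + (- a) *\<^sub>R h))\<^sup>2" by simp
  also have "\<dots> = (dual_pnorm P s)\<^sup>2 - 2 * a * (s \<bullet> h) + a\<^sup>2 * (pnorm P h)\<^sup>2"
    by (subst pnorm_sq_add[OF P]) (simp add: dual_pnorm_eq P pnorm_sq_scaleR[OF P] sym_pos_def_inv del: scaleR_minus_left)
  finally have "2 * a * (s \<bullet> h) \<le> (dual_pnorm P s)\<^sup>2 + a\<^sup>2 * (pnorm P h)\<^sup>2" by simp
  then show ?thesis using a by (simp add: field_simps power2_eq_square)
qed

lemma pnorm_dual_Cauchy_Schwarz:
  assumes P: "sym_pos_def P"
  shows "s \<bullet> h \<le> dual_pnorm P s * pnorm P h"
proof (cases "h = 0")
  case False
  define D N where "D = dual_pnorm P s" and "N = (pnorm P h)\<^sup>2"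
  have N: "0 < N" using P False by (auto simp: N_def pnorm_sq(1)[OF P] sym_pos_def_def)
  \<comment> \<open>the residual of projecting \<open>P\<^sup>-\<^sup>1 s\<close> onto \<open>h\<close>, scaled by \<open>N\<close>\<close>
  have "0 \<le> (pnorm P (N *\<^sub>R inv P s + (- (s \<bullet> h)) *\<^sub>R h))\<^sup>2" by simp
  also have "\<dots> = N * (N * D\<^sup>2 - (s \<bullet> h)\<^sup>2)"
    by (subst pnorm_sq_add[OF P])
       (simp add: pnorm_sq_scaleR[OF P] linear_scale[OF sym_pos_def_linear[OF P]] sym_pos_def_inv[OF P]
         dual_pnorm_eq[OF P] D_def N_def[symmetric] del: scaleR_minus_left,
        simp add: power2_eq_square algebra_simps)
  finally have "(s \<bullet> h)\<^sup>2 \<le> N * D\<^sup>2" using N by (simp add: zero_le_mult_iff)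
  then have "(s \<bullet> h)\<^sup>2 \<le> (D * pnorm P h)\<^sup>2" by (simp add: N_def power_mult_distrib mult.commute)
  then show ?thesis
    using P by (intro power2_le_imp_le[of "s \<bullet> h" "dual_pnorm P s * pnorm P h"]) (simp_all add: D_def)
qed (simp add: pnorm_def)

text \<open>
  Transfers topological facts, which refer to the Euclidean norm: continuity of Lipschitz operators,
  and square integrability of the oracle errors.
\<close>
lemma pnorm_norm_equiv:
  assumes P: "sym_pos_def (P :: 'z::euclidean_space \<Rightarrow> 'z)"
  obtains c where "0 < c" and "\<And>u. pnorm P u \<le> c * norm u" and "\<And>u. norm u \<le> c * pnorm P u"
    and "\<And>u. dual_pnorm P u \<le> c * norm u" and "\<And>u. norm u \<le> c * dual_pnorm P u"
proof -
  have sqrt_bound: "\<exists>c>0. \<forall>u. pnorm R u \<le> c * norm u" if R: "linear R" for R :: "'z \<Rightarrow> 'z"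
  proof -
    obtain K where K: "0 < K" "\<And>u. norm (R u) \<le> norm u * K"
      using bounded_linear.pos_bounded[OF linear_conv_bounded_linear[THEN iffD1, OF R]] by auto
    have "pnorm R u \<le> sqrt K * norm u" for u
    proof -
      have "R u \<bullet> u \<le> norm (R u) * norm u" by (rule norm_cauchy_schwarz)
      also have "\<dots> \<le> (norm u * K) * norm u" using K(2) by (intro mult_right_mono) auto
      also have "\<dots> = (sqrt K * norm u)\<^sup>2" using K(1) by (simp add: power_mult_distrib power2_eq_square)
      finally show ?thesis
        unfolding pnorm_def using K(1) by (intro real_le_lsqrt) auto
    qed
    then show ?thesis using K(1) by (intro exI[of _ "sqrt K"]) auto
  qed
  obtain c1 where c1: "0 < c1" "\<And>u. pnorm P u \<le> c1 * norm u"
    using sqrt_bound[OF sym_pos_def_linear[OF P]] by auto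
  obtain c2 where c2: "0 < c2" "\<And>u. pnorm (inv P) u \<le> c2 * norm u"
    using sqrt_bound[OF sym_pos_def_inv(3)[OF P]] by auto
  have d2: "dual_pnorm P u \<le> c2 * norm u" for u
    using c2(2)[of u] by (simp add: dual_pnorm_def pnorm_def inner_commute)
  have n1: "norm u \<le> c2 * pnorm P u" and n2: "norm u \<le> c1 * dual_pnorm P u" for u
  proof -
    have *: "norm u * norm u \<le> dual_pnorm P u * pnorm P u"
      using pnorm_dual_Cauchy_Schwarz[OF P, of u u] by (simp add: dot_square_norm power2_eq_square)
    have "norm u * norm u \<le> (c2 * norm u) * pnorm P u"
      using P by (intro order.trans[OF *] mult_right_mono d2) auto
    then show "norm u \<le> c2 * pnorm P u"
      using c2(1) P by (cases "u = 0") (auto simp: mult.assoc mult.left_commute[of c2])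
    have "norm u * norm u \<le> dual_pnorm P u * (c1 * norm u)"
      using P by (intro order.trans[OF *] mult_left_mono c1(2)) auto
    then show "norm u \<le> c1 * dual_pnorm P u"
      using c1(1) P by (cases "u = 0") (auto simp: mult.assoc[symmetric] mult.commute[of c1])
  qed
  have max: "a * b \<le> max c1 c2 * b" if "a \<le> max c1 c2" "0 \<le> b" for a b
    using that by (rule mult_right_mono)
  show ?thesis
  proof (rule that[of "max c1 c2"])
    fix u
    show "0 < max c1 c2" using c1 by simp
    show "pnorm P u \<le> max c1 c2 * norm u" by (rule order.trans[OF c1(2) max]) auto
    show "norm u \<le> max c1 c2 * pnorm P u" by (rule order.trans[OF n1 max]) (use P in auto)
    show "dual_pnorm P u \<le> max c1 c2 * norm u" by (rule order.trans[OF d2 max]) auto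
    show "norm u \<le> max c1 c2 * dual_pnorm P u" by (rule order.trans[OF n2 max]) (use P in auto)
  qed
qed

lemma lipschitz_op_continuous_on:
  assumes P: "sym_pos_def P" and G: "lipschitz_op P Z M G"
  shows "continuous_on Z G"
proof -
  obtain c where c: "0 < c" "\<And>u. pnorm P u \<le> c * norm u" "\<And>u. norm u \<le> c * dual_pnorm P u"
    using pnorm_norm_equiv[OF P] by metis
  have "(c * (\<bar>M\<bar> * c))-lipschitz_on Z G"
  proof (rule lipschitz_onI)
    fix u v assume uv: "u \<in> Z" "v \<in> Z"
    have "norm (G u - G v) \<le> c * dual_pnorm P (G u - G v)" by (rule c(3))
    also have "\<dots> \<le> c * (M * pnorm P (u - v))"
      using G uv c(1) by (intro mult_left_mono) (auto simp: lipschitz_op_def)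
    also have "\<dots> \<le> c * (\<bar>M\<bar> * pnorm P (u - v))"
      using c(1) P by (intro mult_left_mono mult_right_mono) auto
    also have "\<dots> \<le> c * (\<bar>M\<bar> * (c * norm (u - v)))"
      using c(1,2) by (intro mult_left_mono) auto
    finally show "dist (G u) (G v) \<le> c * (\<bar>M\<bar> * c) * dist u v"
      by (simp add: dist_norm mult.assoc)
  qed (use c(1) in auto)
  then show ?thesis by (rule lipschitz_on_continuous_on)
qed

lemma continuous_on_pnorm [continuous_intros]:
  assumes "sym_pos_def P" and "continuous_on S h"
  shows "continuous_on S (\<lambda>x. pnorm P (h x))"
proof -
  have "continuous_on UNIV P"
    using sym_pos_def_linear[OF assms(1)] linear_continuous_on linear_conv_bounded_linear by blast
  then have "continuous_on S (\<lambda>x. P (h x))"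
    by (rule continuous_on_compose2) (use assms(2) in auto)
  then show ?thesis unfolding pnorm_def by (intro continuous_intros assms(2))
qed

lemma convex_on_pnorm_sq:
  assumes P: "sym_pos_def P" and "convex Z"
  shows "convex_on Z (\<lambda>x. (pnorm P (x - a))\<^sup>2)"
proof (rule convex_onI)
  fix t :: real and x y assume t: "0 < t" "t < 1"
  define u v where "u = x - a" and "v = y - a"
  have *: "(1 - t) *\<^sub>R x + t *\<^sub>R y - a = u + t *\<^sub>R (v - u)"
    by (simp add: u_def v_def algebra_simps)
  have v: "(pnorm P v)\<^sup>2 = (pnorm P u)\<^sup>2 + 2 * (P u \<bullet> (v - u)) + (pnorm P (v - u))\<^sup>2"
    using pnorm_sq_add[OF P, of u "v - u"] by simp
  have "(pnorm P (u + t *\<^sub>R (v - u)))\<^sup>2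
      = (pnorm P u)\<^sup>2 + 2 * t * (P u \<bullet> (v - u)) + t\<^sup>2 * (pnorm P (v - u))\<^sup>2"
    by (subst pnorm_sq_add[OF P]) (simp add: pnorm_sq_scaleR[OF P])
  also have "\<dots> \<le> (pnorm P u)\<^sup>2 + 2 * t * (P u \<bullet> (v - u)) + t * (pnorm P (v - u))\<^sup>2"
    using t by (intro add_left_mono mult_right_mono) (auto simp: power2_eq_square mult_left_le)
  also have "\<dots> = (1 - t) * (pnorm P u)\<^sup>2 + t * (pnorm P v)\<^sup>2"
    unfolding v by (simp add: algebra_simps)
  finally show "(pnorm P ((1 - t) *\<^sub>R x + t *\<^sub>R y - a))\<^sup>2
      \<le> (1 - t) * (pnorm P (x - a))\<^sup>2 + t * (pnorm P (y - a))\<^sup>2"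
    unfolding * by (simp add: u_def v_def)
qed fact


section \<open>Convex functions with Lipschitz gradient\<close>

text \<open>
  Restriction to segments avoids the interior of \<open>Z\<close>, which may be empty.
\<close>
lemma has_real_derivative_along_segment:
  assumes "convex Z" and uv: "u \<in> Z" "v \<in> Z" and s: "s \<in> {0..1}"
    and f: "\<And>x. x \<in> Z \<Longrightarrow> (f has_derivative (\<lambda>h. grad x \<bullet> h)) (at x within Z)"
  shows "((\<lambda>s. f (v + s *\<^sub>R (u - v))) has_real_derivative grad (v + s *\<^sub>R (u - v)) \<bullet> (u - v))
           (at s within {0..1})"
    and "v + s *\<^sub>R (u - v) \<in> Z"
proof -
  have seg: "v + s *\<^sub>R (u - v) \<in> Z" if "s \<in> {0..1}" for s
  proof -
    have "v + s *\<^sub>R (u - v) = (1 - s) *\<^sub>R v + s *\<^sub>R u" by (simp add: algebra_simps)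
    then show ?thesis using convexD_alt[OF \<open>convex Z\<close> uv(2,1)] that by auto
  qed
  then show inZ: "v + s *\<^sub>R (u - v) \<in> Z" using s by blast
  have "((\<lambda>s. v + s *\<^sub>R (u - v)) has_derivative (\<lambda>h. h *\<^sub>R (u - v))) (at s within {0..1})"
    by (auto intro!: derivative_eq_intros)
  moreover have "(f has_derivative (\<lambda>h. grad (v + s *\<^sub>R (u - v)) \<bullet> h))
      (at (v + s *\<^sub>R (u - v)) within (\<lambda>s. v + s *\<^sub>R (u - v)) ` {0..1})"
    by (rule has_derivative_subset[OF f[OF inZ]]) (use seg in auto)
  ultimately have "((\<lambda>s. f (v + s *\<^sub>R (u - v))) has_derivative
      (\<lambda>h. grad (v + s *\<^sub>R (u - v)) \<bullet> (h *\<^sub>R (u - v)))) (at s within {0..1})"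
    by (rule has_derivative_in_compose)
  moreover have "(\<lambda>h. grad (v + s *\<^sub>R (u - v)) \<bullet> (h *\<^sub>R (u - v)))
      = (*) (grad (v + s *\<^sub>R (u - v)) \<bullet> (u - v))"
    by (auto simp: mult.commute)
  ultimately show "((\<lambda>s. f (v + s *\<^sub>R (u - v))) has_real_derivative
      grad (v + s *\<^sub>R (u - v)) \<bullet> (u - v)) (at s within {0..1})"
    by (simp add: has_field_derivative_def)
qed

text \<open>
  The difference quotients at \<open>v\<close> towards \<open>u\<close> are bounded by the slope of the chord.
\<close>
lemma convex_smooth_lower:
  assumes Z: "convex Z" and f: "convex_smooth P Z L f grad" and uv: "u \<in> Z" "v \<in> Z"
  shows "f v + grad v \<bullet> (u - v) \<le> f u"
proof -
  define \<phi> where "\<phi> s = f (v + s *\<^sub>R (u - v))" for s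
  have fd: "\<And>x. x \<in> Z \<Longrightarrow> (f has_derivative (\<lambda>h. grad x \<bullet> h)) (at x within Z)"
    and cvx: "convex_on Z f"
    using f by (auto simp: convex_smooth_def)
  have "(\<phi> has_real_derivative grad v \<bullet> (u - v)) (at 0 within {0..1})"
    using has_real_derivative_along_segment(1)[OF Z uv _ fd, where s=0] by (simp add: \<phi>_def[abs_def])
  then have lim: "((\<lambda>s. (\<phi> s - \<phi> 0) / (s - 0)) \<longlongrightarrow> grad v \<bullet> (u - v)) (at 0 within {0..1})"
    by (simp add: has_field_derivative_iff)
  have "\<forall>\<^sub>F s in at 0 within {0..1::real}. (\<phi> s - \<phi> 0) / (s - 0) \<le> f u - f v"
  proof -
    have "(\<phi> s - \<phi> 0) / (s - 0) \<le> f u - f v" if "s \<in> {0..1}" "s \<noteq> 0" for s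
    proof -
      have "v + s *\<^sub>R (u - v) = (1 - s) *\<^sub>R v + s *\<^sub>R u" by (simp add: algebra_simps)
      then have "\<phi> s \<le> (1 - s) * f v + s * f u"
        unfolding \<phi>_def using convex_onD[OF cvx, of s v u] that uv by auto
      then have "\<phi> s - \<phi> 0 \<le> s * (f u - f v)" by (simp add: \<phi>_def algebra_simps)
      then show ?thesis using that by (simp add: field_simps)
    qed
    then show ?thesis by (auto simp: eventually_at_filter)
  qed
  moreover have "at 0 within {0..1::real} \<noteq> bot"
    by (simp add: at_within_Icc_at_right)
  ultimately have "grad v \<bullet> (u - v) \<le> f u - f v"
    using tendsto_upperbound[OF lim] by blast
  then show ?thesis by simp
qed

lemma convex_smooth_upper:
  assumes P: "sym_pos_def P" and Z: "convex Z" and f: "convex_smooth P Z L f grad"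
    and uv: "u \<in> Z" "v \<in> Z"
  shows "f u \<le> f v + grad v \<bullet> (u - v) + L / 2 * (pnorm P (u - v))\<^sup>2"
proof -
  have fd: "\<And>x. x \<in> Z \<Longrightarrow> (f has_derivative (\<lambda>h. grad x \<bullet> h)) (at x within Z)"
    and lip: "lipschitz_op P Z L grad"
    using f by (auto simp: convex_smooth_def)
  define N where "N = (pnorm P (u - v))\<^sup>2"
  \<comment> \<open>\<open>f\<close> along the segment minus its quadratic majorant decreases\<close>
  define \<psi> where "\<psi> s = f (v + s *\<^sub>R (u - v)) - s * (grad v \<bullet> (u - v)) - L / 2 * N * s\<^sup>2" for s
  define \<psi>' where "\<psi>' s = grad (v + s *\<^sub>R (u - v)) \<bullet> (u - v) - grad v \<bullet> (u - v) - L * N * s" for s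
  have der: "(\<psi> has_real_derivative \<psi>' s) (at s within {0..1})" if "s \<in> {0..1}" for s
  proof -
    have "((\<lambda>s. s * (grad v \<bullet> (u - v))) has_real_derivative grad v \<bullet> (u - v)) (at s within {0..1})"
      and "((\<lambda>s. L / 2 * N * s\<^sup>2) has_real_derivative L * N * s) (at s within {0..1})"
      by (auto intro!: derivative_eq_intros)
    then show ?thesis
      unfolding \<psi>_def \<psi>'_def
      by (intro DERIV_diff has_real_derivative_along_segment(1)[OF Z uv that fd])
  qed
  have neg: "\<psi>' s \<le> 0" if s: "s \<in> {0..1}" for s
  proof -
    have x: "v + s *\<^sub>R (u - v) \<in> Z" by (rule has_real_derivative_along_segment(2)[OF Z uv s fd])
    let ?x = "v + s *\<^sub>R (u - v)"
    have "(grad ?x - grad v) \<bullet> (u - v) \<le> dual_pnorm P (grad ?x - grad v) * pnorm P (u - v)"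
      by (rule pnorm_dual_Cauchy_Schwarz[OF P])
    also have "\<dots> \<le> (L * pnorm P (?x - v)) * pnorm P (u - v)"
      using lip[unfolded lipschitz_op_def, rule_format, OF x uv(2)] P
      by (intro mult_right_mono) auto
    also have "\<dots> = L * N * s"
      using that by (simp add: pnorm_scaleR[OF P] N_def power2_eq_square)
    finally show ?thesis by (simp add: \<psi>'_def inner_diff_left)
  qed
  have "\<psi> 1 \<le> \<psi> 0"
  proof (rule DERIV_nonpos_imp_decreasing_open[of 0 1 \<psi>])
    show "\<exists>y. DERIV \<psi> s :> y \<and> y \<le> 0" if "0 < s" "s < 1" for s
      using der[of s] neg[of s] that at_within_Icc_at[of 0 s 1] by (intro exI[of _ "\<psi>' s"]) auto
    show "continuous_on {0..1} \<psi>"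
      using der by (intro DERIV_continuous_on) auto
  qed simp
  then show ?thesis by (simp add: \<psi>_def N_def)
qed

section \<open>The proximal step\<close>

lemma arg_min_on_compact:
  fixes F :: "'z::euclidean_space \<Rightarrow> real"
  assumes "compact Z" "Z \<noteq> {}" "continuous_on Z F"
  shows "arg_min_on F Z \<in> Z" and "\<And>u. u \<in> Z \<Longrightarrow> F (arg_min_on F Z) \<le> F u"
proof -
  obtain x where "x \<in> Z" "\<forall>u\<in>Z. F x \<le> F u"
    using continuous_attains_inf[OF assms] by blast
  then have "is_arg_min F (\<lambda>z. z \<in> Z) x" by (simp add: is_arg_min_linorder)
  then have "is_arg_min F (\<lambda>z. z \<in> Z) (arg_min_on F Z)"
    unfolding arg_min_on_def arg_min_def by (rule someI)
  then show "arg_min_on F Z \<in> Z" "\<And>u. u \<in> Z \<Longrightarrow> F (arg_min_on F Z) \<le> F u"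
    by (auto simp: is_arg_min_linorder)
qed

definition prox_objective ::
  "('z::euclidean_space \<Rightarrow> 'z) \<Rightarrow> 'i set \<Rightarrow> ('i \<Rightarrow> real) \<Rightarrow> ('i \<Rightarrow> 'z) \<Rightarrow> ('i \<Rightarrow> 'z) \<Rightarrow> 'z \<Rightarrow> real" where
  "prox_objective P I \<eta> g c z = (\<Sum>i\<in>I. g i \<bullet> z + 1/2 * \<eta> i * (pnorm P (z - c i))\<^sup>2)"

lemma continuous_on_prox_objective: "sym_pos_def P \<Longrightarrow> continuous_on Z (prox_objective P I \<eta> g c)"
  unfolding prox_objective_def by (intro continuous_intros) auto

text \<open>
  First-order optimality along the segment from the minimiser \<open>x\<close> to \<open>u\<close>; as the objective is
  exactly quadratic, the optimality condition becomes a three-point inequality with equality in the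
  quadratic parts.
\<close>
lemma prox_three_point:
  assumes P: "sym_pos_def P" and Z: "convex Z" and x: "x \<in> Z" and u: "u \<in> Z"
    and min: "\<And>v. v \<in> Z \<Longrightarrow> prox_objective P I \<eta> g c x \<le> prox_objective P I \<eta> g c v"
  shows "(\<Sum>i\<in>I. g i \<bullet> (x - u))
    \<le> (\<Sum>i\<in>I. \<eta> i / 2 * ((pnorm P (u - c i))\<^sup>2 - (pnorm P (x - c i))\<^sup>2 - (pnorm P (u - x))\<^sup>2))"
proof -
  define h where "h = u - x"
  define a where "a = (\<Sum>i\<in>I. g i \<bullet> h + \<eta> i * (P (x - c i) \<bullet> h))"
  define b where "b = (\<Sum>i\<in>I. \<eta> i / 2 * (pnorm P h)\<^sup>2)"
  have expand: "prox_objective P I \<eta> g c (x + s *\<^sub>R h) = prox_objective P I \<eta> g c x + (s * a + s\<^sup>2 * b)" for s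
  proof -
    have "(pnorm P (x + s *\<^sub>R h - c i))\<^sup>2
        = (pnorm P (x - c i))\<^sup>2 + 2 * s * (P (x - c i) \<bullet> h) + s\<^sup>2 * (pnorm P h)\<^sup>2" for i
      using pnorm_sq_add[OF P, of "x - c i" "s *\<^sub>R h"]
      by (simp add: pnorm_sq_scaleR[OF P] algebra_simps)
    then show ?thesis
      unfolding prox_objective_def a_def b_def
      by (simp add: sum_distrib_left sum.distrib[symmetric] inner_add_right algebra_simps
          cong: sum.cong)
  qed
  have pos: "0 \<le> a + s * b" if s: "0 < s" "s \<le> 1" for s
  proof -
    have "x + s *\<^sub>R h = (1 - s) *\<^sub>R x + s *\<^sub>R u" by (simp add: h_def algebra_simps)
    then have "x + s *\<^sub>R h \<in> Z" using convexD_alt[OF Z x u, of s] s by simp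
    then have "0 \<le> s * a + s\<^sup>2 * b" using min[of "x + s *\<^sub>R h"] by (simp add: expand)
    then have "0 \<le> s * (a + s * b)" by (simp add: power2_eq_square algebra_simps)
    then show ?thesis using s by (simp add: zero_le_mult_iff)
  qed
  have "((\<lambda>s. a + s * b) \<longlongrightarrow> a + 0 * b) (at_right 0)" by (intro tendsto_intros)
  moreover have "\<forall>\<^sub>F s in at_right 0. 0 \<le> a + s * b"
    unfolding eventually_at_right_field using pos by (intro exI[of _ 1]) auto
  ultimately have "0 \<le> a"
    using tendsto_lowerbound[of "\<lambda>s. a + s * b" "a + 0 * b"] by (simp add: trivial_limit_at_right_real)
  also have "a = (\<Sum>i\<in>I. g i \<bullet> h)
      + (\<Sum>i\<in>I. \<eta> i / 2 * ((pnorm P (u - c i))\<^sup>2 - (pnorm P (x - c i))\<^sup>2 - (pnorm P (u - x))\<^sup>2))"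
  proof -
    have "\<eta> i / 2 * ((pnorm P (u - c i))\<^sup>2 - (pnorm P (x - c i))\<^sup>2 - (pnorm P (u - x))\<^sup>2)
        = \<eta> i * (P (x - c i) \<bullet> h)" for i
      using pnorm_sq_add[OF P, of "x - c i" h] by (simp add: h_def)
    then show ?thesis by (simp only: a_def sum.distrib)
  qed
  also have "(\<Sum>i\<in>I. g i \<bullet> h) = - (\<Sum>i\<in>I. g i \<bullet> (x - u))"
    by (simp add: h_def inner_diff_right flip: sum_negf)
  finally show ?thesis by simp
qed

text \<open>
  All data of a proximal step enter through one linear term, up to a constant.
\<close>
lemma prox_objective_normal_form:
  assumes P: "sym_pos_def P"
  shows "prox_objective P I \<eta> g c z
    = prox_objective P {()} (\<lambda>_. \<Sum>i\<in>I. \<eta> i) (\<lambda>_. \<Sum>i\<in>I. g i - \<eta> i *\<^sub>R P (c i)) (\<lambda>_. 0) z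
      + (\<Sum>i\<in>I. \<eta> i / 2 * (pnorm P (c i))\<^sup>2)"
proof -
  have sq: "(pnorm P (z - c i))\<^sup>2 = (pnorm P z)\<^sup>2 - 2 * (P (c i) \<bullet> z) + (pnorm P (c i))\<^sup>2" for i
    using pnorm_sq_add[OF P, of "- c i" z] pnorm_sq_scaleR[OF P, of "-1" "c i"]
    by (simp add: linear_neg[OF sym_pos_def_linear[OF P]])
  have "prox_objective P I \<eta> g c z
      = (\<Sum>i\<in>I. (g i - \<eta> i *\<^sub>R P (c i)) \<bullet> z + \<eta> i * (1 / 2 * (pnorm P z)\<^sup>2) + \<eta> i / 2 * (pnorm P (c i))\<^sup>2)"
    unfolding prox_objective_def sq by (intro sum.cong) (simp_all add: inner_diff_left field_simps)
  also have "\<dots> = (\<Sum>i\<in>I. g i - \<eta> i *\<^sub>R P (c i)) \<bullet> z + (\<Sum>i\<in>I. \<eta> i) * (1 / 2 * (pnorm P z)\<^sup>2)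
      + (\<Sum>i\<in>I. \<eta> i / 2 * (pnorm P (c i))\<^sup>2)"
    by (simp only: sum.distrib inner_sum_left sum_distrib_right)
  finally show ?thesis by (simp add: prox_objective_def)
qed

lemma arg_min_on_add_const:
  fixes F :: "'z \<Rightarrow> real"
  shows "arg_min_on (\<lambda>z. F z + k) Z = arg_min_on F Z"
  by (simp add: arg_min_on_def arg_min_def is_arg_min_def)

text \<open>
  The minimiser is a Lipschitz function of the linear term by strong convexity, so that measurable
  data have a measurable minimiser.
\<close>
lemma borel_measurable_prox:
  assumes P: "sym_pos_def P" and Z: "convex Z" "compact Z" "Z \<noteq> {}"
    and H: "0 < (\<Sum>i\<in>I. \<eta> i)"
    and meas: "\<And>i. i \<in> I \<Longrightarrow> (\<lambda>\<omega>. g \<omega> i) \<in> borel_measurable F" "\<And>i. i \<in> I \<Longrightarrow> (\<lambda>\<omega>. c \<omega> i) \<in> borel_measurable F"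
  shows "(\<lambda>\<omega>. arg_min_on (prox_objective P I \<eta> (g \<omega>) (c \<omega>)) Z) \<in> borel_measurable F"
proof -
  define H where "H = (\<Sum>i\<in>I. \<eta> i)"
  define obj where "obj b = prox_objective P {()} (\<lambda>_. H) (\<lambda>_. b) (\<lambda>_. 0)" for b
  define x where "x b = arg_min_on (obj b) Z" for b
  have xZ: "x b \<in> Z" and xmin: "\<And>u. u \<in> Z \<Longrightarrow> obj b (x b) \<le> obj b u" for b
    unfolding x_def obj_def
    using arg_min_on_compact[OF Z(2,3) continuous_on_prox_objective[OF P]] by blast+
  obtain k where k: "0 < k" "\<And>u. norm u \<le> k * pnorm P u"
    using pnorm_norm_equiv[OF P] by metis
  have "(k\<^sup>2 / H)-lipschitz_on UNIV x"
  proof (rule lipschitz_onI)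
    fix b b'
    define N where "N = (pnorm P (x b - x b'))\<^sup>2"
    have 1: "b \<bullet> (x b - x b') \<le> H / 2 * ((pnorm P (x b'))\<^sup>2 - (pnorm P (x b))\<^sup>2 - N)"
      using prox_three_point[OF P Z(1) xZ[of b] xZ[of b'] xmin[of _ b, unfolded obj_def]]
      by (simp add: N_def pnorm_minus_commute[OF P, of "x b'"])
    have 2: "b' \<bullet> (x b' - x b) \<le> H / 2 * ((pnorm P (x b))\<^sup>2 - (pnorm P (x b'))\<^sup>2 - N)"
      using prox_three_point[OF P Z(1) xZ[of b'] xZ[of b] xmin[of _ b', unfolded obj_def]]
      by (simp add: N_def)
    have "H * N \<le> (b' - b) \<bullet> (x b - x b')"
      using 1 2 by (simp add: inner_diff_left inner_diff_right algebra_simps)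
    also have "\<dots> \<le> norm (b' - b) * norm (x b - x b')" by (rule norm_cauchy_schwarz)
    finally have *: "H * N \<le> norm (b' - b) * norm (x b - x b')" .
    have "(norm (x b - x b'))\<^sup>2 \<le> (k * pnorm P (x b - x b'))\<^sup>2"
      using k(2) by (intro power_mono) auto
    then have "H * (norm (x b - x b'))\<^sup>2 \<le> k\<^sup>2 * (H * N)"
      using H by (simp add: N_def power_mult_distrib H_def)
    also have "\<dots> \<le> k\<^sup>2 * (norm (b' - b) * norm (x b - x b'))"
      using * by (intro mult_left_mono) auto
    finally have **: "norm (x b - x b') * (H * norm (x b - x b')) \<le> norm (x b - x b') * (k\<^sup>2 * norm (b' - b))"
      by (simp add: power2_eq_square mult_ac)
    have "H * norm (x b - x b') \<le> k\<^sup>2 * norm (b' - b)"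
    proof (cases "x b = x b'")
      case False
      then have "0 < norm (x b - x b')" by simp
      then show ?thesis using ** by (simp only: mult_le_cancel_left_pos)
    qed simp
    then show "dist (x b) (x b') \<le> k\<^sup>2 / H * dist b b'"
      using H by (simp add: dist_norm H_def field_simps norm_minus_commute)
  qed (use H in \<open>auto simp: H_def\<close>)
  then have x: "x \<in> borel_measurable borel"
    by (intro borel_measurable_continuous_onI lipschitz_on_continuous_on)
  have "P \<in> borel_measurable borel"
    using sym_pos_def_linear[OF P] linear_continuous_on linear_conv_bounded_linear
    by (intro borel_measurable_continuous_onI) blast
  then have "(\<lambda>\<omega>. \<Sum>i\<in>I. g \<omega> i - \<eta> i *\<^sub>R P (c \<omega> i)) \<in> borel_measurable F"
    by (intro borel_measurable_sum borel_measurable_diff borel_measurable_scaleR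
        borel_measurable_const measurable_compose[OF meas(2), of _ P borel] meas(1))
  then have "(\<lambda>\<omega>. x (\<Sum>i\<in>I. g \<omega> i - \<eta> i *\<^sub>R P (c \<omega> i))) \<in> borel_measurable F"
    by (rule measurable_compose[OF _ x])
  moreover have "arg_min_on (prox_objective P I \<eta> (g \<omega>) (c \<omega>)) Z = x (\<Sum>i\<in>I. g \<omega> i - \<eta> i *\<^sub>R P (c \<omega> i))" for \<omega>
  proof -
    have "prox_objective P I \<eta> (g \<omega>) (c \<omega>)
        = (\<lambda>z. obj (\<Sum>i\<in>I. g \<omega> i - \<eta> i *\<^sub>R P (c \<omega> i)) z + (\<Sum>i\<in>I. \<eta> i / 2 * (pnorm P (c \<omega> i))\<^sup>2))"
      by (rule ext) (simp add: prox_objective_normal_form[OF P, of I] obj_def H_def)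
    then show ?thesis by (simp add: arg_min_on_add_const x_def)
  qed
  ultimately show ?thesis by simp
qed


section \<open>The step sizes\<close>

lemma step_alpha_pos: "0 < step_alpha t"
  by (induction t) (auto intro!: divide_pos_pos add_pos_nonneg)

text \<open>The reciprocals \<open>\<theta>\<^sub>t\<close> of the step sizes solve \<open>\<theta>\<^sub>t\<^sub>+\<^sub>1\<^sup>2 - \<theta>\<^sub>t\<^sub>+\<^sub>1 = \<theta>\<^sub>t\<^sup>2\<close>.\<close>
definition theta :: "nat \<Rightarrow> real" where "theta t = 1 / step_alpha t"

lemma theta_pos [simp]: "0 < theta t"
  and step_alpha_eq: "step_alpha t = 1 / theta t"
  using step_alpha_pos[of t] by (simp_all add: theta_def)

lemma theta_nonneg_nonzero [simp]: "0 \<le> theta t" "theta t \<noteq> 0"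
  using theta_pos[of t] by linarith+

lemma theta_0 [simp]: "theta 0 = 1" by (simp add: theta_def)

lemma theta_Suc: "theta (Suc t) = (1 + sqrt (1 + 4 * (theta t)\<^sup>2)) / 2"
  by (simp add: theta_def power_divide)

lemma theta_recurrence: "(theta (Suc t))\<^sup>2 = (theta t)\<^sup>2 + theta (Suc t)"
proof -
  define r where "r = sqrt (1 + 4 * (theta t)\<^sup>2)"
  have "r * r = 1 + 4 * (theta t)\<^sup>2" by (simp add: r_def)
  then show ?thesis
    unfolding theta_Suc r_def[symmetric] by (simp add: power2_eq_square field_simps)
qed

lemma theta_ge: "(real t + 2) / 2 \<le> theta t" and theta_le: "theta t \<le> real t + 1"
proof -
  have step: "theta t + 1 / 2 \<le> theta (Suc t)" "theta (Suc t) \<le> theta t + 1" for t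
  proof -
    have "sqrt ((2 * theta t)\<^sup>2) \<le> sqrt (1 + 4 * (theta t)\<^sup>2)"
      by (intro real_sqrt_le_mono) (simp add: power_mult_distrib)
    then show "theta t + 1 / 2 \<le> theta (Suc t)"
      using theta_pos[of t] by (simp add: theta_Suc real_sqrt_mult)
    have "sqrt (1 + 4 * (theta t)\<^sup>2) \<le> 1 + 2 * theta t"
      using theta_pos[of t] by (intro real_le_lsqrt) (auto simp: power2_eq_square algebra_simps)
    then show "theta (Suc t) \<le> theta t + 1" by (simp add: theta_Suc)
  qed
  show "(real t + 2) / 2 \<le> theta t"
  proof (induction t)
    case (Suc t) then show ?case using step(1)[of t] by simp
  qed simp
  show "theta t \<le> real t + 1"
  proof (induction t)
    case (Suc t) then show ?case using step(2)[of t] by simp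
  qed simp
qed

lemma theta_mono: "s \<le> t \<Longrightarrow> theta s \<le> theta t"
proof (rule lift_Suc_mono_le[of theta])
  fix t
  show "theta t \<le> theta (Suc t)"
    using theta_recurrence[of t] theta_pos[of t] theta_pos[of "Suc t"]
    by (intro power2_le_imp_le[of "theta t"]) auto
qed

lemma sum_theta: "0 < m \<Longrightarrow> (\<Sum>j<m. theta j) = (theta (m - 1))\<^sup>2"
proof (induction m)
  case (Suc m)
  show ?case
  proof (cases m)
    case 0 then show ?thesis by simp
  next
    case (Suc k)
    then show ?thesis using Suc.IH theta_recurrence[of k] by simp
  qed
qed simp

lemma step_alpha_le_1: "step_alpha t \<le> 1"
  using theta_ge[of t] theta_pos[of t] by (simp add: step_alpha_eq field_simps)


section \<open>The trace of a run\<close>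

text \<open>
  Every entry of the state is written at most once, so that the final state is a record of the whole
  run: it satisfies all the defining equations of the algorithm simultaneously. This turns the
  imperative recursion into a system of equations that determines all later arguments.
\<close>

lemma fold_copy_other:
  "u \<notin> dst ` set ls \<Longrightarrow> fold (\<lambda>l z. z(dst l := z (src l))) ls z0 u = z0 u"
  by (induction ls arbitrary: z0) auto

lemma fold_copy_target:
  assumes "l \<in> set ls" "inj_on dst (set ls)" "\<And>l l'. src l \<noteq> dst l'"
  shows "fold (\<lambda>l z. z(dst l := z (src l))) ls z0 (dst l) = z0 (src l)"
  using assms
proof (induction ls rule: rev_induct)
  case (snoc x ls)
  have "fold (\<lambda>l z. z(dst l := z (src l))) ls z0 (src x) = z0 (src x)"
    by (rule fold_copy_other) (use snoc.prems(3) in auto)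
  moreover have "dst l \<noteq> dst x" if "l \<noteq> x"
    using snoc.prems that by (auto simp: inj_on_def)
  ultimately show ?case using snoc by (cases "l = x") (auto simp del: fun_upd_apply simp: fun_upd_same fun_upd_other)
qed simp

context
  fixes n :: nat
    and T :: "nat \<Rightarrow> nat"
    and Z :: "'z::euclidean_space set"
    and P :: "'z \<Rightarrow> 'z"
    and Q :: "nat \<Rightarrow> 'z \<Rightarrow> 'z"
    and \<alpha> :: "nat \<Rightarrow> real"
    and \<eta> :: "nat list \<Rightarrow> real"
    and Gs :: "nat list \<Rightarrow> 'z \<Rightarrow> 'z"
begin

text \<open>The point returned by the call at \<open>t\<close>, read off from the state.\<close>
definition node_value :: "nat \<Rightarrow> nat list \<Rightarrow> 'z sliding_state \<Rightarrow> 'z" where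
  "node_value d t s = (if d = 0 then leaf_step n Z P \<eta> s t else zbars s (t @ [T (Suc (length t))]))"

text \<open>
  One pass of the loop below \<open>t\<close>. Here \<open>d\<close> counts the levels below the node \<open>(t,j)\<close>, so that
  \<open>r < d\<close> runs over the levels to which iterates are copied.
\<close>
definition step_equations :: "nat \<Rightarrow> nat list \<Rightarrow> nat \<Rightarrow> 'z sliding_state \<Rightarrow> bool" where
  "step_equations d t j s \<longleftrightarrow>
     Gvals s (t @ [j]) = Gs (t @ [j]) (sliding_w \<alpha> s (t @ [j])) \<and>
     Qvals s (t @ [j]) = Q (Suc (length t)) (zs s (t @ [j])) \<and>
     zbars s (t @ [Suc j]) = \<alpha> j *\<^sub>R node_value d (t @ [j]) s + (1 - \<alpha> j) *\<^sub>R zbars s (t @ [j]) \<and>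
     zs s (t @ [Suc j]) =
       arg_min_on (\<lambda>z. (Q (Suc (length t)) (node_value d (t @ [j]) s) - Qvals s (t @ [j])) \<bullet> z
         + 1/2 * \<eta> (t @ [j]) * (pnorm P (z - node_value d (t @ [j]) s))\<^sup>2) Z \<and>
     (\<forall>r<d. zs s (t @ [Suc j] @ replicate (Suc r) 0)
        = zs s (t @ [j] @ [T (Suc (Suc (length t)))] @ replicate r 0))"

primrec traced :: "nat \<Rightarrow> nat list \<Rightarrow> 'z sliding_state \<Rightarrow> bool" where
  "traced 0 t s \<longleftrightarrow> True"
| "traced (Suc d) t s \<longleftrightarrow> zbars s (t @ [0]) = zs s (t @ [0]) \<and>
     (\<forall>j<T (Suc (length t)). step_equations d t j s \<and> traced d (t @ [j]) s)"

definition same_along :: "nat list \<Rightarrow> 'z sliding_state \<Rightarrow> 'z sliding_state \<Rightarrow> bool" where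
  "same_along t s s' \<longleftrightarrow> (\<forall>u. prefix u t \<or> prefix t u \<longrightarrow>
     zs s' u = zs s u \<and> zbars s' u = zbars s u \<and> Gvals s' u = Gvals s u \<and> Qvals s' u = Qvals s u)"

text \<open>
  The call at \<open>t\<close> leaves the indices \<open>(t,0,\<dots>,0)\<close> of \<open>zs\<close> alone because its caller has prepared them.
\<close>
definition unchanged_off :: "nat list \<Rightarrow> 'z sliding_state \<Rightarrow> 'z sliding_state \<Rightarrow> bool" where
  "unchanged_off t s s' \<longleftrightarrow>
     (\<forall>u. \<not> strict_prefix t u \<longrightarrow>
        zbars s' u = zbars s u \<and> Gvals s' u = Gvals s u \<and> Qvals s' u = Qvals s u) \<and>
     (\<forall>u. (\<forall>v. u = t @ v \<longrightarrow> set v \<subseteq> {0}) \<longrightarrow> zs s' u = zs s u)"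

lemma sliding_w_cong:
  assumes "zs s' t = zs s t" "\<And>l. zbars s' (take l t) = zbars s (take l t)"
  shows "sliding_w \<alpha> s' t = sliding_w \<alpha> s t"
  unfolding sliding_w_def assms by (rule refl)

lemma node_value_cong: "same_along t s s' \<Longrightarrow> node_value d t s' = node_value d t s"
  by (auto simp: node_value_def leaf_step_def same_along_def take_is_prefix)

lemma same_along_snoc: "same_along t s s' \<Longrightarrow> same_along (t @ [j]) s s'"
  by (auto simp: same_along_def dest: append_prefixD)

lemma step_equations_cong:
  assumes eq: "same_along (t @ [j]) s s'" and "zbars s' (t @ [Suc j]) = zbars s (t @ [Suc j])"
    and zs: "\<And>r. zs s' (t @ [Suc j] @ replicate r 0) = zs s (t @ [Suc j] @ replicate r 0)"
    and s: "step_equations d t j s"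
  shows "step_equations d t j s'"
proof -
  have "sliding_w \<alpha> s' (t @ [j]) = sliding_w \<alpha> s (t @ [j])"
  proof (rule sliding_w_cong)
    show "zbars s' (take l (t @ [j])) = zbars s (take l (t @ [j]))" for l
      using eq take_is_prefix[of l "t @ [j]"] unfolding same_along_def by blast
  qed (use eq in \<open>auto simp: same_along_def\<close>)
  moreover have "zs s' (t @ [Suc j]) = zs s (t @ [Suc j])" using zs[of 0] by simp
  moreover have "zs s' (t @ [j] @ [T (Suc (Suc (length t)))] @ replicate r 0)
      = zs s (t @ [j] @ [T (Suc (Suc (length t)))] @ replicate r 0)" for r
    using eq by (simp add: same_along_def prefix_def)
  moreover have "Gvals s' (t @ [j]) = Gvals s (t @ [j])" "Qvals s' (t @ [j]) = Qvals s (t @ [j])"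
     "zs s' (t @ [j]) = zs s (t @ [j])" "zbars s' (t @ [j]) = zbars s (t @ [j])"
    using eq by (auto simp: same_along_def)
  ultimately show ?thesis
    using s zs assms(2) node_value_cong[OF eq] unfolding step_equations_def by metis
qed

lemma traced_cong: "same_along t s s' \<Longrightarrow> traced d t s \<Longrightarrow> traced d t s'"
proof (induction d arbitrary: t)
  case (Suc d)
  have "step_equations d t j s' \<and> traced d (t @ [j]) s'" if "j < T (Suc (length t))" for j
  proof
    show "step_equations d t j s'"
      by (rule step_equations_cong[OF same_along_snoc[OF Suc.prems(1)]])
         (use Suc.prems that in \<open>auto simp: same_along_def\<close>)
    show "traced d (t @ [j]) s'"
      by (rule Suc.IH[OF same_along_snoc[OF Suc.prems(1)]]) (use Suc.prems that in auto)
  qed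
  then show ?case using Suc.prems by (auto simp: same_along_def)
qed simp

lemma node_update_fields:
  fixes t j zt s
  assumes "length t + Suc d = n"
  defines "s' \<equiv> node_update n T Z P Q \<alpha> \<eta> t j zt s"
  shows "Gvals s' = Gvals s" "Qvals s' = Qvals s"
    "zbars s' = (zbars s)(t @ [Suc j] := \<alpha> j *\<^sub>R zt + (1 - \<alpha> j) *\<^sub>R zbars s (t @ [j]))"
    "zs s' (t @ [Suc j]) = arg_min_on (\<lambda>z. (Q (Suc (length t)) zt - Qvals s (t @ [j])) \<bullet> z
         + 1/2 * \<eta> (t @ [j]) * (pnorm P (z - zt))\<^sup>2) Z"
    "r < d \<Longrightarrow> zs s' (t @ [Suc j] @ replicate (Suc r) 0)
        = zs s (t @ [j] @ [T (Suc (Suc (length t)))] @ replicate r 0)"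
    "(\<And>r. u \<noteq> t @ [Suc j] @ replicate r 0) \<Longrightarrow> zs s' u = zs s u"
proof -
  define i where "i = Suc (length t)"
  define dst where "dst l = (t @ [Suc j]) @ replicate (l - i) (0::nat)" for l
  define src where "src l = (t @ [j]) @ [T (Suc i)] @ replicate (l - Suc i) 0" for l
  define z0 where "z0 = (zs s)(t @ [Suc j] := arg_min_on (\<lambda>z. (Q i zt - Qvals s (t @ [j])) \<bullet> z
         + 1/2 * \<eta> (t @ [j]) * (pnorm P (z - zt))\<^sup>2) Z)"
  have zs': "zs s' = fold (\<lambda>l z. z(dst l := z (src l))) [Suc i..<Suc n] z0"
    by (simp add: s'_def node_update_def Let_def dst_def src_def z0_def i_def)
  show "Gvals s' = Gvals s" "Qvals s' = Qvals s"
    "zbars s' = (zbars s)(t @ [Suc j] := \<alpha> j *\<^sub>R zt + (1 - \<alpha> j) *\<^sub>R zbars s (t @ [j]))"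
    by (simp_all add: s'_def node_update_def Let_def)
  have "t @ [Suc j] \<notin> dst ` set [Suc i..<Suc n]" by (auto simp: dst_def)
  then show "zs s' (t @ [Suc j]) = arg_min_on (\<lambda>z. (Q (Suc (length t)) zt - Qvals s (t @ [j])) \<bullet> z
         + 1/2 * \<eta> (t @ [j]) * (pnorm P (z - zt))\<^sup>2) Z"
    unfolding zs' by (subst fold_copy_other) (auto simp: z0_def i_def)
  show "zs s' (t @ [Suc j] @ replicate (Suc r) 0)
        = zs s (t @ [j] @ [T (Suc (Suc (length t)))] @ replicate r 0)" if "r < d"
  proof -
    have inj: "inj_on dst (set [Suc i..<Suc n])"
    proof (rule inj_onI)
      fix l l' assume "l \<in> set [Suc i..<Suc n]" "l' \<in> set [Suc i..<Suc n]" "dst l = dst l'"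
      then have "length (dst l) = length (dst l')" "i < l" "i < l'" by auto
      then show "l = l'" by (simp add: dst_def)
    qed
    have ne: "src l \<noteq> dst l'" for l l' by (simp add: src_def dst_def)
    have "zs s' (dst (i + Suc r)) = z0 (src (i + Suc r))"
      unfolding zs' by (rule fold_copy_target[OF _ inj ne]) (use that assms(1) in \<open>auto simp: i_def\<close>)
    then show ?thesis by (simp add: dst_def src_def z0_def i_def)
  qed
  show "zs s' u = zs s u" if "\<And>r. u \<noteq> t @ [Suc j] @ replicate r 0"
    unfolding zs' using that that[of 0] by (subst fold_copy_other) (auto simp: dst_def z0_def)
qed

abbreviation (input) rec_call where "rec_call \<equiv> sliding_rec n T Z P Q \<alpha> \<eta> Gs"

text \<open>
  The loop is named in order to state its invariant after \<open>m\<close> passes.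
\<close>
definition rec_body :: "nat \<Rightarrow> nat list \<Rightarrow> nat \<Rightarrow> 'z sliding_state \<Rightarrow> 'z sliding_state" where
  "rec_body d t j s = (let (zt, s1) = rec_call d (t @ [j]) (node_calls Q \<alpha> Gs (t @ [j]) s)
                            in node_update n T Z P Q \<alpha> \<eta> t j zt s1)"

definition rec_loop :: "nat \<Rightarrow> nat list \<Rightarrow> nat \<Rightarrow> 'z sliding_state \<Rightarrow> 'z sliding_state" where
  "rec_loop d t m s = fold (rec_body d t) [0..<m] (s\<lparr>zbars := (zbars s)(t @ [0] := zs s (t @ [0]))\<rparr>)"

lemma rec_loop_simps:
  "rec_loop d t 0 s = s\<lparr>zbars := (zbars s)(t @ [0] := zs s (t @ [0]))\<rparr>"
  "rec_loop d t (Suc m) s = rec_body d t m (rec_loop d t m s)"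
  by (simp_all add: rec_loop_def)

lemma sliding_rec_Suc_loop:
  "rec_call (Suc d) t s = (let s' = rec_loop d t (T (Suc (length t))) s
     in (zbars s' (t @ [T (Suc (length t))]), s'))"
  by (simp add: rec_loop_def rec_body_def[abs_def])

definition trace_ok where
  "trace_ok d t s \<longleftrightarrow> unchanged_off t s (snd (rec_call d t s)) \<and> traced d t (snd (rec_call d t s)) \<and>
     fst (rec_call d t s) = node_value d t (snd (rec_call d t s))"

text \<open>
  The equations of a pass involve indices comparable with \<open>(t,m)\<close>, and entries at \<open>(t,m+1)\<close>. The
  remaining claims say what the pass leaves alone: this is what preserves the equations of the
  earlier passes, where the entries at \<open>(t,m,0,\<dots>,0)\<close> matter because they belong to the pass before.
\<close>
lemma rec_body_spec:
  fixes s t m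
  assumes n: "length t + Suc d = n"
    and IH: "trace_ok d (t @ [m]) (node_calls Q \<alpha> Gs (t @ [m]) s)"
  defines "s' \<equiv> rec_body d t m s"
  shows "step_equations d t m s'" and "traced d (t @ [m]) s'"
    and "\<And>u. \<not> prefix (t @ [m]) u \<Longrightarrow> Gvals s' u = Gvals s u \<and> Qvals s' u = Qvals s u"
    and "\<And>u. \<not> strict_prefix (t @ [m]) u \<Longrightarrow> u \<noteq> t @ [Suc m] \<Longrightarrow> zbars s' u = zbars s u"
    and "\<And>u. (\<And>v. u = t @ [m] @ v \<Longrightarrow> set v \<subseteq> {0}) \<Longrightarrow> (\<And>r. u \<noteq> t @ [Suc m] @ replicate r 0) \<Longrightarrow>
          zs s' u = zs s u"
proof -
  define s1 where "s1 = node_calls Q \<alpha> Gs (t @ [m]) s"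
  define s2 where "s2 = snd (rec_call d (t @ [m]) s1)"
  define zt where "zt = fst (rec_call d (t @ [m]) s1)"
  have s': "s' = node_update n T Z P Q \<alpha> \<eta> t m zt s2"
    by (simp add: s'_def rec_body_def s2_def zt_def s1_def case_prod_beta)
  have off: "unchanged_off (t @ [m]) s1 s2" and tr: "traced d (t @ [m]) s2"
    and zt: "zt = node_value d (t @ [m]) s2"
    using IH unfolding trace_ok_def s1_def[symmetric] by (simp_all add: s2_def zt_def)
  have s1: "zs s1 = zs s" "zbars s1 = zbars s"
    "Gvals s1 = (Gvals s)(t @ [m] := Gs (t @ [m]) (sliding_w \<alpha> s (t @ [m])))"
    "Qvals s1 = (Qvals s)(t @ [m] := Q (Suc (length t)) (zs s (t @ [m])))"
    by (simp_all add: s1_def node_calls_def Let_def)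
  note upd = node_update_fields[OF n, where j=m and zt=zt and s=s2, folded s']
  have along: "same_along (t @ [m]) s2 s'"
    unfolding same_along_def
  proof (intro allI impI)
    fix u assume u: "prefix u (t @ [m]) \<or> prefix (t @ [m]) u"
    then have nr: "u \<noteq> t @ [Suc m] @ replicate r 0" for r
      by (auto simp: prefix_def append_eq_append_conv2 Cons_eq_append_conv)
    have "zs s' u = zs s2 u" by (rule upd(6)[OF nr])
    moreover have "u \<noteq> t @ [Suc m]" using nr[of 0] by simp
    ultimately
    show "zs s' u = zs s2 u \<and> zbars s' u = zbars s2 u \<and> Gvals s' u = Gvals s2 u \<and> Qvals s' u = Qvals s2 u"
      by (simp add: upd(1-3))
  qed
  show tr': "traced d (t @ [m]) s'" by (rule traced_cong[OF along tr])
  have zt': "node_value d (t @ [m]) s' = zt" using node_value_cong[OF along] zt by simp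
  show GQ: "Gvals s' u = Gvals s u \<and> Qvals s' u = Qvals s u" if "\<not> prefix (t @ [m]) u" for u
    using that off upd(1,2) s1 by (auto simp: unchanged_off_def strict_prefix_def)
  show zb: "zbars s' u = zbars s u" if "\<not> strict_prefix (t @ [m]) u" "u \<noteq> t @ [Suc m]" for u
    using that off upd(3) s1 by (auto simp: unchanged_off_def)
  show z: "zs s' u = zs s u" if "\<And>v. u = t @ [m] @ v \<Longrightarrow> set v \<subseteq> {0}" "\<And>r. u \<noteq> t @ [Suc m] @ replicate r 0" for u
    using that off upd(6)[of u] s1 unfolding unchanged_off_def by simp
  have zm: "zs s' (t @ [m]) = zs s (t @ [m])" by (rule z) auto
  have zb2: "zbars s2 (t @ [m]) = zbars s' (t @ [m])" by (simp add: upd(3))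
  have "sliding_w \<alpha> s' (t @ [m]) = sliding_w \<alpha> s (t @ [m])"
  proof (rule sliding_w_cong[OF zm])
    fix l
    have "prefix (take l (t @ [m])) (t @ [m])" by (rule take_is_prefix)
    then have "\<not> strict_prefix (t @ [m]) (take l (t @ [m]))" by (simp add: prefix_order.leD)
    moreover have "take l (t @ [m]) \<noteq> t @ [Suc m]"
    proof
      assume "take l (t @ [m]) = t @ [Suc m]"
      then have "prefix (t @ [Suc m]) (t @ [m])" using take_is_prefix[of l "t @ [m]"] by simp
      then show False by (simp add: prefix_def)
    qed
    ultimately
    show "zbars s' (take l (t @ [m])) = zbars s (take l (t @ [m]))" by (rule zb)
  qed
  moreover have "Gvals s' (t @ [m]) = Gvals s1 (t @ [m])" and Qm: "Qvals s' (t @ [m]) = Qvals s1 (t @ [m])"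
    using off upd(1,2) by (auto simp: unchanged_off_def)
  ultimately have "Gvals s' (t @ [m]) = Gs (t @ [m]) (sliding_w \<alpha> s' (t @ [m]))"
    by (simp add: s1(3))
  moreover have "Qvals s' (t @ [m]) = Q (Suc (length t)) (zs s' (t @ [m]))"
    by (simp add: Qm s1(4) zm)
  moreover have "zbars s' (t @ [Suc m]) = \<alpha> m *\<^sub>R zt + (1 - \<alpha> m) *\<^sub>R zbars s' (t @ [m])"
    unfolding zb2[symmetric] by (simp add: upd(3))
  moreover have "zs s' (t @ [Suc m]) =
       arg_min_on (\<lambda>z. (Q (Suc (length t)) zt - Qvals s' (t @ [m])) \<bullet> z
         + 1/2 * \<eta> (t @ [m]) * (pnorm P (z - zt))\<^sup>2) Z"
    unfolding upd(2) by (rule upd(4))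
  moreover have "zs s' (t @ [Suc m] @ replicate (Suc r) 0)
      = zs s' (t @ [m] @ [T (Suc (Suc (length t)))] @ replicate r 0)" if "r < d" for r
  proof -
    have "zs s' (t @ [m] @ [T (Suc (Suc (length t)))] @ replicate r 0)
        = zs s2 (t @ [m] @ [T (Suc (Suc (length t)))] @ replicate r 0)"
      using along by (simp add: same_along_def prefix_def)
    then show ?thesis using upd(5)[OF that] by simp
  qed
  ultimately show "step_equations d t m s'"
    unfolding step_equations_def zt' by blast
qed

lemma trace_ok: "length t + d = n \<Longrightarrow> trace_ok d t s"
proof (induction d arbitrary: t s)
  case 0
  then show ?case by (simp add: trace_ok_def unchanged_off_def node_value_def)
next
  case (Suc d t s)
  note outer_IH = Suc.IH
  define inv where "inv m s' \<longleftrightarrow> unchanged_off t s s' \<and> zbars s' (t @ [0]) = zs s' (t @ [0]) \<and>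
     (\<forall>j<m. step_equations d t j s' \<and> traced d (t @ [j]) s')" for m s'
  have "inv m (rec_loop d t m s)" for m
  proof (induction m)
    case 0
    then show ?case by (auto simp: inv_def rec_loop_simps unchanged_off_def strict_prefix_def)
  next
    case (Suc m)
    define s1 where "s1 = rec_loop d t m s"
    define s2 where "s2 = rec_body d t m s1"
    have len: "length (t @ [m]) + d = n" using \<open>length t + Suc d = n\<close> by simp
    note b = rec_body_spec[where m=m and s=s1, OF \<open>length t + Suc d = n\<close> outer_IH[OF len], folded s2_def]
    have i1: "inv m s1" using Suc by (simp add: s1_def)
    have off: "unchanged_off t s s2"
      unfolding unchanged_off_def
    proof (intro conjI allI impI)
      fix u assume u: "\<not> strict_prefix t u"
      then have "\<not> prefix (t @ [m]) u" "\<not> strict_prefix (t @ [m]) u" "u \<noteq> t @ [Suc m]"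
        by (auto simp: strict_prefix_def prefix_def)
      then show "zbars s2 u = zbars s u" "Gvals s2 u = Gvals s u" "Qvals s2 u = Qvals s u"
        using b(3,4)[of u] i1 u by (auto simp: inv_def unchanged_off_def)
    next
      fix u assume u: "\<forall>v. u = t @ v \<longrightarrow> set v \<subseteq> {0}"
      have "zs s2 u = zs s1 u" by (rule b(5)) (use u in auto)
      then show "zs s2 u = zs s u" using i1 u by (auto simp: inv_def unchanged_off_def)
    qed
    have "zbars s2 (t @ [0]) = zbars s1 (t @ [0])" "zs s2 (t @ [0]) = zs s1 (t @ [0])"
      by (rule b(4,5); auto simp: strict_prefix_def prefix_def)+
    then have zero: "zbars s2 (t @ [0]) = zs s2 (t @ [0])" using i1 by (simp add: inv_def)
    have "step_equations d t j s2 \<and> traced d (t @ [j]) s2" if j: "j < m" for j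
    proof -
      have along: "same_along (t @ [j]) s1 s2"
        unfolding same_along_def
      proof (intro allI impI)
        fix u assume u: "prefix u (t @ [j]) \<or> prefix (t @ [j]) u"
        then have 1: "\<not> prefix (t @ [m]) u" "\<not> strict_prefix (t @ [m]) u" "u \<noteq> t @ [Suc m]"
          "\<And>v. u \<noteq> t @ [m] @ v" "\<And>r. u \<noteq> t @ [Suc m] @ replicate r 0"
          using j by (auto simp: strict_prefix_def prefix_def append_eq_append_conv2 Cons_eq_append_conv)
        show "zs s2 u = zs s1 u \<and> zbars s2 u = zbars s1 u \<and> Gvals s2 u = Gvals s1 u \<and> Qvals s2 u = Qvals s1 u"
          using b(3,4,5)[of u] 1 by auto
      qed
      have "zbars s2 (t @ [Suc j]) = zbars s1 (t @ [Suc j])"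
        by (rule b(4)) (use j in \<open>auto simp: strict_prefix_def prefix_def\<close>)
      moreover have "zs s2 (t @ [Suc j] @ replicate r 0) = zs s1 (t @ [Suc j] @ replicate r 0)" for r
        by (rule b(5)) (use j in auto)
      ultimately have "step_equations d t j s2"
        using step_equations_cong[OF along] i1 j by (auto simp: inv_def)
      then show ?thesis using traced_cong[OF along] i1 j by (auto simp: inv_def)
    qed
    moreover have "step_equations d t m s2" "traced d (t @ [m]) s2" by (rule b)+
    ultimately have "inv (Suc m) s2" using off zero by (auto simp: inv_def less_Suc_eq)
    then show ?case by (simp add: s2_def s1_def rec_loop_simps)
  qed
  from this[of "T (Suc (length t))"] show ?case
    unfolding trace_ok_def sliding_rec_Suc_loop
    by (simp add: Let_def inv_def node_value_def)
qed

lemma sliding_rec_counts: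
  "Gcount (snd (rec_call d t s)) i = Gcount s i
     + (if length t < i \<and> i \<le> length t + d then \<Prod>j=Suc (length t)..i. T j else 0)" (is "?G d t s")
  "Qcount (snd (rec_call d t s)) i = Qcount s i
     + 2 * (if length t < i \<and> i \<le> length t + d then \<Prod>j=Suc (length t)..i. T j else 0)" (is "?Q d t s")
proof -
  have "?G d t s \<and> ?Q d t s"
  proof (induction d arbitrary: t s)
    case (Suc d)
    define k where "k = (if length t < i \<and> i \<le> length t + Suc d then \<Prod>j=Suc (Suc (length t))..i. T j else 0)"
    have "Gcount (rec_loop d t m s) i = Gcount s i + m * k \<and> Qcount (rec_loop d t m s) i = Qcount s i + 2 * m * k" for m
    proof (induction m)
      case 0 then show ?case by (simp add: rec_loop_simps)
    next
      case (Suc m)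
      have "Gcount (rec_body d t m s') i = Gcount s' i + k \<and> Qcount (rec_body d t m s') i = Qcount s' i + 2 * k" for s'
        using \<open>\<And>t s. ?G d t s \<and> ?Q d t s\<close>
        by (auto simp: rec_body_def case_prod_beta node_update_def node_calls_def Let_def k_def)
      then show ?case using Suc by (simp add: rec_loop_simps)
    qed
    moreover have "T (Suc (length t)) * k = (if length t < i \<and> i \<le> length t + Suc d then \<Prod>j=Suc (length t)..i. T j else 0)"
      by (auto simp: k_def prod.atLeast_Suc_atMost)
    ultimately show ?case unfolding sliding_rec_Suc_loop by (simp add: Let_def mult.assoc)
  qed simp
  then show "?G d t s" "?Q d t s" by auto
qed

end


section \<open>Sums over the tree of indices\<close>

definition extensions :: "(nat \<Rightarrow> nat) \<Rightarrow> nat \<Rightarrow> nat list \<Rightarrow> nat list set" where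
  "extensions T r t = {t @ u | u. length u = r \<and> (\<forall>l<r. u ! l < T (Suc (length t + l)))}"

abbreviation level :: "(nat \<Rightarrow> nat) \<Rightarrow> nat \<Rightarrow> nat list set" where
  "level T i \<equiv> extensions T i []"

lemma extensions_0 [simp]: "extensions T 0 t = {t}"
  by (auto simp: extensions_def)

lemma extensions_Suc: "extensions T (Suc r) t = (\<Union>j<T (Suc (length t)). extensions T r (t @ [j]))"
proof (intro equalityI subsetI)
  fix x assume "x \<in> extensions T (Suc r) t"
  then obtain u where u: "x = t @ u" "length u = Suc r" "\<forall>l<Suc r. u ! l < T (Suc (length t + l))"
    by (auto simp: extensions_def)
  then obtain j v where "u = j # v" by (cases u) auto
  with u have "x = (t @ [j]) @ v" "length v = r" "j < T (Suc (length t))"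
    and "\<forall>l<r. v ! l < T (Suc (length (t @ [j]) + l))"
    by force+
  then show "x \<in> (\<Union>j<T (Suc (length t)). extensions T r (t @ [j]))"
    unfolding extensions_def by blast
next
  fix x assume "x \<in> (\<Union>j<T (Suc (length t)). extensions T r (t @ [j]))"
  then obtain j v where "j < T (Suc (length t))" "x = t @ j # v" "length v = r"
    "\<forall>l<r. v ! l < T (Suc (Suc (length t + l)))"
    by (auto simp: extensions_def)
  then show "x \<in> extensions T (Suc r) t"
    by (auto simp: extensions_def nth_Cons split: nat.splits intro!: exI[of _ "j # v"])
qed

lemma finite_extensions [simp]: "finite (extensions T r t)"
  by (induction r arbitrary: t) (auto simp: extensions_Suc)

lemma length_extensions: "v \<in> extensions T r t \<Longrightarrow> length v = length t + r"
  and take_extensions: "v \<in> extensions T r t \<Longrightarrow> take (length t) v = t"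
  by (auto simp: extensions_def)

lemma sum_extensions_Suc:
  "(\<Sum>v\<in>extensions T (Suc r) t. f v) = (\<Sum>j<T (Suc (length t)). \<Sum>v\<in>extensions T r (t @ [j]). f v)"
  unfolding extensions_Suc
proof (rule sum.UNION_disjoint; (intro ballI impI)?)
  fix i j :: nat assume "i \<noteq> j"
  then show "extensions T r (t @ [i]) \<inter> extensions T r (t @ [j]) = {}"
    by (auto simp: extensions_def)
qed auto

lemma sum_extensions_add:
  "(\<Sum>v\<in>extensions T (a + b) t. f v) = (\<Sum>w\<in>extensions T a t. \<Sum>v\<in>extensions T b w. f v)"
  by (induction a arbitrary: t) (simp_all add: sum_extensions_Suc)

lemma snoc_in_level [simp]: "t @ [j] \<in> level T (Suc k) \<longleftrightarrow> t \<in> level T k \<and> j < T (Suc k)"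
  by (auto simp: extensions_def nth_append less_Suc_eq)

lemma level_Suc_cases:
  assumes "v \<in> level T (Suc k)"
  obtains t j where "v = t @ [j]" "t \<in> level T k" "j < T (Suc k)"
proof -
  have "v \<noteq> []" using assms by (auto simp: extensions_def)
  then obtain t j where "v = t @ [j]" by (cases v rule: rev_cases) auto
  with assms that show ?thesis by auto
qed

lemma nodes_eq_levels: "nodes n T = (\<Union>i\<in>{1..n}. level T i)"
proof -
  have "(\<forall>l\<in>{1..k}. t ! (l - 1) < T l) \<longleftrightarrow> (\<forall>l<k. t ! l < T (Suc l))" for k t
    by (metis Suc_le_D Suc_le_eq atLeastAtMost_iff One_nat_def Suc_le_mono diff_Suc_1 le0)
  then show ?thesis by (auto simp: nodes_def extensions_def)
qed

text \<open>
  The last nonzero entry of an index tells which step has written its iterate: a proximal step at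
  that entry, copied along the zeros behind it.
\<close>
lemma level_cases:
  assumes u: "u \<in> level T k"
  obtains "u = replicate k 0"
  | t l j m where "u = t @ [Suc j] @ replicate m 0" "t \<in> level T l" "j < T (Suc l)" "k = Suc l + m"
proof -
  have "u = replicate (length u) 0 \<or> (\<exists>t j m. u = t @ [Suc j] @ replicate m 0)"
  proof (induction u rule: rev_induct)
    case (snoc a u)
    show ?case
    proof (cases a)
      case (Suc j)
      then have "u @ [a] = u @ [Suc j] @ replicate 0 0" by simp
      then show ?thesis by blast
    next
      case 0
      from snoc show ?thesis
      proof
        assume "u = replicate (length u) 0"
        then have "u @ [a] = replicate (length u) 0 @ [0]" using 0 by simp
        then show ?thesis by (simp add: replicate_append_same flip: replicate_Suc)
      next
        assume "\<exists>t j m. u = t @ [Suc j] @ replicate m 0"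
        then obtain t j m where "u = t @ [Suc j] @ replicate m 0" by blast
        then have "u @ [a] = t @ [Suc j] @ replicate (Suc m) 0"
          using 0 by (simp add: replicate_append_same)
        then show ?thesis by blast
      qed
    qed
  qed simp
  then show thesis
  proof (elim disjE exE)
    fix t j m assume eq: "u = t @ [Suc j] @ replicate m 0"
    then have k: "k = Suc (length t) + m" using length_extensions[OF u] by simp
    have nth: "u ! l < T (Suc l)" if "l < k" for l using u that by (auto simp: extensions_def)
    have "t ! l < T (Suc l)" if "l < length t" for l
      using nth[of l] that k eq by (simp add: nth_append)
    then have "t \<in> level T (length t)" by (simp add: extensions_def)
    moreover have "j < T (Suc (length t))" using nth[of "length t"] k eq by (simp add: nth_append)
    ultimately show thesis using that(2) eq k by blast
  qed (use that(1) length_extensions[OF u] in auto)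
qed

definition path_prod :: "(nat \<Rightarrow> nat \<Rightarrow> real) \<Rightarrow> nat list \<Rightarrow> real" where
  "path_prod f t = (\<Prod>l<length t. f (Suc l) (t ! l))"

lemma path_prod_Nil [simp]: "path_prod f [] = 1"
  and path_prod_snoc [simp]: "path_prod f (t @ [j]) = path_prod f t * f (Suc (length t)) j"
proof -
  show "path_prod f [] = 1" by (simp add: path_prod_def)
  have "(\<Prod>l<length t. f (Suc l) ((t @ [j]) ! l)) = (\<Prod>l<length t. f (Suc l) (t ! l))"
    by (intro prod.cong) (auto simp: nth_append)
  then show "path_prod f (t @ [j]) = path_prod f t * f (Suc (length t)) j"
    by (simp add: path_prod_def)
qed

lemma path_prod_mult: "path_prod f t * path_prod g t = path_prod (\<lambda>k j. f k j * g k j) t"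
  by (simp add: path_prod_def prod.distrib)

lemma path_prod_power: "(path_prod f t) ^ m = path_prod (\<lambda>k j. (f k j) ^ m) t"
  by (simp add: path_prod_def prod_power_distrib)

lemma path_prod_cong:
  "\<lbrakk>t \<in> level T i; \<And>k j. k \<in> {1..i} \<Longrightarrow> j < T k \<Longrightarrow> f k j = g k j\<rbrakk> \<Longrightarrow> path_prod f t = path_prod g t"
  unfolding path_prod_def by (intro prod.cong) (auto simp: extensions_def)

lemma path_prod_pos: "(\<And>k j. 0 < f k j) \<Longrightarrow> 0 < path_prod f t"
  unfolding path_prod_def by (intro prod_pos) auto

lemma path_prod_const: "t \<in> level T i \<Longrightarrow> path_prod (\<lambda>k j. h k) t = (\<Prod>k=1..i. h k)"
proof -
  assume "t \<in> level T i"
  then have "length t = i" by (auto dest: length_extensions)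
  have "(\<Prod>l<i. h (Suc l)) = (\<Prod>k=1..i. h k)"
    by (rule prod.reindex_bij_witness[of _ "\<lambda>k. k - 1" Suc]) auto
  then show ?thesis by (simp add: path_prod_def \<open>length t = i\<close>)
qed

lemma path_prod_eq_atLeastAtMost:
  "path_prod f t = (\<Prod>l=1..length t. f l (t ! (l - 1)))"
  unfolding path_prod_def by (rule prod.reindex_bij_witness[of _ "\<lambda>k. k - 1" Suc]) auto

lemma path_prod_mono:
  assumes "t \<in> level T i" "\<And>k j. k \<in> {1..i} \<Longrightarrow> j < T k \<Longrightarrow> 0 \<le> f k j \<and> f k j \<le> g k j"
  shows "path_prod f t \<le> path_prod g t"
  unfolding path_prod_def using assms by (intro prod_mono) (auto simp: extensions_def)

text \<open>
  Distributivity: the loops are independent, so sums over a level factor into sums over loops.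
\<close>
lemma sum_path_prod:
  "(\<Sum>t\<in>level T i. path_prod f t) = (\<Prod>k=1..i. \<Sum>j<T k. f k j)"
proof -
  have "(\<Sum>v\<in>extensions T r t. path_prod f v)
      = path_prod f t * (\<Prod>k=Suc (length t)..length t + r. \<Sum>j<T k. f k j)" for r t
  proof (induction r arbitrary: t)
    case (Suc r)
    define F where "F = (\<Prod>k=Suc (Suc (length t))..length t + Suc r. \<Sum>j<T k. f k j)"
    have "(\<Sum>v\<in>extensions T (Suc r) t. path_prod f v) = (\<Sum>j<T (Suc (length t)). path_prod f (t @ [j]) * F)"
      unfolding sum_extensions_Suc Suc.IH F_def by simp
    also have "\<dots> = path_prod f t * ((\<Sum>j<T (Suc (length t)). f (Suc (length t)) j) * F)"
      by (simp add: sum_distrib_left sum_distrib_right mult_ac)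
    also have "(\<Sum>j<T (Suc (length t)). f (Suc (length t)) j) * F = (\<Prod>k=Suc (length t)..length t + Suc r. \<Sum>j<T k. f k j)"
      unfolding F_def by (rule prod.atLeast_Suc_atMost[symmetric]) simp
    finally show ?case .
  qed simp
  from this[where t="[]"] show ?thesis by simp
qed


section \<open>The descent of one trace\<close>

text \<open>The quadratic growth factor \<open>\<theta>\<^sub>j\<^sup>2\<close> turns the relaxation \<open>1 - \<alpha>\<^sub>j\<close> into a telescoping sum.\<close>
lemma accelerated_recursion:
  assumes "0 < m" "\<And>j. j < m \<Longrightarrow> a (Suc j) \<le> (1 - step_alpha j) * a j + S j"
  shows "(theta (m - 1))\<^sup>2 * a m \<le> (\<Sum>j<m. (theta j)\<^sup>2 * S j)"
  using assms
proof (induction m)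
  case (Suc m)
  have rec: "(theta m)\<^sup>2 * a (Suc m) \<le> (theta m)\<^sup>2 * (1 - step_alpha m) * a m + (theta m)\<^sup>2 * S m"
    using mult_left_mono[OF Suc.prems(2)[of m], of "(theta m)\<^sup>2"] by (simp add: algebra_simps)
  show ?case
  proof (cases m)
    case 0 then show ?thesis using rec by simp
  next
    case (Suc k)
    have "(theta m)\<^sup>2 * (1 - step_alpha m) = (theta m)\<^sup>2 - theta m"
      using theta_pos[of m] by (simp add: step_alpha_eq power2_eq_square field_simps)
    also have "\<dots> = (theta (m - 1))\<^sup>2" using theta_recurrence[of k] Suc by simp
    finally have "(theta m)\<^sup>2 * a (Suc m) \<le> (theta (m - 1))\<^sup>2 * a m + (theta m)\<^sup>2 * S m"
      using rec by simp
    moreover have "(theta (m - 1))\<^sup>2 * a m \<le> (\<Sum>j<m. (theta j)\<^sup>2 * S j)"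
      using Suc.IH Suc.prems(2) Suc by simp
    ultimately show ?thesis by simp
  qed
qed simp

text \<open>
  In the deterministic part the parameters \<open>\<tau>\<^sub>i\<close> are arbitrary nonnegative additions to the
  smoothness constants.
\<close>
locale sliding_problem =
  fixes n :: nat
    and T :: "nat \<Rightarrow> nat"
    and Z :: "'z::euclidean_space set"
    and P :: "'z \<Rightarrow> 'z"
    and p :: "nat \<Rightarrow> 'z \<Rightarrow> real"
    and gradp :: "nat \<Rightarrow> 'z \<Rightarrow> 'z"
    and Q :: "nat \<Rightarrow> 'z \<Rightarrow> 'z"
    and L :: "nat \<Rightarrow> real"
    and M :: "nat \<Rightarrow> real"
    and \<tau> :: "nat \<Rightarrow> real"
  assumes T_pos: "\<And>i. i \<in> {1..n} \<Longrightarrow> 0 < T i"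
    and Z: "compact Z" "convex Z" "Z \<noteq> {}"
    and P: "sym_pos_def P"
    and L_nonneg: "\<And>i. i \<in> {1..n} \<Longrightarrow> 0 \<le> L i"
    and M_nonneg: "\<And>i. i \<in> {1..n} \<Longrightarrow> 0 \<le> M i"
    and \<tau>_nonneg: "\<And>i. i \<in> {1..n} \<Longrightarrow> 0 \<le> \<tau> i"
    and moduli_pos: "\<And>i. i \<in> {1..n} \<Longrightarrow> 0 < L i + \<tau> i + M i"
    and Q_monotone: "\<And>i. i \<in> {1..n} \<Longrightarrow> monotone_op Z (Q i)"
    and Q_lipschitz: "\<And>i. i \<in> {1..n} \<Longrightarrow> lipschitz_op P Z (M i) (Q i)"
    and p_smooth: "\<And>i. i \<in> {1..n} \<Longrightarrow> convex_smooth P Z (L i) (p i) (gradp i)"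
begin

definition \<eta> :: "nat list \<Rightarrow> real" where
  "\<eta> t = (L (length t) + \<tau> (length t)) * path_prod (\<lambda>k j. step_alpha j) t
     + M (length t) * path_prod (\<lambda>k j. step_alpha j / step_alpha (T k - 1)) t"

text \<open>The coefficient of the value returned at \<open>t\<close> in the output.\<close>
definition weight :: "nat list \<Rightarrow> real" where
  "weight = path_prod (\<lambda>k j. theta j / (theta (T k - 1))\<^sup>2)"

text \<open>
  The largest weight that a node of level \<open>i\<close> can have; its square is the accelerated rate.
\<close>
definition rate :: "nat \<Rightarrow> real" where
  "rate i = (\<Prod>k=1..i. 1 / theta (T k - 1))"

definition modulus :: "nat \<Rightarrow> real" where
  "modulus i = (rate i)\<^sup>2 * (L i + \<tau> i) + rate i * M i"

lemma rate_pos: "0 < rate i"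
  unfolding rate_def using theta_pos by (intro prod_pos) auto

lemma weight_pos: "0 < weight t"
  unfolding weight_def using theta_pos by (intro path_prod_pos) auto

lemma weight_le_rate: "t \<in> level T i \<Longrightarrow> weight t \<le> rate i"
proof -
  assume t: "t \<in> level T i"
  have "weight t \<le> path_prod (\<lambda>k j. 1 / theta (T k - 1)) t"
    unfolding weight_def
  proof (rule path_prod_mono[OF t])
    fix k j assume "j < T k"
    then have "theta j \<le> theta (T k - 1)" by (intro theta_mono) auto
    then show "0 \<le> theta j / (theta (T k - 1))\<^sup>2 \<and> theta j / (theta (T k - 1))\<^sup>2 \<le> 1 / theta (T k - 1)"
      using theta_pos[of j] theta_pos[of "T k - 1"] by (simp add: power2_eq_square field_simps)
  qed
  also have "\<dots> = rate i" unfolding rate_def by (rule path_prod_const[OF t])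
  finally show ?thesis .
qed

lemma modulus_pos: "i \<in> {1..n} \<Longrightarrow> 0 < modulus i"
  using rate_pos[of i] moduli_pos[of i] L_nonneg[of i] M_nonneg[of i] \<tau>_nonneg[of i]
  unfolding modulus_def
  by (cases "M i = 0") (auto intro!: add_nonneg_pos mult_nonneg_nonneg)

text \<open>The step sizes are chosen so that this product does not depend on the node.\<close>
lemma weight_eta: "t \<in> level T i \<Longrightarrow> weight t * \<eta> t = modulus i"
proof -
  assume t: "t \<in> level T i"
  then have len: "length t = i" by (auto dest: length_extensions)
  have "weight t * path_prod (\<lambda>k j. step_alpha j) t = path_prod (\<lambda>k j. (1 / theta (T k - 1))\<^sup>2) t"
    unfolding weight_def path_prod_mult
    by (rule path_prod_cong[OF t]) (use theta_pos in \<open>auto simp: step_alpha_eq power_divide less_imp_neq[symmetric]\<close>)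
  also have "\<dots> = (rate i)\<^sup>2"
    unfolding rate_def prod_power_distrib by (rule path_prod_const[OF t])
  finally have 1: "weight t * path_prod (\<lambda>k j. step_alpha j) t = (rate i)\<^sup>2" .
  have "weight t * path_prod (\<lambda>k j. step_alpha j / step_alpha (T k - 1)) t = path_prod (\<lambda>k j. 1 / theta (T k - 1)) t"
    unfolding weight_def path_prod_mult
    by (rule path_prod_cong[OF t])
       (use theta_pos in \<open>auto simp: step_alpha_eq power2_eq_square less_imp_neq[symmetric]\<close>)
  also have "\<dots> = rate i" unfolding rate_def by (rule path_prod_const[OF t])
  finally have 2: "weight t * path_prod (\<lambda>k j. step_alpha j / step_alpha (T k - 1)) t = rate i" .
  have "weight t * \<eta> t = (weight t * path_prod (\<lambda>k j. step_alpha j) t) * (L i + \<tau> i)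
      + (weight t * path_prod (\<lambda>k j. step_alpha j / step_alpha (T k - 1)) t) * M i"
    by (simp add: \<eta>_def len algebra_simps)
  then show ?thesis unfolding 1 2 modulus_def .
qed

lemma eta_pos: "t \<in> level T i \<Longrightarrow> i \<in> {1..n} \<Longrightarrow> 0 < \<eta> t"
  using weight_eta[of t i] modulus_pos[of i] weight_pos[of t] by (metis zero_less_mult_pos)

end

text \<open>
  The equations that hold in the final state of a run, with arbitrary vectors \<open>g\<close> in place of the
  oracle answers; \<open>r t\<close> stands for the point returned at \<open>t\<close>.
\<close>
locale sliding_trace = sliding_problem n T Z P p gradp Q L M \<tau>
  for n T and Z :: "'z::euclidean_space set" and P p gradp Q L M \<tau> +
  fixes zin :: 'z and z zb r g :: "nat list \<Rightarrow> 'z"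
  assumes zin: "zin \<in> Z"
    and z_init: "\<And>k. k \<le> n \<Longrightarrow> z (replicate k 0) = zin"
    and zb_0: "\<And>k t. t \<in> level T k \<Longrightarrow> k < n \<Longrightarrow> zb (t @ [0]) = z (t @ [0])"
    and zb_Suc: "\<And>k t j. t \<in> level T k \<Longrightarrow> k < n \<Longrightarrow> j < T (Suc k) \<Longrightarrow>
        zb (t @ [Suc j]) = step_alpha j *\<^sub>R r (t @ [j]) + (1 - step_alpha j) *\<^sub>R zb (t @ [j])"
    and r_inner: "\<And>k t. t \<in> level T k \<Longrightarrow> k < n \<Longrightarrow> r t = zb (t @ [T (Suc k)])"
    and r_leaf: "\<And>t. t \<in> level T n \<Longrightarrow> r t =
        arg_min_on (prox_objective P {1..n} (\<lambda>i. \<eta> (take i t)) (\<lambda>i. g (take i t) + Q i (z (take i t)))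
          (\<lambda>i. z (take i t))) Z"
    and z_Suc: "\<And>k t j. t \<in> level T k \<Longrightarrow> k < n \<Longrightarrow> j < T (Suc k) \<Longrightarrow> z (t @ [Suc j]) =
        arg_min_on (prox_objective P {()} (\<lambda>_. \<eta> (t @ [j]))
          (\<lambda>_. Q (Suc k) (r (t @ [j])) - Q (Suc k) (z (t @ [j]))) (\<lambda>_. r (t @ [j]))) Z"
    and z_copy: "\<And>k t j m. t \<in> level T k \<Longrightarrow> j < T (Suc k) \<Longrightarrow> Suc (Suc k) + m \<le> n \<Longrightarrow>
        z (t @ [Suc j] @ replicate (Suc m) 0) = z (t @ [j] @ [T (Suc (Suc k))] @ replicate m 0)"
begin

lemma arg_min_on_prox:
  "arg_min_on (prox_objective P I h c x) Z \<in> Z"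
  "u \<in> Z \<Longrightarrow> prox_objective P I h c x (arg_min_on (prox_objective P I h c x) Z) \<le> prox_objective P I h c x u"
  using arg_min_on_compact[OF Z(1,3) continuous_on_prox_objective[OF P]] by blast+

lemma T_eq_Suc: "k < n \<Longrightarrow> T (Suc k) = Suc (T (Suc k) - 1)"
  using T_pos[of "Suc k"] by simp

text \<open>
  Following the copies back leads to a proximal step, whose value lies in \<open>Z\<close>.
\<close>
lemma z_Suc_replicate_in_Z:
  "\<lbrakk>t \<in> level T k; j < T (Suc k); Suc k + m \<le> n\<rbrakk> \<Longrightarrow> z (t @ [Suc j] @ replicate m 0) \<in> Z"
proof (induction m arbitrary: t j k)
  case 0
  then show ?case using z_Suc[of t k j] arg_min_on_prox(1) by simp
next
  case (Suc m)
  define j' where "j' = T (Suc (Suc k)) - 1"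
  have j': "T (Suc (Suc k)) = Suc j'" using T_eq_Suc[of "Suc k"] Suc.prems by (simp add: j'_def)
  have "z ((t @ [j]) @ [Suc j'] @ replicate m 0) \<in> Z"
    by (rule Suc.IH[of _ "Suc k"]) (use Suc.prems j' in auto)
  then show ?case using z_copy[of t k j m] Suc.prems j' by simp
qed

lemma z_in_Z:
  assumes t: "t \<in> level T k" and k: "k \<le> n"
  shows "z t \<in> Z"
  using t
proof (cases rule: level_cases)
  case 1
  then show ?thesis using z_init[OF k] zin by simp
next
  case (2 v l j m)
  then show ?thesis using z_Suc_replicate_in_Z[of v l j m] k by simp
qed

lemma convex_step_in_Z:
  "x \<in> Z \<Longrightarrow> y \<in> Z \<Longrightarrow> step_alpha j *\<^sub>R x + (1 - step_alpha j) *\<^sub>R y \<in> Z"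
  using convexD_alt[OF Z(2), of y x "step_alpha j"] step_alpha_pos[of j] step_alpha_le_1[of j]
  by (simp add: add.commute)

lemma zb_in_Z_if:
  assumes "t \<in> level T k" "k < n" "\<And>j. j < T (Suc k) \<Longrightarrow> r (t @ [j]) \<in> Z"
  shows "m \<le> T (Suc k) \<Longrightarrow> zb (t @ [m]) \<in> Z"
proof (induction m)
  case 0
  show ?case using zb_0 z_in_Z[of "t @ [0]" "Suc k"] assms T_pos[of "Suc k"] by simp
next
  case (Suc m)
  then show ?case using zb_Suc[of t k m] convex_step_in_Z assms by simp
qed

lemma r_in_Z: "t \<in> level T k \<Longrightarrow> k \<le> n \<Longrightarrow> r t \<in> Z"
proof (induction "n - k" arbitrary: t k)
  case 0
  then show ?case using r_leaf[of t] arg_min_on_prox(1) by simp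
next
  case (Suc d)
  have "zb (t @ [T (Suc k)]) \<in> Z"
  proof (rule zb_in_Z_if[of t k])
    show "r (t @ [j]) \<in> Z" if "j < T (Suc k)" for j
      by (rule Suc.hyps(1)[of "Suc k"]) (use Suc that in auto)
  qed (use Suc in auto)
  then show ?case using r_inner Suc by simp
qed

lemma zb_in_Z: "\<lbrakk>t \<in> level T k; k < n; m \<le> T (Suc k)\<rbrakk> \<Longrightarrow> zb (t @ [m]) \<in> Z"
  using zb_in_Z_if[of t k m] r_in_Z[of _ "Suc k"] by simp

text \<open>\<open>a\<^sub>1 \<circ> \<dots> \<circ> a\<^sub>k\<close>\<close>
definition amap :: "nat list \<Rightarrow> 'z \<Rightarrow> 'z" where
  "amap t = foldr (\<lambda>l v. step_alpha (t ! (l - 1)) *\<^sub>R v + (1 - step_alpha (t ! (l - 1))) *\<^sub>R zb (take l t))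
       [1..<Suc (length t)]"

definition w :: "nat list \<Rightarrow> 'z" where "w t = amap t (z t)"

lemma amap_Nil [simp]: "amap [] v = v" by (simp add: amap_def)

lemma amap_snoc: "amap (t @ [j]) v = amap t (step_alpha j *\<^sub>R v + (1 - step_alpha j) *\<^sub>R zb (t @ [j]))"
proof -
  have "foldr (\<lambda>l v. step_alpha ((t @ [j]) ! (l - 1)) *\<^sub>R v + (1 - step_alpha ((t @ [j]) ! (l - 1))) *\<^sub>R zb (take l (t @ [j])))
       [1..<Suc (length t)] = amap t"
    unfolding amap_def by (intro ext foldr_cong) (auto simp: nth_append)
  then show ?thesis by (simp add: amap_def nth_append)
qed

lemma amap_diff: "amap t x - amap t y = path_prod (\<lambda>k j. step_alpha j) t *\<^sub>R (x - y)"
proof (induction t arbitrary: x y rule: rev_induct)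
  case (snoc j t)
  have "amap (t @ [j]) x - amap (t @ [j]) y = path_prod (\<lambda>k j. step_alpha j) t *\<^sub>R (step_alpha j *\<^sub>R (x - y))"
    unfolding amap_snoc snoc by (simp add: algebra_simps)
  then show ?case by simp
qed simp

lemma amap_convex: "amap t (a *\<^sub>R x + (1 - a) *\<^sub>R y) = a *\<^sub>R amap t x + (1 - a) *\<^sub>R amap t y"
proof -
  have "amap t (a *\<^sub>R x + (1 - a) *\<^sub>R y) - amap t y = path_prod (\<lambda>k j. step_alpha j) t *\<^sub>R (a *\<^sub>R (x - y))"
    unfolding amap_diff by (simp add: algebra_simps)
  also have "\<dots> = a *\<^sub>R (amap t x - amap t y)" unfolding amap_diff by simp
  finally show ?thesis by (simp add: algebra_simps)
qed

lemma amap_in_Z: "\<lbrakk>t \<in> level T k; k \<le> n; x \<in> Z\<rbrakk> \<Longrightarrow> amap t x \<in> Z"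
proof (induction t arbitrary: x k rule: rev_induct)
  case (snoc j t)
  obtain k' where k: "k = Suc k'" using length_extensions[OF snoc.prems(1)] by auto
  show ?case unfolding amap_snoc
    by (rule snoc.IH[of k']) (use snoc.prems k zb_in_Z[of t k' j] in \<open>auto intro!: convex_step_in_Z\<close>)
qed simp

lemma w_in_Z: "t \<in> level T k \<Longrightarrow> k \<le> n \<Longrightarrow> w t \<in> Z"
  unfolding w_def by (intro amap_in_Z z_in_Z)

text \<open>
  The value returned at \<open>t\<close> is a weighted mean of the values returned below it, whence Jensen's
  inequality.
\<close>
lemma jensen_extensions:
  assumes h: "convex_on Z h"
  shows "t \<in> level T k \<Longrightarrow> k + m \<le> n \<Longrightarrow> weight t * h (r t) \<le> (\<Sum>v\<in>extensions T m t. weight v * h (r v))"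
proof (induction m arbitrary: t k)
  case (Suc m)
  have k: "k < n" and len: "length t = k" using Suc.prems by (auto dest: length_extensions)
  define W where "W = (theta (T (Suc k) - 1))\<^sup>2"
  have W: "0 < W" using theta_pos by (simp add: W_def)
  have "(theta (T (Suc k) - 1))\<^sup>2 * h (zb (t @ [T (Suc k)]))
      \<le> (\<Sum>j<T (Suc k). (theta j)\<^sup>2 * (step_alpha j * h (r (t @ [j]))))"
  proof (rule accelerated_recursion)
    fix j assume j: "j < T (Suc k)"
    have "h (zb (t @ [Suc j])) = h ((1 - step_alpha j) *\<^sub>R zb (t @ [j]) + step_alpha j *\<^sub>R r (t @ [j]))"
      using zb_Suc[OF Suc.prems(1) k j] by (simp add: add.commute)
    also have "\<dots> \<le> (1 - step_alpha j) * h (zb (t @ [j])) + step_alpha j * h (r (t @ [j]))"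
      by (rule convex_onD[OF h])
         (use step_alpha_pos[of j] step_alpha_le_1[of j] zb_in_Z[OF Suc.prems(1) k, of j] j
           r_in_Z[of "t @ [j]" "Suc k"] Suc.prems k in auto)
    finally show "h (zb (t @ [Suc j])) \<le> (1 - step_alpha j) * h (zb (t @ [j])) + step_alpha j * h (r (t @ [j]))" .
  qed (use T_pos k in auto)
  also have "(\<Sum>j<T (Suc k). (theta j)\<^sup>2 * (step_alpha j * h (r (t @ [j])))) = (\<Sum>j<T (Suc k). theta j * h (r (t @ [j])))"
    using theta_pos by (intro sum.cong) (auto simp: step_alpha_eq power2_eq_square less_imp_neq[symmetric])
  finally have "W * h (r t) \<le> (\<Sum>j<T (Suc k). theta j * h (r (t @ [j])))"
    using r_inner[OF Suc.prems(1) k] by (simp add: W_def)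
  then have "(weight t / W) * (W * h (r t)) \<le> (weight t / W) * (\<Sum>j<T (Suc k). theta j * h (r (t @ [j])))"
    using W weight_pos[of t] by (intro mult_left_mono) auto
  also have "\<dots> = (\<Sum>j<T (Suc k). weight (t @ [j]) * h (r (t @ [j])))"
    unfolding sum_distrib_left by (intro sum.cong) (simp_all add: weight_def len W_def)
  also have "\<dots> \<le> (\<Sum>j<T (Suc k). \<Sum>v\<in>extensions T m (t @ [j]). weight v * h (r v))"
    using Suc.prems by (intro sum_mono Suc.IH[of _ "Suc k"]) auto
  finally show ?case using W by (simp add: sum_extensions_Suc len)
qed simp

text \<open>
  The iterates of a level form one sequence through all loops: where an inner loop ends, its last
  iterate is copied to the start of the next inner loop.
\<close>
lemma telescope_level:
  fixes \<phi> :: "'z \<Rightarrow> real"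
  shows "\<lbrakk>t \<in> level T k; k + Suc m \<le> n\<rbrakk> \<Longrightarrow>
    (\<Sum>v\<in>extensions T (Suc m) t. \<phi> (z v) - \<phi> (z (butlast v @ [Suc (last v)])))
      = \<phi> (z (t @ replicate (Suc m) 0)) - \<phi> (z (t @ [T (Suc k)] @ replicate m 0))"
proof (induction m arbitrary: t k)
  case 0
  then have "length t = k" by (auto dest: length_extensions)
  then show ?case
    using sum_lessThan_telescope'[of "\<lambda>j. \<phi> (z (t @ [j]))" "T (Suc k)"]
    by (simp add: sum_extensions_Suc)
next
  case (Suc m)
  have len: "length t = k" using Suc.prems by (auto dest: length_extensions)
  have "(\<Sum>v\<in>extensions T (Suc (Suc m)) t. \<phi> (z v) - \<phi> (z (butlast v @ [Suc (last v)])))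
      = (\<Sum>j<T (Suc k). \<phi> (z ((t @ [j]) @ replicate (Suc m) 0)) - \<phi> (z ((t @ [j]) @ [T (Suc (Suc k))] @ replicate m 0)))"
    unfolding sum_extensions_Suc[of _ _ "Suc m"] len
    by (intro sum.cong refl Suc.IH) (use Suc.prems in auto)
  also have "\<dots> = (\<Sum>j<T (Suc k). \<phi> (z (t @ [j] @ replicate (Suc m) 0)) - \<phi> (z (t @ [Suc j] @ replicate (Suc m) 0)))"
    using z_copy[of t k _ m] Suc.prems by (intro sum.cong) auto
  also have "\<dots> = \<phi> (z (t @ [0] @ replicate (Suc m) 0)) - \<phi> (z (t @ [T (Suc k)] @ replicate (Suc m) 0))"
    by (rule sum_lessThan_telescope')
  finally show ?case by simp
qed

text \<open>
  Seen from inside the loops around level \<open>i\<close>, the function \<open>p\<^sub>i\<close> is replaced by its composition with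
  \<open>a\<^sub>1 \<circ> \<dots> \<circ> a\<^sub>k\<close>; each loop runs an accelerated scheme for this composition, and the error terms of
  the loops multiply up along the index.
\<close>
lemma smooth_descent:
  assumes i: "i \<in> {1..n}" and u: "u \<in> Z"
  defines "b \<equiv> path_prod (\<lambda>k j. (theta j)\<^sup>2 / (theta (T k - 1))\<^sup>2)"
    and "\<kappa> \<equiv> path_prod (\<lambda>k j. step_alpha j)"
  shows "t \<in> level T k \<Longrightarrow> k + m = i \<Longrightarrow>
    b t * (p i (amap t (r t)) - p i (amap t u))
      \<le> (\<Sum>v\<in>extensions T m t. b v * (\<kappa> v * (gradp i (w v) \<bullet> (r v - u)) + L i / 2 * (\<kappa> v)\<^sup>2 * (pnorm P (r v - z v))\<^sup>2))"
proof (induction m arbitrary: t k)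
  case 0
  then have ki: "k = i" and t: "t \<in> level T i" by auto
  have in_Z: "amap t (r t) \<in> Z" "amap t u \<in> Z" "w t \<in> Z"
    using amap_in_Z[OF t] r_in_Z[OF t] w_in_Z[OF t] i u by auto
  have "p i (amap t (r t)) \<le> p i (w t) + gradp i (w t) \<bullet> (amap t (r t) - w t)
      + L i / 2 * (pnorm P (amap t (r t) - w t))\<^sup>2"
    by (rule convex_smooth_upper[OF P Z(2) p_smooth[OF i] in_Z(1,3)])
  moreover have "p i (w t) + gradp i (w t) \<bullet> (amap t u - w t) \<le> p i (amap t u)"
    by (rule convex_smooth_lower[OF Z(2) p_smooth[OF i] in_Z(2,3)])
  moreover have "gradp i (w t) \<bullet> (amap t (r t) - w t) - gradp i (w t) \<bullet> (amap t u - w t) = \<kappa> t * (gradp i (w t) \<bullet> (r t - u))"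
  proof -
    have "gradp i (w t) \<bullet> (amap t (r t) - w t) - gradp i (w t) \<bullet> (amap t u - w t) = gradp i (w t) \<bullet> (amap t (r t) - amap t u)"
      by (simp add: inner_diff_right)
    then show ?thesis by (simp add: amap_diff \<kappa>_def)
  qed
  moreover have "(pnorm P (amap t (r t) - w t))\<^sup>2 = (\<kappa> t)\<^sup>2 * (pnorm P (r t - z t))\<^sup>2"
    by (simp add: w_def amap_diff \<kappa>_def pnorm_sq_scaleR[OF P])
  ultimately have "p i (amap t (r t)) - p i (amap t u)
     \<le> \<kappa> t * (gradp i (w t) \<bullet> (r t - u)) + L i / 2 * (\<kappa> t)\<^sup>2 * (pnorm P (r t - z t))\<^sup>2"
    by (simp add: mult.assoc)
  moreover have "0 \<le> b t" unfolding b_def using theta_pos by (intro less_imp_le path_prod_pos) auto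
  ultimately show ?case by (simp add: mult_left_mono)
next
  case (Suc m)
  have k: "k < n" "k < i" and len: "length t = k" using Suc.prems i by (auto dest: length_extensions)
  have cvx: "convex_on Z (p i)" using p_smooth[OF i] by (simp add: convex_smooth_def)
  define W where "W = (theta (T (Suc k) - 1))\<^sup>2"
  have W: "0 < W" using theta_pos by (simp add: W_def)
  have b: "0 \<le> b t" unfolding b_def using theta_pos by (intro less_imp_le path_prod_pos) auto
  define X where "X j = p i (amap (t @ [j]) (r (t @ [j]))) - p i (amap (t @ [j]) u)" for j
  have "(theta (T (Suc k) - 1))\<^sup>2 * (p i (amap t (zb (t @ [T (Suc k)]))) - p i (amap t u))
      \<le> (\<Sum>j<T (Suc k). (theta j)\<^sup>2 * X j)"
  proof (rule accelerated_recursion)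
    fix j assume j: "j < T (Suc k)"
    have "p i (amap t (zb (t @ [Suc j]))) = X j + p i (amap (t @ [j]) u)"
      using zb_Suc[OF Suc.prems(1) k(1) j] by (simp add: X_def amap_snoc)
    also have "amap (t @ [j]) u = (1 - step_alpha j) *\<^sub>R amap t (zb (t @ [j])) + step_alpha j *\<^sub>R amap t u"
      unfolding amap_snoc amap_convex by (simp add: add.commute)
    also have "p i \<dots> \<le> (1 - step_alpha j) * p i (amap t (zb (t @ [j]))) + step_alpha j * p i (amap t u)"
      by (rule convex_onD[OF cvx])
         (use step_alpha_pos[of j] step_alpha_le_1[of j] zb_in_Z[OF Suc.prems(1) k(1), of j] j
           amap_in_Z[OF Suc.prems(1)] k u in auto)
    finally show "p i (amap t (zb (t @ [Suc j]))) - p i (amap t u)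
        \<le> (1 - step_alpha j) * (p i (amap t (zb (t @ [j]))) - p i (amap t u)) + X j"
      by (simp add: algebra_simps)
  qed (use T_pos k in auto)
  then have "W * (p i (amap t (r t)) - p i (amap t u)) \<le> (\<Sum>j<T (Suc k). (theta j)\<^sup>2 * X j)"
    using r_inner[OF Suc.prems(1) k(1)] by (simp add: W_def)
  then have "(b t / W) * (W * (p i (amap t (r t)) - p i (amap t u))) \<le> (b t / W) * (\<Sum>j<T (Suc k). (theta j)\<^sup>2 * X j)"
    using W b by (intro mult_left_mono) auto
  also have "\<dots> = (\<Sum>j<T (Suc k). b (t @ [j]) * X j)"
    unfolding sum_distrib_left by (intro sum.cong) (simp_all add: b_def len W_def)
  also have "\<dots> \<le> (\<Sum>j<T (Suc k). \<Sum>v\<in>extensions T m (t @ [j]).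
      b v * (\<kappa> v * (gradp i (w v) \<bullet> (r v - u)) + L i / 2 * (\<kappa> v)\<^sup>2 * (pnorm P (r v - z v))\<^sup>2))"
    unfolding X_def by (intro sum_mono Suc.IH[of _ "Suc k"]) (use Suc.prems in auto)
  finally show ?case using W by (simp add: sum_extensions_Suc len)
qed

end


context sliding_trace
begin

definition noise :: "nat list \<Rightarrow> 'z" where
  "noise t = g t - gradp (length t) (w t)"

definition next_index :: "nat list \<Rightarrow> nat list" where
  "next_index t = butlast t @ [Suc (last t)]"

text \<open>
  The residual of the leaf step, as seen by the level of \<open>t\<close>, at the point \<open>x\<close> against the
  competitor \<open>u\<close>.
\<close>
definition residual :: "'z \<Rightarrow> nat list \<Rightarrow> 'z \<Rightarrow> real" where
  "residual u t x = (g t + Q (length t) (z t)) \<bullet> (x - u)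
     - \<eta> t / 2 * ((pnorm P (u - z t))\<^sup>2 - (pnorm P (x - z t))\<^sup>2 - (pnorm P (u - x))\<^sup>2)"

lemma convex_on_residual:
  assumes "t \<in> level T i" "i \<in> {1..n}"
  shows "convex_on Z (residual u t)"
proof -
  have eq: "residual u t = (\<lambda>x. (g t + Q (length t) (z t)) \<bullet> (x - u)
      + (\<eta> t / 2 * (pnorm P (x - z t))\<^sup>2 + (\<eta> t / 2 * (pnorm P (x - u))\<^sup>2 + - \<eta> t / 2 * (pnorm P (u - z t))\<^sup>2)))"
    by (rule ext) (simp add: residual_def pnorm_minus_commute[OF P, of u] algebra_simps)
  have "0 \<le> \<eta> t / 2" using eta_pos[OF assms] by simp
  moreover have "convex_on Z (\<lambda>x. (g t + Q (length t) (z t)) \<bullet> (x - u))"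
    by (rule convex_onI[OF _ Z(2)]) (simp add: algebra_simps inner_diff_right inner_add_right)
  ultimately show ?thesis unfolding eq
    by (intro convex_on_add convex_on_cmul convex_on_pnorm_sq[OF P Z(2)] convex_on_const[THEN iffD2] Z(2))
qed

text \<open>
  The three-point inequality of the leaf step.
\<close>
lemma sum_residual_leaf:
  assumes v: "v \<in> level T n" and u: "u \<in> Z"
  shows "(\<Sum>i=1..n. residual u (take i v) (r v)) \<le> 0"
proof -
  have len: "length v = n" using v by (auto dest: length_extensions)
  have "(\<Sum>i=1..n. (g (take i v) + Q i (z (take i v))) \<bullet> (r v - u))
    \<le> (\<Sum>i=1..n. \<eta> (take i v) / 2 * ((pnorm P (u - z (take i v)))\<^sup>2
        - (pnorm P (r v - z (take i v)))\<^sup>2 - (pnorm P (u - r v))\<^sup>2))"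
    by (rule prox_three_point[OF P Z(2) r_in_Z[OF v] u]) (simp_all add: r_leaf[OF v] arg_min_on_prox)
  moreover have "residual u (take i v) (r v) = (g (take i v) + Q i (z (take i v))) \<bullet> (r v - u)
      - \<eta> (take i v) / 2 * ((pnorm P (u - z (take i v)))\<^sup>2 - (pnorm P (r v - z (take i v)))\<^sup>2 - (pnorm P (u - r v))\<^sup>2)"
    if "i \<in> {1..n}" for i
  proof -
    have "length (take i v) = i" using that len by simp
    then show ?thesis by (simp only: residual_def)
  qed
  moreover from calculation(2) have "(\<Sum>i=1..n. residual u (take i v) (r v)) = (\<Sum>i=1..n. (g (take i v) + Q i (z (take i v))) \<bullet> (r v - u)
      - \<eta> (take i v) / 2 * ((pnorm P (u - z (take i v)))\<^sup>2 - (pnorm P (r v - z (take i v)))\<^sup>2 - (pnorm P (u - r v))\<^sup>2))"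
    by (intro sum.cong refl)
  ultimately show ?thesis by (simp add: sum_subtractf)
qed

text \<open>
  Averaging the optimality conditions of all leaf steps: by Jensen's inequality the residual of each
  level may be evaluated at the averaged points of that level.
\<close>
lemma sum_residual:
  assumes u: "u \<in> Z"
  shows "(\<Sum>i=1..n. \<Sum>t\<in>level T i. weight t * residual u t (r t)) \<le> 0"
proof -
  have "(\<Sum>t\<in>level T i. weight t * residual u t (r t)) \<le> (\<Sum>v\<in>level T n. weight v * residual u (take i v) (r v))"
    if i: "i \<in> {1..n}" for i
  proof -
    have "(\<Sum>t\<in>level T i. weight t * residual u t (r t))
        \<le> (\<Sum>t\<in>level T i. \<Sum>v\<in>extensions T (n - i) t. weight v * residual u t (r v))"
      using i by (intro sum_mono jensen_extensions[OF convex_on_residual]) auto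
    also have "\<dots> = (\<Sum>t\<in>level T i. \<Sum>v\<in>extensions T (n - i) t. weight v * residual u (take i v) (r v))"
    proof (intro sum.cong refl)
      fix t v assume "t \<in> level T i" "v \<in> extensions T (n - i) t"
      then have "take i v = t" using take_extensions length_extensions[of t T i "[]"] by force
      then show "weight v * residual u t (r v) = weight v * residual u (take i v) (r v)" by simp
    qed
    also have "\<dots> = (\<Sum>v\<in>level T n. weight v * residual u (take i v) (r v))"
      using i sum_extensions_add[of "\<lambda>v. weight v * residual u (take i v) (r v)" T i "n - i" "[]"] by simp
    finally show ?thesis .
  qed
  then have "(\<Sum>i=1..n. \<Sum>t\<in>level T i. weight t * residual u t (r t))
      \<le> (\<Sum>i=1..n. \<Sum>v\<in>level T n. weight v * residual u (take i v) (r v))"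
    by (rule sum_mono)
  also have "\<dots> = (\<Sum>v\<in>level T n. weight v * (\<Sum>i=1..n. residual u (take i v) (r v)))"
    by (subst sum.swap) (simp add: sum_distrib_left)
  also have "\<dots> \<le> 0"
    by (rule sum_nonpos, rule mult_nonneg_nonpos)
       (simp_all only: sum_residual_leaf[OF _ u] less_imp_le[OF weight_pos])
  finally show ?thesis .
qed

text \<open>
  The extragradient step turns the operator value at \<open>z\<^sub>t\<close> into the one at \<open>r\<^sub>t\<close>. The quadratic
  residual \<open>modulus i\<close> pays for the smoothness of \<open>p\<^sub>i\<close>, for the Lipschitz error of this step, and
  with its part proportional to \<open>\<tau>\<^sub>i\<close> for the correlation of the noise with \<open>r\<^sub>t\<close>.
\<close>
lemma node_estimate:
  assumes t: "t \<in> level T i" and i: "i \<in> {1..n}" and u: "u \<in> Z"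
    and no_noise: "\<tau> i = 0 \<Longrightarrow> noise t = 0"
  shows "weight t * (gradp i (w t) \<bullet> (r t - u) + Q i (r t) \<bullet> (r t - u))
      + (rate i)\<^sup>2 * L i / 2 * (pnorm P (r t - z t))\<^sup>2
    \<le> weight t * residual u t (r t)
      + modulus i / 2 * ((pnorm P (u - z t))\<^sup>2 - (pnorm P (u - z (next_index t)))\<^sup>2)
      + (weight t * (noise t \<bullet> (u - z t)) + (weight t)\<^sup>2 / (2 * (rate i)\<^sup>2 * \<tau> i) * (dual_pnorm P (noise t))\<^sup>2)"
proof -
  obtain k t' j where k: "i = Suc k" "k < n" and tj: "t = t' @ [j]" "t' \<in> level T k" "j < T (Suc k)"
  proof -
    have i': "i = Suc (i - 1)" "i - 1 < n" using i by auto
    then have "t \<in> level T (Suc (i - 1))" using t by simp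
    then show thesis by (rule level_Suc_cases) (use that i' in auto)
  qed
  have len: "length t = i" "length t' = k" using t tj by (auto dest: length_extensions)
  define z' where "z' = z (next_index t)"
  have z': "z' = z (t' @ [Suc j])" by (simp add: z'_def next_index_def tj)
  define N where "N = (pnorm P (r t - z t))\<^sup>2"
  define D where "D = Q i (r t) - Q i (z t)"
  define W where "W = weight t"
  define E where "E = modulus i"
  define h where "h = \<eta> t"
  have rZ: "r t \<in> Z" and zZ: "z t \<in> Z" using r_in_Z[OF t] z_in_Z[OF t] i by auto
  have W: "0 < W" and h: "0 < h" and E: "0 < E" and WE: "W * h = E" and N: "0 \<le> N"
    using weight_pos eta_pos[OF t i] modulus_pos[OF i] weight_eta[OF t] by (auto simp: W_def E_def h_def N_def)
  have mon: "W * (h * x) = E * x" for x using WE by (simp flip: mult.assoc)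

  have z'Z: "z' \<in> Z" and prox: "D \<bullet> (z' - u) \<le> h / 2 * ((pnorm P (u - r t))\<^sup>2 - (pnorm P (z' - r t))\<^sup>2 - (pnorm P (u - z'))\<^sup>2)"
  proof -
    have eq: "z' = arg_min_on (prox_objective P {()} (\<lambda>_. h) (\<lambda>_. D) (\<lambda>_. r t)) Z"
      using z_Suc[OF tj(2) k(2) tj(3)] unfolding z' D_def h_def tj(1) k(1) .
    show "z' \<in> Z" unfolding eq by (rule arg_min_on_prox)
    then show "D \<bullet> (z' - u) \<le> h / 2 * ((pnorm P (u - r t))\<^sup>2 - (pnorm P (z' - r t))\<^sup>2 - (pnorm P (u - z'))\<^sup>2)"
      using prox_three_point[OF P Z(2) _ u, of z' "{()}" "\<lambda>_. h" "\<lambda>_. D" "\<lambda>_. r t"]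
        arg_min_on_prox(2)[of _ "{()}" "\<lambda>_. h" "\<lambda>_. D" "\<lambda>_. r t", folded eq] by simp
  qed
  have young: "D \<bullet> (r t - z') \<le> (dual_pnorm P D)\<^sup>2 / (2 * h) + h / 2 * (pnorm P (z' - r t))\<^sup>2"
    using pnorm_dual_Young[OF P h, of D "r t - z'"] by (simp add: pnorm_minus_commute[OF P])
  have lip: "W * ((dual_pnorm P D)\<^sup>2 / (2 * h)) \<le> rate i * M i / 2 * N"
  proof -
    have "dual_pnorm P D \<le> M i * pnorm P (r t - z t)"
      using Q_lipschitz[OF i] rZ zZ by (auto simp: lipschitz_op_def D_def)
    then have "(dual_pnorm P D)\<^sup>2 \<le> (M i)\<^sup>2 * N"
      using power_mono[OF _ dual_pnorm_nonneg[OF P]] by (auto simp: N_def simp flip: power_mult_distrib)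
    moreover have "W * (W * (M i)\<^sup>2) \<le> rate i * M i * E"
    proof -
      have "W * W \<le> rate i * rate i"
        using W weight_le_rate[OF t] by (intro mult_mono) (auto simp: W_def)
      then have "W * W * (M i)\<^sup>2 \<le> rate i * rate i * (M i)\<^sup>2" by (intro mult_right_mono) auto
      also have "\<dots> = rate i * M i * (rate i * M i)" by (simp add: power2_eq_square)
      also have "\<dots> \<le> rate i * M i * E"
        unfolding E_def modulus_def using rate_pos[of i] L_nonneg[OF i] \<tau>_nonneg[OF i] M_nonneg[OF i]
        by (intro mult_left_mono) auto
      finally show ?thesis by (simp add: mult.assoc)
    qed
    ultimately have "W * (W * (dual_pnorm P D)\<^sup>2) \<le> rate i * M i * E * N"
    proof -
      have "W * (W * (dual_pnorm P D)\<^sup>2) \<le> W * (W * ((M i)\<^sup>2 * N))"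
        using W \<open>(dual_pnorm P D)\<^sup>2 \<le> (M i)\<^sup>2 * N\<close> by (intro mult_left_mono) auto
      also have "\<dots> = (W * (W * (M i)\<^sup>2)) * N" by simp
      also have "\<dots> \<le> (rate i * M i * E) * N"
        using \<open>W * (W * (M i)\<^sup>2) \<le> rate i * M i * E\<close> N by (intro mult_right_mono) auto
      finally show ?thesis .
    qed
    then have "W * (W * (dual_pnorm P D)\<^sup>2) \<le> W * (h * (rate i * M i * N))" by (simp add: mon mult_ac)
    then have "W * (dual_pnorm P D)\<^sup>2 \<le> h * (rate i * M i * N)" using W by simp
    then show ?thesis using h by (simp add: field_simps)
  qed
  have noise: "W * (noise t \<bullet> (z t - r t))
      \<le> W\<^sup>2 / (2 * (rate i)\<^sup>2 * \<tau> i) * (dual_pnorm P (noise t))\<^sup>2 + (rate i)\<^sup>2 * \<tau> i / 2 * N"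
  proof (cases "\<tau> i = 0")
    case False
    then have a: "0 < (rate i)\<^sup>2 * \<tau> i" using \<tau>_nonneg[OF i] rate_pos[of i] by simp
    have "(W *\<^sub>R noise t) \<bullet> (z t - r t)
      \<le> (dual_pnorm P (W *\<^sub>R noise t))\<^sup>2 / (2 * ((rate i)\<^sup>2 * \<tau> i)) + (rate i)\<^sup>2 * \<tau> i / 2 * (pnorm P (z t - r t))\<^sup>2"
      by (rule pnorm_dual_Young[OF P a])
    moreover have "(dual_pnorm P (W *\<^sub>R noise t))\<^sup>2 = W\<^sup>2 * (dual_pnorm P (noise t))\<^sup>2"
      unfolding dual_pnorm_sq[OF P]
      by (simp add: linear_scale[OF sym_pos_def_inv(3)[OF P]] power2_eq_square)
    ultimately show ?thesis by (simp add: N_def pnorm_minus_commute[OF P, of "z t"] mult.assoc)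
  qed (use no_noise in simp)
  have split: "W * (gradp i (w t) \<bullet> (r t - u) + Q i (r t) \<bullet> (r t - u))
      = W * ((g t + Q i (z t)) \<bullet> (r t - u)) + W * (D \<bullet> (z' - u)) + W * (D \<bullet> (r t - z'))
        + W * (noise t \<bullet> (u - z t)) + W * (noise t \<bullet> (z t - r t))"
    by (simp add: noise_def len D_def inner_diff_left inner_diff_right inner_add_left algebra_simps)
  have "W * (D \<bullet> (z' - u)) \<le> E / 2 * ((pnorm P (u - r t))\<^sup>2 - (pnorm P (z' - r t))\<^sup>2 - (pnorm P (u - z'))\<^sup>2)"
    using mult_left_mono[OF prox less_imp_le[OF W]] WE by (simp flip: mult.assoc)
  moreover have "W * (D \<bullet> (r t - z')) \<le> rate i * M i / 2 * N + E / 2 * (pnorm P (z' - r t))\<^sup>2"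
    using mult_left_mono[OF young less_imp_le[OF W]] lip WE by (simp add: distrib_left flip: mult.assoc)
  moreover have "W * residual u t (r t) = W * ((g t + Q i (z t)) \<bullet> (r t - u))
      - E / 2 * ((pnorm P (u - z t))\<^sup>2 - N - (pnorm P (u - r t))\<^sup>2)"
    using WE by (simp add: residual_def len N_def h_def[symmetric] right_diff_distrib flip: mult.assoc)
  moreover have "E / 2 * N = (rate i)\<^sup>2 * L i / 2 * N + (rate i)\<^sup>2 * \<tau> i / 2 * N + rate i * M i / 2 * N"
    by (simp add: E_def modulus_def algebra_simps add_divide_distrib)
  ultimately show ?thesis
    using noise split unfolding W_def[symmetric] E_def[symmetric] N_def[symmetric] z'_def[symmetric]
    by (simp add: right_diff_distrib distrib_left add_divide_distrib)
qed

text \<open>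
  The node estimates are summed: distances telescope along each level because the modulus is constant
  there, and the averaged residuals are nonpositive.
\<close>
lemma gap_term_bound:
  assumes u: "u \<in> Z"
    and no_noise: "\<And>i t. i \<in> {1..n} \<Longrightarrow> t \<in> level T i \<Longrightarrow> \<tau> i = 0 \<Longrightarrow> noise t = 0"
  shows "(\<Sum>i=1..n. p i (r [])) - (\<Sum>i=1..n. p i u) + (\<Sum>i=1..n. Q i u) \<bullet> (r [] - u)
    \<le> (\<Sum>i=1..n. modulus i / 2 * (pnorm P (u - zin))\<^sup>2)
      + (\<Sum>i=1..n. \<Sum>t\<in>level T i. weight t * (noise t \<bullet> (u - z t))
          + (weight t)\<^sup>2 / (2 * (rate i)\<^sup>2 * \<tau> i) * (dual_pnorm P (noise t))\<^sup>2)"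
proof -
  define rhs where "rhs i t = weight t * (noise t \<bullet> (u - z t))
          + (weight t)\<^sup>2 / (2 * (rate i)\<^sup>2 * \<tau> i) * (dual_pnorm P (noise t))\<^sup>2" for i t
  have level: "p i (r []) - p i u + Q i u \<bullet> (r [] - u)
      \<le> (\<Sum>t\<in>level T i. weight t * residual u t (r t)) + modulus i / 2 * (pnorm P (u - zin))\<^sup>2 + (\<Sum>t\<in>level T i. rhs i t)"
    if i: "i \<in> {1..n}" for i
  proof -
    have prod1: "path_prod (\<lambda>k j. (theta j)\<^sup>2 / (theta (T k - 1))\<^sup>2) t * path_prod (\<lambda>k j. step_alpha j) t = weight t"
      if "t \<in> level T i" for t
      unfolding path_prod_mult weight_def
      by (rule path_prod_cong[OF that]) (simp add: step_alpha_eq power2_eq_square)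
    have prod2: "path_prod (\<lambda>k j. (theta j)\<^sup>2 / (theta (T k - 1))\<^sup>2) t * (path_prod (\<lambda>k j. step_alpha j) t)\<^sup>2 = (rate i)\<^sup>2"
      if "t \<in> level T i" for t
    proof -
      have "path_prod (\<lambda>k j. (theta j)\<^sup>2 / (theta (T k - 1))\<^sup>2) t * (path_prod (\<lambda>k j. step_alpha j) t)\<^sup>2
          = path_prod (\<lambda>k j. (1 / theta (T k - 1))\<^sup>2) t"
        unfolding path_prod_power path_prod_mult
        by (rule path_prod_cong[OF that]) (simp add: step_alpha_eq power_divide)
      also have "\<dots> = (rate i)\<^sup>2" unfolding rate_def prod_power_distrib by (rule path_prod_const[OF that])
      finally show ?thesis .
    qed
    have "p i (r []) - p i u \<le> (\<Sum>t\<in>level T i. weight t * (gradp i (w t) \<bullet> (r t - u))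
        + (rate i)\<^sup>2 * L i / 2 * (pnorm P (r t - z t))\<^sup>2)"
    proof -
      have "p i (r []) - p i u \<le> (\<Sum>v\<in>level T i. path_prod (\<lambda>k j. (theta j)\<^sup>2 / (theta (T k - 1))\<^sup>2) v *
          (path_prod (\<lambda>k j. step_alpha j) v * (gradp i (w v) \<bullet> (r v - u))
            + L i / 2 * (path_prod (\<lambda>k j. step_alpha j) v)\<^sup>2 * (pnorm P (r v - z v))\<^sup>2))"
        using smooth_descent[OF i u, of "[]" 0 i] by simp
      also have "\<dots> = (\<Sum>v\<in>level T i. weight v * (gradp i (w v) \<bullet> (r v - u))
        + (rate i)\<^sup>2 * L i / 2 * (pnorm P (r v - z v))\<^sup>2)"
      proof (intro sum.cong refl)
        fix v assume v: "v \<in> level T i"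
        show "path_prod (\<lambda>k j. (theta j)\<^sup>2 / (theta (T k - 1))\<^sup>2) v *
          (path_prod (\<lambda>k j. step_alpha j) v * (gradp i (w v) \<bullet> (r v - u))
            + L i / 2 * (path_prod (\<lambda>k j. step_alpha j) v)\<^sup>2 * (pnorm P (r v - z v))\<^sup>2)
          = weight v * (gradp i (w v) \<bullet> (r v - u)) + (rate i)\<^sup>2 * L i / 2 * (pnorm P (r v - z v))\<^sup>2"
          unfolding prod1[OF v, symmetric] prod2[OF v, symmetric] by (simp add: distrib_left)
      qed
      finally show ?thesis .
    qed
    moreover have "Q i u \<bullet> (r [] - u) \<le> (\<Sum>t\<in>level T i. weight t * (Q i (r t) \<bullet> (r t - u)))"
    proof -
      have "convex_on Z (\<lambda>x. Q i u \<bullet> (x - u))"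
        by (rule convex_onI[OF _ Z(2)]) (simp add: algebra_simps inner_diff_right inner_add_right)
      then have "weight [] * (Q i u \<bullet> (r [] - u)) \<le> (\<Sum>t\<in>level T i. weight t * (Q i u \<bullet> (r t - u)))"
        using jensen_extensions[of _ "[]" 0 i] i by simp
      also have "\<dots> \<le> (\<Sum>t\<in>level T i. weight t * (Q i (r t) \<bullet> (r t - u)))"
      proof (intro sum_mono mult_left_mono)
        fix t assume "t \<in> level T i"
        then have "r t \<in> Z" using r_in_Z i by auto
        then have "0 \<le> (Q i (r t) - Q i u) \<bullet> (r t - u)"
          using Q_monotone[OF i] u by (auto simp: monotone_op_def)
        then show "Q i u \<bullet> (r t - u) \<le> Q i (r t) \<bullet> (r t - u)" by (simp add: inner_diff_left)
      qed (auto intro: less_imp_le weight_pos)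
      finally show ?thesis by (simp add: weight_def)
    qed
    ultimately have "p i (r []) - p i u + Q i u \<bullet> (r [] - u)
      \<le> (\<Sum>t\<in>level T i. weight t * (gradp i (w t) \<bullet> (r t - u) + Q i (r t) \<bullet> (r t - u))
          + (rate i)\<^sup>2 * L i / 2 * (pnorm P (r t - z t))\<^sup>2)"
      by (simp add: sum.distrib distrib_left)
    also have "\<dots> \<le> (\<Sum>t\<in>level T i. weight t * residual u t (r t)
      + modulus i / 2 * ((pnorm P (u - z t))\<^sup>2 - (pnorm P (u - z (next_index t)))\<^sup>2) + rhs i t)"
      unfolding rhs_def using i no_noise u by (intro sum_mono node_estimate) auto
    also have "\<dots> = (\<Sum>t\<in>level T i. weight t * residual u t (r t))
        + modulus i / 2 * (\<Sum>t\<in>level T i. (pnorm P (u - z t))\<^sup>2 - (pnorm P (u - z (next_index t)))\<^sup>2)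
        + (\<Sum>t\<in>level T i. rhs i t)"
      by (simp add: sum.distrib sum_distrib_left)
    also have "(\<Sum>t\<in>level T i. (pnorm P (u - z t))\<^sup>2 - (pnorm P (u - z (next_index t)))\<^sup>2) \<le> (pnorm P (u - zin))\<^sup>2"
    proof -
      have i': "Suc (i - 1) = i" "i \<le> n" using i by auto
      show ?thesis
        using telescope_level[of "[]" 0 "i - 1" "\<lambda>x. (pnorm P (u - x))\<^sup>2"] z_init[of i] i'
        by (simp add: next_index_def del: replicate_Suc)
    qed
    finally show ?thesis using modulus_pos[OF i] by (simp add: mult_left_mono)
  qed
  have "(\<Sum>i=1..n. p i (r [])) - (\<Sum>i=1..n. p i u) + (\<Sum>i=1..n. Q i u) \<bullet> (r [] - u)
    = (\<Sum>i=1..n. p i (r []) - p i u + Q i u \<bullet> (r [] - u))"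
    by (simp add: sum.distrib sum_subtractf inner_sum_left)
  also have "\<dots> \<le> (\<Sum>i=1..n. (\<Sum>t\<in>level T i. weight t * residual u t (r t))
      + modulus i / 2 * (pnorm P (u - zin))\<^sup>2 + (\<Sum>t\<in>level T i. rhs i t))"
    by (rule sum_mono[OF level])
  also have "\<dots> = (\<Sum>i=1..n. \<Sum>t\<in>level T i. weight t * residual u t (r t))
      + (\<Sum>i=1..n. modulus i / 2 * (pnorm P (u - zin))\<^sup>2) + (\<Sum>i=1..n. \<Sum>t\<in>level T i. rhs i t)"
    by (simp add: sum.distrib)
  finally show ?thesis using sum_residual[OF u] unfolding rhs_def by linarith
qed

end


section \<open>The run satisfies the trace equations\<close>

lemma traced_extensions:
  "traced n T Z P Q \<alpha> \<eta> Gs (m + d) t s \<Longrightarrow> v \<in> extensions T m t \<Longrightarrow> traced n T Z P Q \<alpha> \<eta> Gs d v s"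
  by (induction m arbitrary: t) (auto simp: extensions_Suc)

lemma (in sliding_problem) sliding_run_trace:
  fixes Gs and zin :: 'z
  assumes zin: "zin \<in> Z"
  defines "run \<equiv> sliding_run n T Z P Q step_alpha \<eta> Gs zin"
  defines "s \<equiv> snd run"
  defines "r \<equiv> \<lambda>t. node_value n T Z P \<eta> (n - length t) t s"
  shows "sliding_trace n T Z P p gradp Q L M \<tau> zin (zs s) (zbars s) r (Gvals s)"
    and "fst run = r []"
    and "\<And>t k. t \<in> level T k \<Longrightarrow> k \<in> {1..n} \<Longrightarrow> Gvals s t = Gs t (sliding_trace.w (zs s) (zbars s) t)"
proof -
  have ok: "trace_ok n T Z P Q step_alpha \<eta> Gs n [] (init_state zin)"
    by (rule trace_ok) simp
  have run: "run = sliding_rec n T Z P Q step_alpha \<eta> Gs n [] (init_state zin)"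
    by (simp add: run_def sliding_run_def)
  have off: "unchanged_off [] (init_state zin) s" and tr: "traced n T Z P Q step_alpha \<eta> Gs n [] s"
    and out: "fst run = node_value n T Z P \<eta> n [] s"
    using ok unfolding trace_ok_def run[symmetric] s_def by auto
  show "fst run = r []" by (simp add: r_def out)
  have tr_at: "zbars s (t @ [0]) = zs s (t @ [0]) \<and>
      (\<forall>j<T (Suc k). step_equations n T Z P Q step_alpha \<eta> Gs (n - Suc k) t j s)"
    if t: "t \<in> level T k" and k: "k < n" for t k
  proof -
    have "length t = k" using t by (auto dest: length_extensions)
    have "traced n T Z P Q step_alpha \<eta> Gs (Suc (n - Suc k)) t s"
      by (rule traced_extensions[OF _ t]) (use tr k in simp)
    then show ?thesis using \<open>length t = k\<close> by simp
  qed
  have w_eq: "sliding_w step_alpha s t = sliding_trace.w (zs s) (zbars s) t"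
    if "sliding_trace n T Z P p gradp Q L M \<tau> zin (zs s) (zbars s) r (Gvals s)" for t
    unfolding sliding_w_def sliding_trace.w_def[OF that] sliding_trace.amap_def[OF that] ..
  have GQ: "Gvals s t = Gs t (sliding_w step_alpha s t)" "Qvals s t = Q k (zs s t)"
    if t: "t \<in> level T k" and k: "k \<in> {1..n}" for t k
  proof -
    have k': "k = Suc (k - 1)" "k - 1 < n" using k by auto
    then have "t \<in> level T (Suc (k - 1))" using t by simp
    then obtain t' j where t': "t = t' @ [j]" "t' \<in> level T (k - 1)" "j < T (Suc (k - 1))"
      by (rule level_Suc_cases)
    moreover have "length t' = k - 1" using t' by (auto dest: length_extensions)
    ultimately show "Gvals s t = Gs t (sliding_w step_alpha s t)" "Qvals s t = Q k (zs s t)"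
      using tr_at[of t' "k - 1"] k' by (auto simp: step_equations_def)
  qed
  show trace: "sliding_trace n T Z P p gradp Q L M \<tau> zin (zs s) (zbars s) r (Gvals s)"
  proof unfold_locales
    show "zin \<in> Z" by fact
    show "zs s (replicate k 0) = zin" for k
      using off by (simp add: unchanged_off_def init_state_def set_replicate_conv_if)
    fix k t assume t: "t \<in> level T k"
    then have len: "length t = k" by (auto dest: length_extensions)
    show "k < n \<Longrightarrow> zbars s (t @ [0]) = zs s (t @ [0])" using tr_at[OF t] by simp
    show "k < n \<Longrightarrow> r t = zbars s (t @ [T (Suc k)])"
      by (simp add: r_def len node_value_def)
    fix j assume j: "j < T (Suc k)"
    show "zs s (t @ [Suc j] @ replicate (Suc m) 0) = zs s (t @ [j] @ [T (Suc (Suc k))] @ replicate m 0)"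
      if "Suc (Suc k) + m \<le> n" for m
      using tr_at[OF t] j that len by (auto simp: step_equations_def)
    assume k: "k < n"
    note st = tr_at[OF t k, THEN conjunct2, rule_format, OF j, unfolded step_equations_def len]
    have r: "node_value n T Z P \<eta> (n - Suc k) (t @ [j]) s = r (t @ [j])" by (simp add: r_def len)
    show "zbars s (t @ [Suc j]) = step_alpha j *\<^sub>R r (t @ [j]) + (1 - step_alpha j) *\<^sub>R zbars s (t @ [j])"
      using st by (simp add: r)
    show "zs s (t @ [Suc j]) =
        arg_min_on (prox_objective P {()} (\<lambda>_. \<eta> (t @ [j]))
          (\<lambda>_. Q (Suc k) (r (t @ [j])) - Q (Suc k) (zs s (t @ [j]))) (\<lambda>_. r (t @ [j]))) Z"
      using st by (simp add: r prox_objective_def[abs_def])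
  next
    fix t assume t: "t \<in> level T n"
    then have len: "length t = n" by (auto dest: length_extensions)
    have "Qvals s (take i t) = Q i (zs s (take i t))" if "i \<in> {1..n}" for i
      by (rule GQ(2)[OF _ that]) (use t that in \<open>auto simp: extensions_def\<close>)
    then have "prox_objective P {1..n} (\<lambda>i. \<eta> (take i t)) (\<lambda>i. Gvals s (take i t) + Q i (zs s (take i t)))
        (\<lambda>i. zs s (take i t)) = (\<lambda>z. \<Sum>i=1..n. (Gvals s (take i t) + Qvals s (take i t)) \<bullet> z
                     + 1/2 * \<eta> (take i t) * (pnorm P (z - zs s (take i t)))\<^sup>2)"
      by (auto simp: prox_objective_def fun_eq_iff intro!: sum.cong)
    then show "r t = arg_min_on (prox_objective P {1..n} (\<lambda>i. \<eta> (take i t))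
        (\<lambda>i. Gvals s (take i t) + Q i (zs s (take i t))) (\<lambda>i. zs s (take i t))) Z"
      by (simp add: r_def len node_value_def leaf_step_def)
  qed
  show "\<And>t k. t \<in> level T k \<Longrightarrow> k \<in> {1..n} \<Longrightarrow> Gvals s t = Gs t (sliding_trace.w (zs s) (zbars s) t)"
    using GQ(1) w_eq[OF trace] by metis
qed


section \<open>Execution order and filtration\<close>

abbreviation lex_less :: "nat list \<Rightarrow> nat list \<Rightarrow> bool" where
  "lex_less \<equiv> ord_class.lexordp"

lemma lexordp_append_cancel [simp]: "lex_less (us @ xs) (us @ ys) \<longleftrightarrow> lex_less xs (ys :: nat list)"
  by (induction us) auto

lemma takeWhile_sorted_wrt:
  assumes "sorted_wrt R xs" "x \<in> set xs" "\<And>x. \<not> R x x" "\<And>x y. R x y \<Longrightarrow> \<not> R y x"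
  shows "set (takeWhile (\<lambda>y. y \<noteq> x) xs) = {y \<in> set xs. R y x}"
  using assms
proof (induction xs)
  case (Cons a xs)
  then show ?case by (cases "x = a") auto
qed simp

text \<open>The execution order is the lexicographic order, in which an index follows its proper prefixes.\<close>
lemma sorted_wrt_nodes_below: "sorted_wrt lex_less (nodes_below T d t)"
proof (induction d arbitrary: t)
  case (Suc d)
  define blk where "blk j = (t @ [j]) # nodes_below T d (t @ [j])" for j
  have ext: "\<exists>u. x = t @ j # u" if "x \<in> set (blk j)" for x j
    using that by (auto simp: blk_def set_nodes_below)
  have "sorted_wrt lex_less (blk j)" for j
    using Suc by (auto simp: blk_def set_nodes_below intro!: lexordp_append_rightI)
  moreover have "lex_less x y" if "x \<in> set (blk i)" "y \<in> set (blk j)" "i < j" for x y i j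
    using ext[OF that(1)] ext[OF that(2)] that(3) by auto
  ultimately have "sorted_wrt lex_less (concat (map blk [0..<m]))" for m
    by (induction m) (auto simp: sorted_wrt_append)
  then show ?case by (simp add: blk_def[abs_def])
qed simp

text \<open>
  The history is extended to all indices by the lexicographic order, since iterates at the ends of
  loops have indices that are not nodes.
\<close>
definition history ::
  "nat \<Rightarrow> (nat \<Rightarrow> nat) \<Rightarrow> 'w measure \<Rightarrow> 's measure \<Rightarrow> ('w \<Rightarrow> 'z::euclidean_space) \<Rightarrow>
   (nat list \<Rightarrow> 'w \<Rightarrow> 's) \<Rightarrow> nat list \<Rightarrow> 'w measure" where
  "history n T Pr S zin \<xi> u =
     sigma (space Pr)
       ({zin -` A \<inter> space Pr | A. A \<in> sets borel} \<union>
        {\<xi> \<mu> -` A \<inter> space Pr | \<mu> A. \<mu> \<in> nodes n T \<and> lex_less \<mu> u \<and> A \<in> sets S})"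

lemma node_history_eq:
  assumes "\<nu> \<in> nodes n T"
  shows "node_history n T Pr S zin \<xi> \<nu> = history n T Pr S zin \<xi> \<nu>"
proof -
  have "set (takeWhile (\<lambda>\<mu>. \<mu> \<noteq> \<nu>) (execution_order n T)) = {\<mu> \<in> nodes n T. lex_less \<mu> \<nu>}"
    unfolding set_execution_order[symmetric]
  proof (rule takeWhile_sorted_wrt)
    show "sorted_wrt lex_less (execution_order n T)"
      unfolding execution_order_def by (rule sorted_wrt_nodes_below)
  qed (use assms lexordp_irreflexive' lexordp_antisym in \<open>auto simp: set_execution_order\<close>)
  then show ?thesis unfolding node_history_def history_def by (simp add: conj_assoc)
qed

lemma space_history [simp]: "space (history n T Pr S zin \<xi> u) = space Pr"
  unfolding history_def by (rule space_measure_of) auto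

lemma sets_history:
  "sets (history n T Pr S zin \<xi> u) = sigma_sets (space Pr)
       ({zin -` A \<inter> space Pr | A. A \<in> sets borel} \<union>
        {\<xi> \<mu> -` A \<inter> space Pr | \<mu> A. \<mu> \<in> nodes n T \<and> lex_less \<mu> u \<and> A \<in> sets S})"
  unfolding history_def by (rule sets_measure_of) auto

lemma history_mono:
  assumes "u = v \<or> lex_less u v"
  shows "sets (history n T Pr S zin \<xi> u) \<subseteq> sets (history n T Pr S zin \<xi> v)"
  unfolding sets_history by (rule sigma_sets_subseteq) (use assms lexordp_trans in blast)

lemma measurable_history_mono:
  assumes "f \<in> borel_measurable (history n T Pr S zin \<xi> u)" "u = v \<or> lex_less u v"
  shows "f \<in> borel_measurable (history n T Pr S zin \<xi> v)"
  using assms(1) history_mono[OF assms(2)] unfolding measurable_def space_history by blast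

lemma zin_measurable_history: "zin \<in> borel_measurable (history n T Pr S zin \<xi> u)"
  unfolding measurable_def sets_history by (auto intro!: sigma_sets.Basic)


lemma subalgebra_history:
  assumes "zin \<in> borel_measurable Pr" "\<And>\<nu>. \<nu> \<in> nodes n T \<Longrightarrow> \<xi> \<nu> \<in> measurable Pr S"
  shows "subalgebra Pr (history n T Pr S zin \<xi> u)"
  unfolding subalgebra_def sets_history using assms
  by (auto intro!: sets.sigma_sets_subset measurable_sets)


section \<open>The run is adapted\<close>

text \<open>
  Each oracle is constrained only at the nodes of its own level, where it is called. This form
  applies also to the bilinear problem, where the samples at a node serve one block of variables.
\<close>
locale sliding_oracle =
  prob_space Pr + sliding_problem n T Z P p gradp Q L M "noise_tau T \<sigma> \<Omega>"
  for Pr :: "'w measure" and n T and Z :: "'z::euclidean_space set" and P p gradp Q L M \<sigma> \<Omega> +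
  fixes S :: "'s measure"
    and G :: "nat \<Rightarrow> 'z \<Rightarrow> 's \<Rightarrow> 'z"
    and \<xi> :: "nat list \<Rightarrow> 'w \<Rightarrow> 's"
    and zin :: "'w \<Rightarrow> 'z"
  assumes n_pos: "1 \<le> n"
    and \<sigma>_nonneg: "\<And>i. i \<in> {1..n} \<Longrightarrow> 0 \<le> \<sigma> i"
    and G_measurable: "\<And>i. i \<in> {1..n} \<Longrightarrow>
          (\<lambda>(v, x). G i v x) \<in> borel_measurable (restrict_space borel Z \<Otimes>\<^sub>M S)"
    and \<xi>_measurable: "\<And>\<nu>. \<nu> \<in> nodes n T \<Longrightarrow> \<xi> \<nu> \<in> measurable Pr S"
    and oracle_unbiased: "\<And>i \<nu>. i \<in> {1..n} \<Longrightarrow> \<nu> \<in> level T i \<Longrightarrow>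
          unbiased_oracle Pr (node_history n T Pr S zin \<xi> \<nu>) (dual_pnorm P) (\<sigma> i) Z
            (gradp i) (G i) (\<xi> \<nu>)"
    and zin_measurable: "zin \<in> borel_measurable Pr"
    and zin_in_Z: "\<And>\<omega>. \<omega> \<in> space Pr \<Longrightarrow> zin \<omega> \<in> Z"
    and \<Omega>_pos: "0 < \<Omega>"
    and \<Omega>_bound: "AE \<omega> in Pr. (SUP z\<in>Z. (pnorm P (zin \<omega> - z))\<^sup>2) \<le> \<Omega>"
begin

lemma step_eta_eq: "step_eta T L M \<sigma> \<Omega> = \<eta>"
  by (rule ext) (simp add: step_eta_def \<eta>_def path_prod_eq_atLeastAtMost Let_def prod_dividef)

definition run where "run \<omega> = tuned_run n T Z P Q G L M \<sigma> \<Omega> (zin \<omega>) (\<lambda>\<nu>. \<xi> \<nu> \<omega>)"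
definition z where "z \<omega> = zs (snd (run \<omega>))"
definition zb where "zb \<omega> = zbars (snd (run \<omega>))"
definition g where "g \<omega> = Gvals (snd (run \<omega>))"
definition r where "r \<omega> t = node_value n T Z P \<eta> (n - length t) t (snd (run \<omega>))"
definition w where "w \<omega> = sliding_trace.w (z \<omega>) (zb \<omega>)"
definition zout where "zout \<omega> = fst (run \<omega>)"

abbreviation "hist \<equiv> history n T Pr S zin \<xi>"

lemma run_trace:
  assumes "\<omega> \<in> space Pr"
  shows "sliding_trace n T Z P p gradp Q L M (noise_tau T \<sigma> \<Omega>) (zin \<omega>) (z \<omega>) (zb \<omega>) (r \<omega>) (g \<omega>)"
    and "zout \<omega> = r \<omega> []"
    and "t \<in> level T i \<Longrightarrow> i \<in> {1..n} \<Longrightarrow> g \<omega> t = G i (w \<omega> t) (\<xi> t \<omega>)"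
  using sliding_run_trace[OF zin_in_Z[OF assms], where Gs="\<lambda>t v. G (length t) v (\<xi> t \<omega>)"]
  by (auto simp: run_def z_def zb_def r_def[abs_def] g_def w_def zout_def tuned_run_def step_eta_eq
      dest: length_extensions)

lemma hist_subalgebra: "subalgebra Pr (hist u)"
  by (rule subalgebra_history[OF zin_measurable \<xi>_measurable])

lemma hist_\<xi>:
  assumes "\<mu> \<in> nodes n T" "lex_less \<mu> u"
  shows "\<xi> \<mu> \<in> measurable (hist u) S"
  unfolding measurable_def sets_history using assms measurable_space[OF \<xi>_measurable]
  by (auto intro!: sigma_sets.Basic)

lemma level_nodes: "t \<in> level T i \<Longrightarrow> i \<in> {1..n} \<Longrightarrow> t \<in> nodes n T"
  by (auto simp: nodes_eq_levels)

lemma measurable_compose_on: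
  assumes h: "continuous_on Z h" and v: "v \<in> borel_measurable F" "\<And>\<omega>. \<omega> \<in> space F \<Longrightarrow> v \<omega> \<in> Z"
  shows "(\<lambda>\<omega>. h (v \<omega>)) \<in> borel_measurable F"
proof -
  have "v \<in> measurable F (restrict_space borel Z)"
    using v by (intro measurable_restrict_space2) auto
  moreover have "h \<in> borel_measurable (restrict_space borel Z)"
    by (rule borel_measurable_continuous_on_restrict[OF h])
  ultimately show ?thesis by (rule measurable_compose)
qed

lemma oracle_answer_measurable:
  assumes i: "i \<in> {1..n}" and v: "v \<in> borel_measurable F" "\<And>\<omega>. \<omega> \<in> space F \<Longrightarrow> v \<omega> \<in> Z"
    and x: "x \<in> measurable F S"
  shows "(\<lambda>\<omega>. G i (v \<omega>) (x \<omega>)) \<in> borel_measurable F"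
proof -
  have "v \<in> measurable F (restrict_space borel Z)"
    using v by (intro measurable_restrict_space2) auto
  then have "(\<lambda>\<omega>. (v \<omega>, x \<omega>)) \<in> measurable F (restrict_space borel Z \<Otimes>\<^sub>M S)"
    using x by (rule measurable_Pair)
  from measurable_compose[OF this G_measurable[OF i]] show ?thesis by simp
qed

lemma continuous_Q: "i \<in> {1..n} \<Longrightarrow> continuous_on Z (Q i)"
  by (rule lipschitz_op_continuous_on[OF P Q_lipschitz])

lemma continuous_gradp: "i \<in> {1..n} \<Longrightarrow> continuous_on Z (gradp i)"
  using p_smooth by (intro lipschitz_op_continuous_on[OF P, of Z "L i"]) (auto simp: convex_smooth_def)

lemma in_Z:
  assumes "\<omega> \<in> space Pr" "t \<in> level T k" "k \<le> n"
  shows "z \<omega> t \<in> Z" "r \<omega> t \<in> Z" "w \<omega> t \<in> Z"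
  using sliding_trace.z_in_Z[OF run_trace(1)] sliding_trace.r_in_Z[OF run_trace(1)]
    sliding_trace.w_in_Z[OF run_trace(1)] assms unfolding w_def by auto

lemma prefix_lex_less: "prefix s t \<Longrightarrow> s = t \<or> lex_less s t"
  by (auto simp: prefix_def intro!: lexordp_append_rightI)

text \<open>The point \<open>w\<^sub>t\<close> combines \<open>z\<^sub>t\<close> with averages at the prefixes of \<open>t\<close>.\<close>
lemma w_measurable:
  assumes t: "t \<in> level T k" "k \<le> n" and z: "(\<lambda>\<omega>. z \<omega> t) \<in> borel_measurable (hist t)"
    and zb: "\<And>t' l j. t' \<in> level T l \<Longrightarrow> l < n \<Longrightarrow> j < T (Suc l) \<Longrightarrow> prefix (t' @ [j]) t \<Longrightarrow>
      (\<lambda>\<omega>. zb \<omega> (t' @ [j])) \<in> borel_measurable (hist (t' @ [j]))"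
  shows "(\<lambda>\<omega>. w \<omega> t) \<in> borel_measurable (hist t)"
proof -
  have "(\<lambda>\<omega>. sliding_trace.amap (zb \<omega>) s (x \<omega>)) \<in> borel_measurable (hist t)"
    if "s \<in> level T l" "l \<le> n" "prefix s t" "x \<in> borel_measurable (hist t)" for s l x
    using that
  proof (induction s arbitrary: l x rule: rev_induct)
    case Nil
    have "(\<lambda>\<omega>. sliding_trace.amap (zb \<omega>) [] (x \<omega>)) \<in> borel_measurable (hist t) \<longleftrightarrow> x \<in> borel_measurable (hist t)"
      by (rule measurable_cong) (simp add: sliding_trace.amap_Nil[OF run_trace(1)])
    then show ?case using Nil by simp
  next
    case (snoc j s)
    obtain l' where l: "l = Suc l'" using length_extensions[OF snoc.prems(1)] by auto
    have "(\<lambda>\<omega>. zb \<omega> (s @ [j])) \<in> borel_measurable (hist t)"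
      by (rule measurable_history_mono[OF zb[of s l' j] prefix_lex_less]) (use snoc.prems l in auto)
    then have "(\<lambda>\<omega>. step_alpha j *\<^sub>R x \<omega> + (1 - step_alpha j) *\<^sub>R zb \<omega> (s @ [j])) \<in> borel_measurable (hist t)"
      using snoc.prems(4) by (intro borel_measurable_add borel_measurable_scaleR) auto
    then have "(\<lambda>\<omega>. sliding_trace.amap (zb \<omega>) s (step_alpha j *\<^sub>R x \<omega> + (1 - step_alpha j) *\<^sub>R zb \<omega> (s @ [j])))
        \<in> borel_measurable (hist t)"
      using snoc.prems l by (intro snoc.IH[of l']) (auto dest: append_prefixD)
    then show ?case
      by (rule measurable_cong[THEN iffD1, rotated]) (simp add: sliding_trace.amap_snoc[OF run_trace(1)])
  qed
  from this[OF t prefix_order.refl z] show ?thesis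
    by (rule measurable_cong[THEN iffD1, rotated]) (simp add: w_def sliding_trace.w_def[OF run_trace(1)])
qed

text \<open>
  The indices at which iterates and averages are written, those at the ends of loops included.
\<close>
definition z_indices :: "nat list set" where
  "z_indices = {u. \<exists>k\<le>n. u \<in> level T k} \<union>
     {t @ [Suc j] @ replicate m 0 | t j m k. t \<in> level T k \<and> j < T (Suc k) \<and> Suc k + m \<le> n}"

definition zb_indices :: "nat list set" where
  "zb_indices = {t @ [j] | t j k. t \<in> level T k \<and> k < n \<and> j \<le> T (Suc k)}"

lemma finite_indices: "finite (z_indices \<union> zb_indices)"
proof (rule finite_subset)
  define B where "B = (\<Sum>k\<le>n. T k)"
  have B: "T k \<le> B" if "k \<le> n" for k unfolding B_def using that by (intro member_le_sum) auto
  have lev: "set t \<subseteq> {..B} \<and> length t = k" if "t \<in> level T k" "k \<le> n" for t k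
  proof -
    have len: "length t = k" using length_extensions[OF that(1)] by simp
    have "t ! l \<le> B" if l: "l < k" for l
    proof -
      have "t ! l < T (Suc l)" using \<open>t \<in> level T k\<close> l by (auto simp: extensions_def)
      also have "T (Suc l) \<le> B" using B l \<open>k \<le> n\<close> by simp
      finally show ?thesis by simp
    qed
    then show ?thesis using len by (auto simp: in_set_conv_nth)
  qed
  show "z_indices \<union> zb_indices \<subseteq> {u. set u \<subseteq> {..B} \<and> length u \<le> n}"
  proof
    fix u assume "u \<in> z_indices \<union> zb_indices"
    then consider k where "k \<le> n" "u \<in> level T k"
      | t j m k where "u = t @ [Suc j] @ replicate m 0" "t \<in> level T k" "j < T (Suc k)" "Suc k + m \<le> n"
      | t j k where "u = t @ [j]" "t \<in> level T k" "k < n" "j \<le> T (Suc k)"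
      unfolding z_indices_def zb_indices_def by auto
    then show "u \<in> {u. set u \<subseteq> {..B} \<and> length u \<le> n}"
    proof cases
      case 1 then show ?thesis using lev[of u k] by simp
    next
      case 2 then show ?thesis using lev[of t k] B[of "Suc k"] by auto
    next
      case 3 then show ?thesis using lev[of t k] B[of "Suc k"] by auto
    qed
  qed
  show "finite {u. set u \<subseteq> {..B} \<and> length u \<le> n}" by (rule finite_lists_length_le) simp
qed

text \<open>
  Every iterate is determined by oracle answers at lexicographically smaller nodes; the claim follows
  by induction along the lexicographic order.
\<close>
lemma iterates_measurable:
  "(u \<in> z_indices \<longrightarrow> (\<lambda>\<omega>. z \<omega> u) \<in> borel_measurable (hist u)) \<and>
   (u \<in> zb_indices \<longrightarrow> (\<lambda>\<omega>. zb \<omega> u) \<in> borel_measurable (hist u))"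
proof (induction "card {v \<in> z_indices \<union> zb_indices. lex_less v u}" arbitrary: u rule: less_induct)
  case less
  have below: "(v \<in> z_indices \<longrightarrow> (\<lambda>\<omega>. z \<omega> v) \<in> borel_measurable (hist v)) \<and>
     (v \<in> zb_indices \<longrightarrow> (\<lambda>\<omega>. zb \<omega> v) \<in> borel_measurable (hist v))"
    if v: "lex_less v u" for v
  proof (cases "v \<in> z_indices \<union> zb_indices")
    case True
    have "{x \<in> z_indices \<union> zb_indices. lex_less x v} \<subset> {x \<in> z_indices \<union> zb_indices. lex_less x u}"
      using True v lexordp_trans[OF _ v] lexordp_irreflexive'[of v] by blast
    then have "card {x \<in> z_indices \<union> zb_indices. lex_less x v} < card {x \<in> z_indices \<union> zb_indices. lex_less x u}"
      using finite_indices by (intro psubset_card_mono) auto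
    then show ?thesis by (rule less)
  qed simp
  have z: "(\<lambda>\<omega>. z \<omega> t) \<in> borel_measurable (hist t)" if "t \<in> level T k" "k \<le> n" "lex_less t u" for t k
    using below[OF that(3)] that(1,2) by (auto simp: z_indices_def)
  have zbm: "(\<lambda>\<omega>. zb \<omega> (t @ [j])) \<in> borel_measurable (hist (t @ [j]))"
    if "t \<in> level T k" "k < n" "j \<le> T (Suc k)" "lex_less (t @ [j]) u" for t k j
    using below[OF that(4)] that(1-3) by (auto simp: zb_indices_def)
  have gm: "(\<lambda>\<omega>. g \<omega> t) \<in> borel_measurable (hist u)" if t: "t \<in> level T k" "k \<in> {1..n}" "lex_less t u" for t k
  proof -
    have "(\<lambda>\<omega>. w \<omega> t) \<in> borel_measurable (hist t)"
    proof (rule w_measurable[OF t(1)])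
      fix t' l j assume "t' \<in> level T l" "l < n" "j < T (Suc l)" "prefix (t' @ [j]) t"
      moreover have "lex_less (t' @ [j]) u"
        using prefix_lex_less[OF \<open>prefix (t' @ [j]) t\<close>] lexordp_trans[OF _ t(3)] t(3) by auto
      ultimately show "(\<lambda>\<omega>. zb \<omega> (t' @ [j])) \<in> borel_measurable (hist (t' @ [j]))"
        by (intro zbm[of t' l]) simp_all
    next
      show "(\<lambda>\<omega>. z \<omega> t) \<in> borel_measurable (hist t)" by (rule z[OF t(1) _ t(3)]) (use t in simp)
    qed (use t in simp)
    then have "(\<lambda>\<omega>. w \<omega> t) \<in> borel_measurable (hist u)" by (rule measurable_history_mono) (use t in simp)
    then have "(\<lambda>\<omega>. G k (w \<omega> t) (\<xi> t \<omega>)) \<in> borel_measurable (hist u)"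
      using t in_Z(3)[of _ t k] hist_\<xi>[of t u] level_nodes[of t k] by (intro oracle_answer_measurable) auto
    then show ?thesis
      by (rule measurable_cong[THEN iffD1, rotated]) (use t run_trace(3) in simp)
  qed
  have rm: "(\<lambda>\<omega>. r \<omega> (t @ [j])) \<in> borel_measurable (hist u)"
    if t: "t \<in> level T k" "k < n" "j < T (Suc k)" and u: "t @ [Suc j] = u \<or> lex_less (t @ [Suc j]) u" for t k j
  proof -
    have tj: "t @ [j] \<in> level T (Suc k)" using t by simp
    have lt: "lex_less x u" if "lex_less x (t @ [Suc j])" for x
      using that u lexordp_trans by blast
    show ?thesis
    proof (cases "Suc k = n")
      case False
      then have k: "Suc k < n" using t by simp
      have "lex_less (t @ [j] @ [T (Suc (Suc k))]) u" by (rule lt) simp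
      then have "(\<lambda>\<omega>. zb \<omega> ((t @ [j]) @ [T (Suc (Suc k))])) \<in> borel_measurable (hist u)"
        by (intro measurable_history_mono[OF zbm[OF tj k]]) simp_all
      then show ?thesis
        by (rule measurable_cong[THEN iffD1, rotated])
           (use sliding_trace.r_inner[OF run_trace(1) tj k] in simp)
    next
      case True
      then have leaf: "t @ [j] \<in> level T n" using tj by simp
      have take: "take i (t @ [j]) \<in> level T i" "lex_less (take i (t @ [j])) u" if "i \<in> {1..n}" for i
      proof -
        show "take i (t @ [j]) \<in> level T i"
          using leaf that by (auto simp: extensions_def simp del: take_append)
        show "lex_less (take i (t @ [j])) u"
        proof (rule lt, cases "i \<le> length t")
          case True
          then show "lex_less (take i (t @ [j])) (t @ [Suc j])"
            using lexordp_append_rightI[of "drop i t @ [Suc j]" "take i t"]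
            by (metis append_assoc append_is_Nil_conv append_take_drop_id not_Cons_self2 take_append
                take_eq_Nil diff_is_0_eq' append_Nil2 take0)
        next
          case False
          then have "take i (t @ [j]) = t @ [j]" by simp
          then show "lex_less (take i (t @ [j])) (t @ [Suc j])" by simp
        qed
      qed
      have zm: "(\<lambda>\<omega>. z \<omega> (take i (t @ [j]))) \<in> borel_measurable (hist u)" if "i \<in> {1..n}" for i
        using take[OF that] that by (intro measurable_history_mono[OF z[of _ i]]) auto
      have Qm: "(\<lambda>\<omega>. Q i (z \<omega> (take i (t @ [j])))) \<in> borel_measurable (hist u)" if "i \<in> {1..n}" for i
        using take[OF that] that in_Z(1)[of _ _ i]
        by (intro measurable_compose_on[OF continuous_Q[OF that] zm]) auto
      have pos: "0 < \<eta> (take i (t @ [j]))" if "i \<in> {1..n}" for i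
        using eta_pos[OF take(1)[OF that] that] .
      have "(\<lambda>\<omega>. arg_min_on (prox_objective P {1..n} (\<lambda>i. \<eta> (take i (t @ [j])))
          (\<lambda>i. g \<omega> (take i (t @ [j])) + Q i (z \<omega> (take i (t @ [j])))) (\<lambda>i. z \<omega> (take i (t @ [j])))) Z)
          \<in> borel_measurable (hist u)"
        using True
        by (intro borel_measurable_prox P Z sum_pos borel_measurable_add zm Qm gm[OF take(1) _ take(2)] pos) auto
      then show ?thesis
        by (rule measurable_cong[THEN iffD1, rotated])
           (use sliding_trace.r_leaf[OF run_trace(1) leaf] in simp)
    qed
  qed
  have z_u: "(\<lambda>\<omega>. z \<omega> u) \<in> borel_measurable (hist u)" if u: "u \<in> z_indices"
  proof -
    have Suc: ?thesis if t: "u = t @ [Suc j] @ replicate m 0" "t \<in> level T k" "j < T (Suc k)" "Suc k + m \<le> n" for t j m k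
    proof (cases m)
      case 0
      then have u: "u = t @ [Suc j]" and k: "k < n" using t by auto
      have tj: "t @ [j] \<in> level T (Suc k)" using t by simp
      have i: "Suc k \<in> {1..n}" using k by simp
      have zm: "(\<lambda>\<omega>. z \<omega> (t @ [j])) \<in> borel_measurable (hist u)"
        using k by (intro measurable_history_mono[OF z[OF tj]]) (auto simp: u)
      have rm': "(\<lambda>\<omega>. r \<omega> (t @ [j])) \<in> borel_measurable (hist u)"
        using t k u by (intro rm) auto
      have "(\<lambda>\<omega>. arg_min_on (prox_objective P {()} (\<lambda>_. \<eta> (t @ [j]))
          (\<lambda>_. Q (Suc k) (r \<omega> (t @ [j])) - Q (Suc k) (z \<omega> (t @ [j]))) (\<lambda>_. r \<omega> (t @ [j]))) Z) \<in> borel_measurable (hist u)"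
        using in_Z[OF _ tj] k eta_pos[OF tj i]
        by (intro borel_measurable_prox P Z borel_measurable_diff rm'
            measurable_compose_on[OF continuous_Q[OF i] zm] measurable_compose_on[OF continuous_Q[OF i] rm']) auto
      then show ?thesis
        by (rule measurable_cong[THEN iffD1, rotated])
           (use sliding_trace.z_Suc[OF run_trace(1) t(2) k t(3)] u in simp)
    next
      case (Suc m')
      have pos: "0 < T (Suc (Suc k))" using t Suc T_pos[of "Suc (Suc k)"] by simp
      have idx: "t @ [j] @ [T (Suc (Suc k))] @ replicate m' 0 \<in> z_indices"
      proof -
        have "t @ [j] @ [T (Suc (Suc k))] @ replicate m' 0
            = (t @ [j]) @ [Suc (T (Suc (Suc k)) - 1)] @ replicate m' 0" using pos by simp
        moreover have "t @ [j] \<in> level T (Suc k)" "T (Suc (Suc k)) - 1 < T (Suc (Suc k))" "Suc (Suc k) + m' \<le> n"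
          using t Suc pos by auto
        ultimately show ?thesis unfolding z_indices_def by blast
      qed
      have "lex_less (t @ [j] @ [T (Suc (Suc k))] @ replicate m' 0) u" by (simp add: t(1))
      then have "(\<lambda>\<omega>. z \<omega> (t @ [j] @ [T (Suc (Suc k))] @ replicate m' 0)) \<in> borel_measurable (hist u)"
        using below idx by (blast intro: measurable_history_mono)
      then show ?thesis
        by (rule measurable_cong[THEN iffD1, rotated])
           (use sliding_trace.z_copy[OF run_trace(1) t(2,3), of _ m'] t Suc in simp)
    qed
    from u consider k where "k \<le> n" "u \<in> level T k"
      | t j m k where "u = t @ [Suc j] @ replicate m 0" "t \<in> level T k" "j < T (Suc k)" "Suc k + m \<le> n"
      unfolding z_indices_def by auto
    then show ?thesis
    proof cases
      case 1
      from 1(2) show ?thesis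
      proof (cases rule: level_cases)
        assume "u = replicate k 0"
        then show ?thesis
          by (intro measurable_cong[THEN iffD1, rotated, OF zin_measurable_history])
             (use sliding_trace.z_init[OF run_trace(1)] 1 in simp)
      qed (use Suc 1 in auto)
    qed (use Suc in auto)
  qed
  moreover have "(\<lambda>\<omega>. zb \<omega> u) \<in> borel_measurable (hist u)" if "u \<in> zb_indices"
  proof -
    from that obtain t j k where t: "u = t @ [j]" "t \<in> level T k" "k < n" "j \<le> T (Suc k)"
      unfolding zb_indices_def by auto
    show ?thesis
    proof (cases j)
      case 0
      have "u \<in> level T (Suc k)" using t 0 T_pos[of "Suc k"] by simp
      then have "u \<in> z_indices" using t by (auto simp: z_indices_def simp del: snoc_in_level intro!: exI[of _ "Suc k"])
      from z_u[OF this] show ?thesis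
        by (rule measurable_cong[THEN iffD1, rotated])
           (use sliding_trace.zb_0[OF run_trace(1) t(2,3)] t(1) 0 in simp)
    next
      case (Suc j')
      have "(\<lambda>\<omega>. zb \<omega> (t @ [j'])) \<in> borel_measurable (hist u)"
        using t Suc by (intro measurable_history_mono[OF zbm[of t k j']]) auto
      moreover have "(\<lambda>\<omega>. r \<omega> (t @ [j'])) \<in> borel_measurable (hist u)"
        using t Suc by (intro rm[of t k j']) auto
      ultimately have "(\<lambda>\<omega>. step_alpha j' *\<^sub>R r \<omega> (t @ [j']) + (1 - step_alpha j') *\<^sub>R zb \<omega> (t @ [j'])) \<in> borel_measurable (hist u)"
        by (intro borel_measurable_add borel_measurable_scaleR) auto
      then show ?thesis
        by (rule measurable_cong[THEN iffD1, rotated])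
           (use sliding_trace.zb_Suc[OF run_trace(1) t(2,3), of _ j'] t Suc in simp)
    qed
  qed
  ultimately show ?case by blast
qed

end


section \<open>The gap function\<close>

lemma gap_bdd_above:
  assumes "compact Z" and p: "\<And>i. i \<in> {1..n} \<Longrightarrow> continuous_on Z (p i)" and Q: "\<And>i. i \<in> {1..n} \<Longrightarrow> continuous_on Z (Q i)"
  shows "bdd_above ((\<lambda>z. (\<Sum>i=1..n. p i u) - (\<Sum>i=1..n. p i z) + (\<Sum>i=1..n. Q i z) \<bullet> (u - z)) ` Z)"
proof -
  have "continuous_on Z (\<lambda>z. (\<Sum>i=1..n. p i u) - (\<Sum>i=1..n. p i z) + (\<Sum>i=1..n. Q i z) \<bullet> (u - z))"
    by (intro continuous_intros p Q)
  then show ?thesis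
    by (intro bounded_imp_bdd_above compact_imp_bounded compact_continuous_image \<open>compact Z\<close>)
qed

text \<open>
  Up to the continuous function \<open>p\<close>, the gap is a supremum of affine functions with a common
  Lipschitz constant, the bound of \<open>Q\<close> on \<open>Z\<close>.
\<close>
lemma gap_continuous_on:
  assumes Z: "compact Z" "Z \<noteq> {}" and p: "\<And>i. i \<in> {1..n} \<Longrightarrow> continuous_on Z (p i)"
    and Q: "\<And>i. i \<in> {1..n} \<Longrightarrow> continuous_on Z (Q i)"
  shows "continuous_on Z (gap n Z p Q)"
proof -
  define q where "q z = (\<Sum>i=1..n. Q i z)" for z
  define F where "F z = (\<Sum>i=1..n. p i z)" for z
  have "continuous_on Z q" unfolding q_def by (intro continuous_intros Q)
  then obtain K where K: "\<And>z. z \<in> Z \<Longrightarrow> norm (q z) \<le> K"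
    using compact_continuous_image[OF _ Z(1)] compact_imp_bounded bounded_iff by (metis image_eqI)
  have K0: "0 \<le> K" using Z(2) K norm_ge_zero order.trans by blast
  have gap: "gap n Z p Q u = (SUP z\<in>Z. F u - F z + q z \<bullet> (u - z))" for u
    by (simp add: gap_def F_def q_def)
  have bdd: "bdd_above ((\<lambda>z. F u - F z + q z \<bullet> (u - z)) ` Z)" for u
    unfolding F_def q_def by (rule gap_bdd_above[OF Z(1) p Q])
  have le: "gap n Z p Q u - F u \<le> (gap n Z p Q v - F v) + K * norm (u - v)" for u v
  proof -
    have "gap n Z p Q u \<le> F u - F v + gap n Z p Q v + K * norm (u - v)"
      unfolding gap[of u]
    proof (rule cSUP_least[OF Z(2)])
      fix z assume z: "z \<in> Z"
      have "F v - F z + q z \<bullet> (v - z) \<le> gap n Z p Q v"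
        unfolding gap by (rule cSUP_upper[OF z bdd])
      moreover have "q z \<bullet> (u - v) \<le> K * norm (u - v)"
        using norm_cauchy_schwarz[of "q z" "u - v"] mult_right_mono[OF K[OF z], of "norm (u - v)"] by simp
      ultimately show "F u - F z + q z \<bullet> (u - z) \<le> F u - F v + gap n Z p Q v + K * norm (u - v)"
        by (simp add: inner_diff_right)
    qed
    then show ?thesis by simp
  qed
  have "K-lipschitz_on Z (\<lambda>u. gap n Z p Q u - F u)"
  proof (rule lipschitz_onI)
    fix u v
    show "dist (gap n Z p Q u - F u) (gap n Z p Q v - F v) \<le> K * dist u v"
      using le[of u v] le[of v u] by (simp add: dist_norm norm_minus_commute abs_le_iff)
  qed (rule K0)
  then have "continuous_on Z (\<lambda>u. gap n Z p Q u - F u)" by (rule lipschitz_on_continuous_on)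
  moreover have "continuous_on Z F" unfolding F_def by (intro continuous_intros p)
  ultimately have "continuous_on Z (\<lambda>u. (gap n Z p Q u - F u) + F u)" by (rule continuous_on_add)
  then show ?thesis by simp
qed


section \<open>Moments of the oracle errors\<close>

lemma integrable_mult_square:
  fixes f h :: "'w \<Rightarrow> real"
  assumes "f \<in> borel_measurable M" "h \<in> borel_measurable M"
    and "integrable M (\<lambda>x. (f x)\<^sup>2)" "integrable M (\<lambda>x. (h x)\<^sup>2)"
  shows "integrable M (\<lambda>x. f x * h x)"
proof (rule Bochner_Integration.integrable_bound)
  show "integrable M (\<lambda>x. (f x)\<^sup>2 + (h x)\<^sup>2)" using assms by simp
  have "norm (f x * h x) \<le> norm ((f x)\<^sup>2 + (h x)\<^sup>2)" for x
  proof -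
    have "0 \<le> (\<bar>f x\<bar> - \<bar>h x\<bar>)\<^sup>2" by simp
    then have "2 * (\<bar>f x\<bar> * \<bar>h x\<bar>) \<le> (f x)\<^sup>2 + (h x)\<^sup>2" by (simp add: power2_diff)
    moreover have "0 \<le> \<bar>f x\<bar> * \<bar>h x\<bar>" by simp
    ultimately have "\<bar>f x\<bar> * \<bar>h x\<bar> \<le> (f x)\<^sup>2 + (h x)\<^sup>2" by linarith
    then show ?thesis by (simp add: abs_mult)
  qed
  then show "AE x in M. norm (f x * h x) \<le> norm ((f x)\<^sup>2 + (h x)\<^sup>2)" by simp
qed (use assms in measurable)

lemma (in prob_space) expectation_le_sqrt:
  fixes X :: "'a \<Rightarrow> real"
  assumes "X \<in> borel_measurable M" "integrable M (\<lambda>x. (X x)\<^sup>2)"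
  shows "integrable M X" and "expectation X \<le> sqrt (expectation (\<lambda>x. (X x)\<^sup>2))"
proof -
  show X: "integrable M X" by (rule square_integrable_imp_integrable[OF assms])
  have "(expectation X)\<^sup>2 \<le> expectation (\<lambda>x. (X x)\<^sup>2)"
    using variance_eq[OF X assms(2)] variance_positive[of X] by simp
  then show "expectation X \<le> sqrt (expectation (\<lambda>x. (X x)\<^sup>2))" by (rule real_le_rsqrt)
qed

text \<open>
  Conditional centring against an observable weight; integrability is needed because conditional
  expectations of non-integrable functions carry no information.
\<close>
lemma (in prob_space) inner_centred_integral:
  fixes e X :: "'a \<Rightarrow> 'z::euclidean_space"
  assumes sub: "subalgebra M F"
    and e: "e \<in> borel_measurable M" "integrable M (\<lambda>\<omega>. (norm (e \<omega>))\<^sup>2)"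
    and X: "X \<in> borel_measurable F" "integrable M (\<lambda>\<omega>. (norm (X \<omega>))\<^sup>2)"
    and centred: "\<And>b. b \<in> Basis \<Longrightarrow> AE \<omega> in M. real_cond_exp M F (\<lambda>\<omega>. e \<omega> \<bullet> b) \<omega> = 0"
  shows "integrable M (\<lambda>\<omega>. e \<omega> \<bullet> X \<omega>)" and "expectation (\<lambda>\<omega>. e \<omega> \<bullet> X \<omega>) = 0"
proof -
  interpret F: finite_measure_subalgebra M F
    by (intro finite_measure_subalgebra.intro finite_measure_axioms finite_measure_subalgebra_axioms.intro sub)
  have XM: "X \<in> borel_measurable M" by (rule measurable_from_subalg[OF sub X(1)])
  have sq: "integrable M (\<lambda>\<omega>. (Y \<omega> \<bullet> b)\<^sup>2)"
    if Y: "Y \<in> borel_measurable M" "integrable M (\<lambda>\<omega>. (norm (Y \<omega>))\<^sup>2)" and b: "b \<in> Basis" for Y :: "'a \<Rightarrow> 'z" and b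
  proof (rule Bochner_Integration.integrable_bound[OF Y(2)])
    show "(\<lambda>\<omega>. (Y \<omega> \<bullet> b)\<^sup>2) \<in> borel_measurable M" using Y(1) by measurable
    have "\<bar>Y \<omega> \<bullet> b\<bar>\<^sup>2 \<le> (norm (Y \<omega>))\<^sup>2" for \<omega> using Basis_le_norm[OF b] by (intro power_mono) auto
    then show "AE \<omega> in M. norm ((Y \<omega> \<bullet> b)\<^sup>2) \<le> norm ((norm (Y \<omega>))\<^sup>2)" by simp
  qed
  have int: "integrable M (\<lambda>\<omega>. (X \<omega> \<bullet> b) * (e \<omega> \<bullet> b))" if b: "b \<in> Basis" for b
    using sq[OF XM X(2) b] sq[OF e b] XM e(1) by (intro integrable_mult_square) auto
  have zero: "expectation (\<lambda>\<omega>. (X \<omega> \<bullet> b) * (e \<omega> \<bullet> b)) = 0" if b: "b \<in> Basis" for b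
  proof -
    have "expectation (\<lambda>\<omega>. (X \<omega> \<bullet> b) * (e \<omega> \<bullet> b))
        = expectation (\<lambda>\<omega>. (X \<omega> \<bullet> b) * real_cond_exp M F (\<lambda>\<omega>. e \<omega> \<bullet> b) \<omega>)"
      by (intro F.real_cond_exp_intg(2)[symmetric] int[OF b] borel_measurable_inner X(1) e(1) borel_measurable_const)
    also have "\<dots> = expectation (\<lambda>\<omega>. 0)"
      using centred[OF b] XM measurable_from_subalg[OF sub borel_measurable_cond_exp]
      by (intro integral_cong_AE) (auto simp: borel_measurable_cond_exp2)
    finally show ?thesis by simp
  qed
  have eq: "e \<omega> \<bullet> X \<omega> = (\<Sum>b\<in>Basis. (X \<omega> \<bullet> b) * (e \<omega> \<bullet> b))" for \<omega>
    by (subst euclidean_inner) (simp add: mult.commute)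
  show "integrable M (\<lambda>\<omega>. e \<omega> \<bullet> X \<omega>)" unfolding eq by (intro Bochner_Integration.integrable_sum int)
  show "expectation (\<lambda>\<omega>. e \<omega> \<bullet> X \<omega>) = 0"
    unfolding eq by (subst Bochner_Integration.integral_sum) (simp_all add: int zero)
qed

lemma (in prob_space) second_moment_bound:
  fixes h :: "'a \<Rightarrow> real"
  assumes sub: "subalgebra M F" and h: "h \<in> borel_measurable M"
    and bound: "AE \<omega> in M. nn_cond_exp M F (\<lambda>\<omega>. ennreal ((h \<omega>)\<^sup>2)) \<omega> \<le> ennreal (s\<^sup>2)"
  shows "integrable M (\<lambda>\<omega>. (h \<omega>)\<^sup>2)" and "expectation (\<lambda>\<omega>. (h \<omega>)\<^sup>2) \<le> s\<^sup>2"
proof -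
  interpret F: finite_measure_subalgebra M F
    by (intro finite_measure_subalgebra.intro finite_measure_axioms finite_measure_subalgebra_axioms.intro sub)
  have "(\<integral>\<^sup>+ \<omega>. ennreal ((h \<omega>)\<^sup>2) \<partial>M) = (\<integral>\<^sup>+ \<omega>. 1 * nn_cond_exp M F (\<lambda>\<omega>. ennreal ((h \<omega>)\<^sup>2)) \<omega> \<partial>M)"
    using h by (subst F.nn_cond_exp_intg) auto
  also have "\<dots> \<le> (\<integral>\<^sup>+ \<omega>. ennreal (s\<^sup>2) \<partial>M)"
    using bound by (intro nn_integral_mono_AE) simp
  also have "\<dots> = ennreal (s\<^sup>2)" by (simp add: emeasure_space_1)
  finally have le: "(\<integral>\<^sup>+ \<omega>. ennreal ((h \<omega>)\<^sup>2) \<partial>M) \<le> ennreal (s\<^sup>2)" .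
  show int: "integrable M (\<lambda>\<omega>. (h \<omega>)\<^sup>2)"
    using h le by (intro integrableI_bounded) (auto intro: le_less_trans)
  have "ennreal (expectation (\<lambda>\<omega>. (h \<omega>)\<^sup>2)) = (\<integral>\<^sup>+ \<omega>. ennreal ((h \<omega>)\<^sup>2) \<partial>M)"
    by (rule nn_integral_eq_integral[symmetric, OF int]) simp
  then show "expectation (\<lambda>\<omega>. (h \<omega>)\<^sup>2) \<le> s\<^sup>2" using le by (metis ennreal_le_iff zero_le_power2)
qed

context sliding_oracle
begin

definition eps where "eps \<omega> t = g \<omega> t - gradp (length t) (w \<omega> t)"

lemma eps_noise: "\<omega> \<in> space Pr \<Longrightarrow> eps \<omega> t = sliding_trace.noise gradp (z \<omega>) (zb \<omega>) (g \<omega>) t"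
  by (simp add: eps_def w_def sliding_trace.noise_def[OF run_trace(1)])

lemma dual_pnorm_measurable: "h \<in> borel_measurable F \<Longrightarrow> (\<lambda>\<omega>. dual_pnorm P (h \<omega>)) \<in> borel_measurable F"
proof -
  have "dual_pnorm P \<in> borel_measurable borel"
    using continuous_on_pnorm[OF P linear_continuous_on[OF linear_conv_bounded_linear[THEN iffD1, OF sym_pos_def_inv(3)[OF P]]]]
    by (intro borel_measurable_continuous_onI) (simp add: dual_pnorm_eq[OF P, abs_def])
  then show "h \<in> borel_measurable F \<Longrightarrow> (\<lambda>\<omega>. dual_pnorm P (h \<omega>)) \<in> borel_measurable F"
    by (rule measurable_compose[rotated])
qed

lemma z_w_measurable:
  assumes t: "t \<in> level T i" "i \<le> n"
  shows "(\<lambda>\<omega>. z \<omega> t) \<in> borel_measurable (hist t)" and "(\<lambda>\<omega>. w \<omega> t) \<in> borel_measurable (hist t)"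
proof -
  show z: "(\<lambda>\<omega>. z \<omega> t) \<in> borel_measurable (hist t)"
    using iterates_measurable[of t] t by (auto simp: z_indices_def)
  show "(\<lambda>\<omega>. w \<omega> t) \<in> borel_measurable (hist t)"
  proof (rule w_measurable[OF t z])
    fix t' l j assume "t' \<in> level T l" "l < n" "j < T (Suc l)"
    then show "(\<lambda>\<omega>. zb \<omega> (t' @ [j])) \<in> borel_measurable (hist (t' @ [j]))"
      using iterates_measurable[of "t' @ [j]"] by (auto simp: zb_indices_def)
  qed
qed

context
  fixes t i
  assumes t: "t \<in> level T i" and i: "i \<in> {1..n}"
begin

lemma eps_eq: "\<omega> \<in> space Pr \<Longrightarrow> eps \<omega> t = G i (w \<omega> t) (\<xi> t \<omega>) - gradp i (w \<omega> t)"
  using run_trace(3)[OF _ t i] length_extensions[OF t] by (simp add: eps_def)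

lemma eps_measurable_if:
  assumes F: "space F = space Pr" "(\<lambda>\<omega>. w \<omega> t) \<in> borel_measurable F" "\<xi> t \<in> measurable F S"
  shows "(\<lambda>\<omega>. eps \<omega> t) \<in> borel_measurable F"
proof -
  have wZ: "w \<omega> t \<in> Z" if "\<omega> \<in> space F" for \<omega> using in_Z(3)[of \<omega> t i] that F(1) t i by auto
  have "(\<lambda>\<omega>. G i (w \<omega> t) (\<xi> t \<omega>) - gradp i (w \<omega> t)) \<in> borel_measurable F"
    by (intro borel_measurable_diff oracle_answer_measurable[OF i F(2) _ F(3)]
        measurable_compose_on[OF continuous_gradp[OF i] F(2)] wZ)
  then show ?thesis by (rule measurable_cong[THEN iffD1, rotated]) (simp add: eps_eq F(1))
qed

lemma eps_measurable: "(\<lambda>\<omega>. eps \<omega> t) \<in> borel_measurable Pr"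
  using z_w_measurable(2)[OF t] i measurable_from_subalg[OF hist_subalgebra] \<xi>_measurable level_nodes[OF t i]
  by (intro eps_measurable_if) auto

lemma eps_measurable_later: "lex_less t u \<Longrightarrow> (\<lambda>\<omega>. eps \<omega> t) \<in> borel_measurable (hist u)"
  using z_w_measurable(2)[OF t] i hist_\<xi>[of t u] level_nodes[OF t i]
  by (intro eps_measurable_if) (auto intro: measurable_history_mono)

text \<open>
  The query point \<open>w\<^sub>t\<close> is determined by the history, so the oracle assumption applies to it.
\<close>
lemma oracle_at_node:
  shows "b \<in> Basis \<Longrightarrow> AE \<omega> in Pr. real_cond_exp Pr (hist t) (\<lambda>\<omega>. eps \<omega> t \<bullet> b) \<omega> = 0"
    and "AE \<omega> in Pr. nn_cond_exp Pr (hist t) (\<lambda>\<omega>. ennreal ((dual_pnorm P (eps \<omega> t))\<^sup>2)) \<omega> \<le> ennreal ((\<sigma> i)\<^sup>2)"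
proof -
  interpret F: finite_measure_subalgebra Pr "hist t"
    by (intro finite_measure_subalgebra.intro finite_measure_axioms finite_measure_subalgebra_axioms.intro hist_subalgebra)
  have uo: "unbiased_oracle Pr (hist t) (dual_pnorm P) (\<sigma> i) Z (gradp i) (G i) (\<xi> t)"
    using oracle_unbiased[OF i t] by (simp add: node_history_eq[OF level_nodes[OF t i]])
  have wm: "(\<lambda>\<omega>. w \<omega> t) \<in> borel_measurable (hist t)" using z_w_measurable(2)[OF t] i by simp
  have wZ: "\<forall>\<omega>\<in>space Pr. w \<omega> t \<in> Z" using in_Z(3)[OF _ t] i by simp
  note * = bspec[OF uo[unfolded unbiased_oracle_def] wm, THEN mp, OF wZ]
  have e: "(\<lambda>\<omega>. G i (w \<omega> t) (\<xi> t \<omega>) - gradp i (w \<omega> t)) \<in> borel_measurable Pr"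
    by (rule measurable_cong[THEN iffD1, OF _ eps_measurable]) (rule eps_eq)
  show "AE \<omega> in Pr. real_cond_exp Pr (hist t) (\<lambda>\<omega>. eps \<omega> t \<bullet> b) \<omega> = 0" if b: "b \<in> Basis"
  proof -
    have "AE \<omega> in Pr. real_cond_exp Pr (hist t) (\<lambda>\<omega>. eps \<omega> t \<bullet> b) \<omega>
        = real_cond_exp Pr (hist t) (\<lambda>\<omega>. (G i (w \<omega> t) (\<xi> t \<omega>) - gradp i (w \<omega> t)) \<bullet> b) \<omega>"
      by (rule F.real_cond_exp_cong) (use eps_measurable e eps_eq in auto)
    with bspec[OF conjunct1[OF *] b] show ?thesis by eventually_elim simp
  qed
  have "AE \<omega> in Pr. nn_cond_exp Pr (hist t) (\<lambda>\<omega>. ennreal ((dual_pnorm P (eps \<omega> t))\<^sup>2)) \<omega>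
      = nn_cond_exp Pr (hist t) (\<lambda>\<omega>. ennreal ((dual_pnorm P (G i (w \<omega> t) (\<xi> t \<omega>) - gradp i (w \<omega> t)))\<^sup>2)) \<omega>"
    by (rule F.nn_cond_exp_cong)
       (use dual_pnorm_measurable[OF eps_measurable] dual_pnorm_measurable[OF e] eps_eq in auto)
  with conjunct2[OF *] show "AE \<omega> in Pr. nn_cond_exp Pr (hist t) (\<lambda>\<omega>. ennreal ((dual_pnorm P (eps \<omega> t))\<^sup>2)) \<omega> \<le> ennreal ((\<sigma> i)\<^sup>2)"
    by eventually_elim simp
qed

end

lemma eps_second_moment:
  assumes t: "t \<in> level T i" and i: "i \<in> {1..n}"
  shows "integrable Pr (\<lambda>\<omega>. (dual_pnorm P (eps \<omega> t))\<^sup>2)"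
    and "expectation (\<lambda>\<omega>. (dual_pnorm P (eps \<omega> t))\<^sup>2) \<le> (\<sigma> i)\<^sup>2"
    and "integrable Pr (\<lambda>\<omega>. (norm (eps \<omega> t))\<^sup>2)"
proof -
  note sm = second_moment_bound[OF hist_subalgebra dual_pnorm_measurable[OF eps_measurable[OF t i]] oracle_at_node(2)[OF t i]]
  show int: "integrable Pr (\<lambda>\<omega>. (dual_pnorm P (eps \<omega> t))\<^sup>2)"
    and "expectation (\<lambda>\<omega>. (dual_pnorm P (eps \<omega> t))\<^sup>2) \<le> (\<sigma> i)\<^sup>2" by (rule sm)+
  obtain c where c: "0 < c" "\<And>u. norm u \<le> c * dual_pnorm P u" using pnorm_norm_equiv[OF P] by metis
  show "integrable Pr (\<lambda>\<omega>. (norm (eps \<omega> t))\<^sup>2)"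
  proof (rule Bochner_Integration.integrable_bound)
    show "integrable Pr (\<lambda>\<omega>. c\<^sup>2 * (dual_pnorm P (eps \<omega> t))\<^sup>2)" using int by simp
    show "(\<lambda>\<omega>. (norm (eps \<omega> t))\<^sup>2) \<in> borel_measurable Pr" using eps_measurable[OF t i] by measurable
    have "(norm (eps \<omega> t))\<^sup>2 \<le> c\<^sup>2 * (dual_pnorm P (eps \<omega> t))\<^sup>2" for \<omega>
      using power_mono[OF c(2), of "eps \<omega> t" 2] by (simp add: power_mult_distrib)
    then show "AE \<omega> in Pr. norm ((norm (eps \<omega> t))\<^sup>2) \<le> norm (c\<^sup>2 * (dual_pnorm P (eps \<omega> t))\<^sup>2)" by simp
  qed
qed

lemma eps_uncorrelated:
  assumes t: "t \<in> level T i" and i: "i \<in> {1..n}"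
    and X: "X \<in> borel_measurable (hist t)" "integrable Pr (\<lambda>\<omega>. (norm (X \<omega>))\<^sup>2)"
  shows "integrable Pr (\<lambda>\<omega>. eps \<omega> t \<bullet> X \<omega>)" and "expectation (\<lambda>\<omega>. eps \<omega> t \<bullet> X \<omega>) = 0"
  using inner_centred_integral[OF hist_subalgebra eps_measurable[OF t i] eps_second_moment(3)[OF t i] X
      oracle_at_node(1)[OF t i]] by blast+

text \<open>Errors at different nodes of a level are uncorrelated, because one of the two is earlier.\<close>
lemma weighted_noise_second_moment:
  assumes i: "i \<in> {1..n}"
  defines "N \<equiv> \<lambda>\<omega>. \<Sum>t\<in>level T i. weight t *\<^sub>R eps \<omega> t"
  shows "N \<in> borel_measurable Pr"
    and "integrable Pr (\<lambda>\<omega>. (dual_pnorm P (N \<omega>))\<^sup>2)"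
    and "expectation (\<lambda>\<omega>. (dual_pnorm P (N \<omega>))\<^sup>2) \<le> (\<sigma> i)\<^sup>2 * (\<Sum>t\<in>level T i. (weight t)\<^sup>2)"
proof -
  show "N \<in> borel_measurable Pr"
    unfolding N_def using eps_measurable[OF _ i] by (intro borel_measurable_sum borel_measurable_scaleR) auto
  have lin: "linear (inv P)" by (rule sym_pos_def_inv(3)[OF P])
  have sym: "a \<bullet> inv P b = b \<bullet> inv P a" for a b
    using sym_pos_def_sym[OF P, of "inv P a" "inv P b"] by (simp add: sym_pos_def_inv[OF P] inner_commute)
  obtain K where K: "0 < K" "\<And>u. norm (inv P u) \<le> norm u * K"
    using bounded_linear.pos_bounded[OF linear_conv_bounded_linear[THEN iffD1, OF lin]] by auto
  have early: "integrable Pr (\<lambda>\<omega>. eps \<omega> t \<bullet> inv P (eps \<omega> s)) \<and> expectation (\<lambda>\<omega>. eps \<omega> t \<bullet> inv P (eps \<omega> s)) = 0"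
    if "s \<in> level T i" "t \<in> level T i" "lex_less s t" for s t
  proof -
    have inv_meas: "inv P \<in> borel_measurable borel"
      using linear_continuous_on[OF linear_conv_bounded_linear[THEN iffD1, OF lin]]
      by (rule borel_measurable_continuous_onI)
    have X: "(\<lambda>\<omega>. inv P (eps \<omega> s)) \<in> borel_measurable (hist t)"
      by (rule measurable_compose[OF eps_measurable_later[OF that(1) i that(3)] inv_meas])
    have "integrable Pr (\<lambda>\<omega>. (norm (inv P (eps \<omega> s)))\<^sup>2)"
    proof (rule Bochner_Integration.integrable_bound)
      show "integrable Pr (\<lambda>\<omega>. (norm (eps \<omega> s))\<^sup>2 * K\<^sup>2)" using eps_second_moment(3)[OF that(1) i] by simp
      have "(norm (inv P (eps \<omega> s)))\<^sup>2 \<le> (norm (eps \<omega> s))\<^sup>2 * K\<^sup>2" for \<omega>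
        using power_mono[OF K(2), of "eps \<omega> s" 2] by (simp add: power_mult_distrib)
      then show "AE \<omega> in Pr. norm ((norm (inv P (eps \<omega> s)))\<^sup>2) \<le> norm ((norm (eps \<omega> s))\<^sup>2 * K\<^sup>2)" by simp
      show "(\<lambda>\<omega>. (norm (inv P (eps \<omega> s)))\<^sup>2) \<in> borel_measurable Pr"
        using measurable_compose[OF eps_measurable[OF that(1) i] inv_meas] by measurable
    qed
    then show ?thesis using eps_uncorrelated[OF that(2) i X] by blast
  qed
  have cross: "integrable Pr (\<lambda>\<omega>. eps \<omega> t \<bullet> inv P (eps \<omega> s)) \<and> expectation (\<lambda>\<omega>. eps \<omega> t \<bullet> inv P (eps \<omega> s)) = 0"
    if "s \<in> level T i" "t \<in> level T i" "s \<noteq> t" for s t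
  proof (cases "lex_less s t")
    case False
    then have "lex_less t s" using lexordp_linear[of s t] that by blast
    from early[OF that(2,1) this] show ?thesis by (simp add: sym)
  qed (use early that in blast)
  have expand: "(dual_pnorm P (N \<omega>))\<^sup>2
      = (\<Sum>t\<in>level T i. \<Sum>s\<in>level T i. weight t * weight s * (eps \<omega> t \<bullet> inv P (eps \<omega> s)))" for \<omega>
  proof -
    have "(dual_pnorm P (N \<omega>))\<^sup>2 = (\<Sum>s\<in>level T i. \<Sum>t\<in>level T i. weight t * weight s * (eps \<omega> t \<bullet> inv P (eps \<omega> s)))"
      unfolding dual_pnorm_sq[OF P] N_def
      by (simp add: linear_sum[OF lin] linear_scale[OF lin] inner_sum_left inner_sum_right sum_distrib_left mult_ac)
    then show ?thesis by (subst (asm) sum.swap)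
  qed
  have diag: "(\<lambda>\<omega>. eps \<omega> t \<bullet> inv P (eps \<omega> t)) = (\<lambda>\<omega>. (dual_pnorm P (eps \<omega> t))\<^sup>2)" for t
    by (simp add: dual_pnorm_sq[OF P])
  have int: "integrable Pr (\<lambda>\<omega>. eps \<omega> t \<bullet> inv P (eps \<omega> s))" if "t \<in> level T i" "s \<in> level T i" for t s
    using cross[of s t] eps_second_moment(1)[of t, OF _ i] that by (cases "s = t") (auto simp: diag)
  show "integrable Pr (\<lambda>\<omega>. (dual_pnorm P (N \<omega>))\<^sup>2)"
    unfolding expand by (intro Bochner_Integration.integrable_sum integrable_mult_right int)
  have "expectation (\<lambda>\<omega>. (dual_pnorm P (N \<omega>))\<^sup>2)
      = (\<Sum>t\<in>level T i. \<Sum>s\<in>level T i. weight t * weight s * expectation (\<lambda>\<omega>. eps \<omega> t \<bullet> inv P (eps \<omega> s)))"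
    unfolding expand by (simp add: Bochner_Integration.integral_sum Bochner_Integration.integrable_sum int)
  also have "\<dots> = (\<Sum>t\<in>level T i. \<Sum>s\<in>level T i. if s = t then (weight t)\<^sup>2 * expectation (\<lambda>\<omega>. (dual_pnorm P (eps \<omega> t))\<^sup>2) else 0)"
    using cross by (intro sum.cong refl) (auto simp: diag power2_eq_square)
  also have "\<dots> = (\<Sum>t\<in>level T i. (weight t)\<^sup>2 * expectation (\<lambda>\<omega>. (dual_pnorm P (eps \<omega> t))\<^sup>2))"
    by (simp add: sum.delta)
  also have "\<dots> \<le> (\<Sum>t\<in>level T i. (weight t)\<^sup>2 * (\<sigma> i)\<^sup>2)"
    using eps_second_moment(2)[OF _ i] by (intro sum_mono mult_left_mono) auto
  finally show "expectation (\<lambda>\<omega>. (dual_pnorm P (N \<omega>))\<^sup>2) \<le> (\<sigma> i)\<^sup>2 * (\<Sum>t\<in>level T i. (weight t)\<^sup>2)"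
    by (simp add: sum_distrib_left mult.commute)
qed

end


section \<open>The expected gap\<close>

context sliding_problem
begin

lemma level_budget_pos: "i \<le> n \<Longrightarrow> 0 < level_budget T i"
  unfolding level_budget_def using T_pos by (intro prod_pos) auto

lemma rate_le:
  assumes "i \<le> n"
  shows "rate i \<le> 2 ^ i / real (level_budget T i)" and "1 / rate i \<le> real (level_budget T i)"
proof -
  have T: "theta (T k - 1) \<le> real (T k)" "real (T k) / 2 \<le> theta (T k - 1)" "0 < T k" if "k \<in> {1..i}" for k
    using theta_le[of "T k - 1"] theta_ge[of "T k - 1"] T_pos[of k] that assms by (auto simp: of_nat_diff)
  have "rate i \<le> (\<Prod>k=1..i. 2 / real (T k))"
    unfolding rate_def
  proof (intro prod_mono conjI)
    fix k assume k: "k \<in> {1..i}"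
    show "1 / theta (T k - 1) \<le> 2 / real (T k)"
      using T[OF k] by (simp add: field_simps)
  qed simp
  also have "\<dots> = 2 ^ i / real (level_budget T i)"
    by (simp add: prod_dividef level_budget_def)
  finally show "rate i \<le> 2 ^ i / real (level_budget T i)" .
  have "1 / rate i = (\<Prod>k=1..i. theta (T k - 1))" by (simp add: rate_def prod_dividef)
  also have "\<dots> \<le> (\<Prod>k=1..i. real (T k))" using T by (intro prod_mono) auto
  finally show "1 / rate i \<le> real (level_budget T i)" by (simp add: level_budget_def)
qed

text \<open>
  In each loop \<open>\<Sum> \<theta>\<^sub>j\<^sup>2 \<le> \<theta>\<^sub>T\<^sub>-\<^sub>1 \<Sum> \<theta>\<^sub>j = \<theta>\<^sub>T\<^sub>-\<^sub>1\<^sup>3\<close>.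
\<close>
lemma sum_weight_sq:
  assumes "i \<le> n"
  shows "(\<Sum>t\<in>level T i. (weight t)\<^sup>2) \<le> rate i"
proof -
  have "(\<Sum>t\<in>level T i. (weight t)\<^sup>2) = (\<Prod>k=1..i. \<Sum>j<T k. (theta j / (theta (T k - 1))\<^sup>2)\<^sup>2)"
    unfolding weight_def path_prod_power by (rule sum_path_prod)
  also have "\<dots> \<le> rate i"
    unfolding rate_def
  proof (intro prod_mono conjI)
    fix k assume "k \<in> {1..i}"
    then have T: "0 < T k" using T_pos[of k] assms by simp
    define h where "h = theta (T k - 1)"
    have h: "0 < h" by (simp add: h_def)
    have "(\<Sum>j<T k. (theta j / h\<^sup>2)\<^sup>2) \<le> (\<Sum>j<T k. h * theta j / h ^ 4)"
    proof (intro sum_mono)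
      fix j assume "j \<in> {..<T k}"
      then have "theta j \<le> h" unfolding h_def by (intro theta_mono) auto
      then have "theta j * theta j \<le> h * theta j" by (intro mult_right_mono) auto
      then have "theta j * theta j / h ^ 4 \<le> h * theta j / h ^ 4" using h by (intro divide_right_mono) auto
      moreover have "(theta j / h\<^sup>2)\<^sup>2 = theta j * theta j / h ^ 4"
        by (simp add: power_divide power2_eq_square power4_eq_xxxx)
      ultimately show "(theta j / h\<^sup>2)\<^sup>2 \<le> h * theta j / h ^ 4" by simp
    qed
    also have "\<dots> = h * (\<Sum>j<T k. theta j) / h ^ 4" by (simp add: sum_distrib_left sum_divide_distrib)
    also have "\<dots> = 1 / h" using sum_theta[OF T, folded h_def] h by (simp add: field_simps power2_eq_square power4_eq_xxxx)
    finally show "(\<Sum>j<T k. (theta j / (theta (T k - 1))\<^sup>2)\<^sup>2) \<le> 1 / theta (T k - 1)" by (simp add: h_def)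
  qed (auto intro: sum_nonneg)
  finally show ?thesis .
qed

end

context sliding_oracle
begin

lemma continuous_p: "i \<in> {1..n} \<Longrightarrow> continuous_on Z (p i)"
proof -
  assume "i \<in> {1..n}"
  then have "(p i has_derivative (\<lambda>h. gradp i v \<bullet> h)) (at v within Z)" if "v \<in> Z" for v
    using p_smooth that by (auto simp: convex_smooth_def)
  then show ?thesis by (intro has_derivative_continuous_on) auto
qed

lemma gap_integrable: "integrable Pr (\<lambda>\<omega>. gap n Z p Q (zout \<omega>))"
proof -
  have root: "[] \<in> level T 0" by simp
  have idx: "[T 1] \<in> zb_indices"
    unfolding zb_indices_def using n_pos by (auto intro!: exI[of _ "[]"] exI[of _ "T 1"] exI[of _ 0])
  have "(\<lambda>\<omega>. zb \<omega> [T 1]) \<in> borel_measurable (hist [T 1])" using iterates_measurable[of "[T 1]"] idx by simp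
  then have "(\<lambda>\<omega>. zb \<omega> [T 1]) \<in> borel_measurable Pr" by (rule measurable_from_subalg[OF hist_subalgebra])
  then have zout: "zout \<in> borel_measurable Pr"
    by (rule measurable_cong[THEN iffD1, rotated])
       (use run_trace(2) sliding_trace.r_inner[OF run_trace(1) root] n_pos in simp)
  have zoutZ: "zout \<omega> \<in> Z" if "\<omega> \<in> space Pr" for \<omega>
    using run_trace(2)[OF that] in_Z(2)[OF that root] by simp
  have cont: "continuous_on Z (gap n Z p Q)"
    by (rule gap_continuous_on[OF Z(1,3) continuous_p continuous_Q])
  obtain K where K: "\<And>u. u \<in> Z \<Longrightarrow> norm (gap n Z p Q u) \<le> K"
    using compact_imp_bounded[OF compact_continuous_image[OF cont Z(1)]] unfolding bounded_iff by auto
  show ?thesis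
    using K zoutZ by (intro integrable_const_bound[of _ K] measurable_compose_on[OF cont zout]) auto
qed

lemma noise_tau_eq_0:
  assumes "i \<in> {1..n}"
  shows "noise_tau T \<sigma> \<Omega> i = 0 \<longleftrightarrow> \<sigma> i = 0"
  using level_budget_pos[of i] assms \<Omega>_pos by (auto simp: noise_tau_def)

lemma AE_no_noise:
  "AE \<omega> in Pr. \<forall>i\<in>{1..n}. \<forall>t\<in>level T i. noise_tau T \<sigma> \<Omega> i = 0 \<longrightarrow> eps \<omega> t = 0"
proof (intro AE_finite_allI)
  fix i t assume i: "i \<in> {1..n}" and t: "t \<in> level T i"
  show "AE \<omega> in Pr. noise_tau T \<sigma> \<Omega> i = 0 \<longrightarrow> eps \<omega> t = 0"
  proof (cases "\<sigma> i = 0")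
    case True
    note m = eps_second_moment[OF t i]
    have "expectation (\<lambda>\<omega>. (dual_pnorm P (eps \<omega> t))\<^sup>2) = 0"
      using m(2) True by (intro antisym Bochner_Integration.integral_nonneg) auto
    then have "AE \<omega> in Pr. (dual_pnorm P (eps \<omega> t))\<^sup>2 = 0"
      using integral_nonneg_eq_0_iff_AE[OF m(1)] by simp
    moreover obtain c where c: "\<And>u. norm u \<le> c * dual_pnorm P u" using pnorm_norm_equiv[OF P] by metis
    have "eps \<omega> t = 0" if "(dual_pnorm P (eps \<omega> t))\<^sup>2 = 0" for \<omega>
      using c[of "eps \<omega> t"] that by simp
    ultimately show ?thesis by (auto elim: eventually_mono)
  qed (simp add: noise_tau_eq_0[OF i])
qed auto

text \<open>
  The competitor may depend on the noise. Its correlation with the noise is split off by the fixed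
  reference point \<open>z\<^sub>i\<^sub>n\<close>: the first noise term is bounded by the norm of one vector uniformly over
  the competitor, the second one is centred.
\<close>
definition noise_bound where
  "noise_bound i \<omega> = sqrt \<Omega> * dual_pnorm P (\<Sum>t\<in>level T i. weight t *\<^sub>R eps \<omega> t)
     + (\<Sum>t\<in>level T i. weight t * (eps \<omega> t \<bullet> (zin \<omega> - z \<omega> t))
         + (weight t)\<^sup>2 / (2 * (rate i)\<^sup>2 * noise_tau T \<sigma> \<Omega> i) * (dual_pnorm P (eps \<omega> t))\<^sup>2)"

lemma gap_le_noise_bound:
  "AE \<omega> in Pr. gap n Z p Q (zout \<omega>) \<le> (\<Sum>i=1..n. modulus i / 2 * \<Omega> + noise_bound i \<omega>)"
  using \<Omega>_bound AE_no_noise AE_space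
proof eventually_elim
  case (elim \<omega>)
  note tr = run_trace(1)[OF elim(3)]
  have "continuous_on Z (\<lambda>u. (pnorm P (zin \<omega> - u))\<^sup>2)" using P by (intro continuous_intros)
  then have bdd: "bdd_above ((\<lambda>u. (pnorm P (zin \<omega> - u))\<^sup>2) ` Z)"
    using Z(1) by (intro bounded_imp_bdd_above compact_imp_bounded compact_continuous_image)
  have dist: "(pnorm P (u - zin \<omega>))\<^sup>2 \<le> \<Omega>" if "u \<in> Z" for u
    using cSUP_upper[OF that bdd] elim(1) by (simp add: pnorm_minus_commute[OF P, of u])
  have "(\<Sum>i=1..n. p i (zout \<omega>)) - (\<Sum>i=1..n. p i u) + (\<Sum>i=1..n. Q i u) \<bullet> (zout \<omega> - u)
      \<le> (\<Sum>i=1..n. modulus i / 2 * \<Omega> + noise_bound i \<omega>)" if u: "u \<in> Z" for u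
  proof -
    have "(\<Sum>i=1..n. p i (zout \<omega>)) - (\<Sum>i=1..n. p i u) + (\<Sum>i=1..n. Q i u) \<bullet> (zout \<omega> - u)
      \<le> (\<Sum>i=1..n. modulus i / 2 * (pnorm P (u - zin \<omega>))\<^sup>2)
      + (\<Sum>i=1..n. \<Sum>t\<in>level T i. weight t * (eps \<omega> t \<bullet> (u - z \<omega> t))
          + (weight t)\<^sup>2 / (2 * (rate i)\<^sup>2 * noise_tau T \<sigma> \<Omega> i) * (dual_pnorm P (eps \<omega> t))\<^sup>2)"
      using sliding_trace.gap_term_bound[OF tr u] elim(2)
      unfolding run_trace(2)[OF elim(3)] eps_noise[OF elim(3), symmetric] by blast
    also have "\<dots> = (\<Sum>i=1..n. modulus i / 2 * (pnorm P (u - zin \<omega>))\<^sup>2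
      + (\<Sum>t\<in>level T i. weight t * (eps \<omega> t \<bullet> (u - z \<omega> t))
          + (weight t)\<^sup>2 / (2 * (rate i)\<^sup>2 * noise_tau T \<sigma> \<Omega> i) * (dual_pnorm P (eps \<omega> t))\<^sup>2))"
      by (simp only: sum.distrib)
    also have "\<dots> \<le> (\<Sum>i=1..n. modulus i / 2 * \<Omega> + noise_bound i \<omega>)"
    proof (intro sum_mono add_mono)
      fix i assume i: "i \<in> {1..n}"
      show "modulus i / 2 * (pnorm P (u - zin \<omega>))\<^sup>2 \<le> modulus i / 2 * \<Omega>"
        using modulus_pos[OF i] dist[OF u] by (intro mult_left_mono) auto
      define N where "N = (\<Sum>t\<in>level T i. weight t *\<^sub>R eps \<omega> t)"
      have "N \<bullet> (u - zin \<omega>) \<le> dual_pnorm P N * pnorm P (u - zin \<omega>)"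
        by (rule pnorm_dual_Cauchy_Schwarz[OF P])
      also have "\<dots> \<le> dual_pnorm P N * sqrt \<Omega>"
        using P real_le_rsqrt[OF dist[OF u]] by (intro mult_left_mono) auto
      finally have "N \<bullet> (u - zin \<omega>) \<le> sqrt \<Omega> * dual_pnorm P N" by (simp add: mult.commute)
      moreover have "(\<Sum>t\<in>level T i. weight t * (eps \<omega> t \<bullet> (u - z \<omega> t)))
          = N \<bullet> (u - zin \<omega>) + (\<Sum>t\<in>level T i. weight t * (eps \<omega> t \<bullet> (zin \<omega> - z \<omega> t)))"
        unfolding N_def
        by (simp add: inner_sum_left inner_diff_right right_diff_distrib sum_subtractf)
      ultimately show "(\<Sum>t\<in>level T i. weight t * (eps \<omega> t \<bullet> (u - z \<omega> t))
          + (weight t)\<^sup>2 / (2 * (rate i)\<^sup>2 * noise_tau T \<sigma> \<Omega> i) * (dual_pnorm P (eps \<omega> t))\<^sup>2) \<le> noise_bound i \<omega>"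
        unfolding noise_bound_def N_def[symmetric] by (simp add: sum.distrib)
    qed
    finally show ?thesis .
  qed
  then show ?case unfolding gap_def by (intro cSUP_least Z(3))
qed

text \<open>
  The vector in the first term is controlled through its second moment, the centred terms vanish,
  and the squared errors are summed with \<open>sum_weight_sq\<close>.
\<close>
lemma noise_bound_expectation:
  assumes i: "i \<in> {1..n}"
  shows "integrable Pr (noise_bound i)"
    and "expectation (noise_bound i) \<le> sqrt \<Omega> * (\<sigma> i * sqrt (rate i))
      + (\<sigma> i)\<^sup>2 / (2 * rate i * noise_tau T \<sigma> \<Omega> i)"
proof -
  define N where "N \<omega> = (\<Sum>t\<in>level T i. weight t *\<^sub>R eps \<omega> t)" for \<omega>
  define k where "k = 1 / (2 * (rate i)\<^sup>2 * noise_tau T \<sigma> \<Omega> i)"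
  have tau0: "0 \<le> noise_tau T \<sigma> \<Omega> i" by (rule \<tau>_nonneg[OF i])
  have k: "0 \<le> k" using tau0 by (simp add: k_def)
  note Nm = weighted_noise_second_moment[OF i, folded N_def]
  note Ne = expectation_le_sqrt[OF dual_pnorm_measurable[OF Nm(1)] Nm(2)]
  have i_le: "i \<le> n" using i by simp
  have "expectation (\<lambda>\<omega>. (dual_pnorm P (N \<omega>))\<^sup>2) \<le> (\<sigma> i)\<^sup>2 * rate i"
    using Nm(3) mult_left_mono[OF sum_weight_sq[OF i_le], of "(\<sigma> i)\<^sup>2"] by simp
  then have "sqrt (expectation (\<lambda>\<omega>. (dual_pnorm P (N \<omega>))\<^sup>2)) \<le> sqrt ((\<sigma> i)\<^sup>2 * rate i)"
    by (rule real_sqrt_le_mono)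
  then have EN: "expectation (\<lambda>\<omega>. dual_pnorm P (N \<omega>)) \<le> \<sigma> i * sqrt (rate i)"
    using Ne(2) \<sigma>_nonneg[OF i] by (simp add: real_sqrt_mult)
  have cross: "integrable Pr (\<lambda>\<omega>. eps \<omega> t \<bullet> (zin \<omega> - z \<omega> t))" "expectation (\<lambda>\<omega>. eps \<omega> t \<bullet> (zin \<omega> - z \<omega> t)) = 0"
    if t: "t \<in> level T i" for t
  proof -
    have X: "(\<lambda>\<omega>. zin \<omega> - z \<omega> t) \<in> borel_measurable (hist t)"
      by (intro borel_measurable_diff zin_measurable_history z_w_measurable(1)[OF t i_le])
    obtain B where B: "\<And>x. x \<in> Z \<Longrightarrow> norm x \<le> B" using compact_imp_bounded[OF Z(1)] by (auto simp: bounded_iff)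
    have "norm (zin \<omega> - z \<omega> t) \<le> B + B" if "\<omega> \<in> space Pr" for \<omega>
      using norm_triangle_ineq4[of "zin \<omega>" "z \<omega> t"] B[OF zin_in_Z[OF that]] B[OF in_Z(1)[OF that t i_le]] by linarith
    then have "AE \<omega> in Pr. norm ((norm (zin \<omega> - z \<omega> t))\<^sup>2) \<le> (B + B)\<^sup>2"
      by (intro AE_I2) (metis norm_ge_zero norm_power power_mono real_norm_def abs_norm_cancel)
    then have "integrable Pr (\<lambda>\<omega>. (norm (zin \<omega> - z \<omega> t))\<^sup>2)"
      by (rule integrable_const_bound)
         (intro borel_measurable_power measurable_compose[OF measurable_from_subalg[OF hist_subalgebra X] borel_measurable_norm])
    then show "integrable Pr (\<lambda>\<omega>. eps \<omega> t \<bullet> (zin \<omega> - z \<omega> t))" "expectation (\<lambda>\<omega>. eps \<omega> t \<bullet> (zin \<omega> - z \<omega> t)) = 0"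
      by (rule eps_uncorrelated[OF t i X])+
  qed
  have nb: "noise_bound i = (\<lambda>\<omega>. sqrt \<Omega> * dual_pnorm P (N \<omega>)
     + (\<Sum>t\<in>level T i. weight t * (eps \<omega> t \<bullet> (zin \<omega> - z \<omega> t)) + (weight t)\<^sup>2 * k * (dual_pnorm P (eps \<omega> t))\<^sup>2))"
    by (rule ext) (simp add: noise_bound_def N_def k_def)
  show "integrable Pr (noise_bound i)"
    unfolding nb using Ne(1) cross(1) eps_second_moment(1)[OF _ i]
    by (intro Bochner_Integration.integrable_add Bochner_Integration.integrable_sum integrable_mult_right) auto
  have "expectation (noise_bound i) = sqrt \<Omega> * expectation (\<lambda>\<omega>. dual_pnorm P (N \<omega>))
     + (\<Sum>t\<in>level T i. (weight t)\<^sup>2 * k * expectation (\<lambda>\<omega>. (dual_pnorm P (eps \<omega> t))\<^sup>2))"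
    unfolding nb using Ne(1) cross eps_second_moment(1)[OF _ i]
    by (simp add: Bochner_Integration.integral_add Bochner_Integration.integral_sum)
  also have "\<dots> \<le> sqrt \<Omega> * (\<sigma> i * sqrt (rate i)) + (\<Sum>t\<in>level T i. (weight t)\<^sup>2 * k * (\<sigma> i)\<^sup>2)"
    using EN k \<Omega>_pos eps_second_moment(2)[OF _ i]
    by (intro add_mono mult_left_mono sum_mono) auto
  also have "(\<Sum>t\<in>level T i. (weight t)\<^sup>2 * k * (\<sigma> i)\<^sup>2) = (\<Sum>t\<in>level T i. (weight t)\<^sup>2) * (k * (\<sigma> i)\<^sup>2)"
    by (simp add: sum_distrib_right mult.assoc)
  also have "\<dots> \<le> rate i * (k * (\<sigma> i)\<^sup>2)"
    using k by (intro mult_right_mono sum_weight_sq[OF i_le]) auto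
  also have "\<dots> = (\<sigma> i)\<^sup>2 / (2 * rate i * noise_tau T \<sigma> \<Omega> i)"
    using rate_pos[of i] by (simp add: k_def power2_eq_square)
  finally show "expectation (noise_bound i) \<le> sqrt \<Omega> * (\<sigma> i * sqrt (rate i))
      + (\<sigma> i)\<^sup>2 / (2 * rate i * noise_tau T \<sigma> \<Omega> i)" by simp
qed

text \<open>
  The value of \<open>\<tau>\<^sub>i\<close> balances its contribution to the modulus against the noise that it absorbs: both
  are at most \<open>2\<^sup>i\<^sup>-\<^sup>1 \<sigma>\<^sub>i \<surd>\<Omega> / \<surd>A\<^sub>i\<close>.
\<close>
lemma level_error_bound:
  assumes i: "i \<in> {1..n}"
  defines "A \<equiv> real (level_budget T i)"
  shows "modulus i / 2 * \<Omega> + (sqrt \<Omega> * (\<sigma> i * sqrt (rate i)) + (\<sigma> i)\<^sup>2 / (2 * rate i * noise_tau T \<sigma> \<Omega> i))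
    \<le> 2 ^ (2 * i - 1) * L i * \<Omega> / A\<^sup>2 + 2 ^ (i - 1) * M i * \<Omega> / A
      + (2 ^ i + 2 powr (real i / 2)) * \<sigma> i * sqrt \<Omega> / sqrt A"
proof -
  define \<tau> where "\<tau> = noise_tau T \<sigma> \<Omega> i"
  define s q where "s = sqrt A" and "q = sqrt \<Omega>"
  have i_le: "i \<le> n" using i by simp
  have A: "0 < A" using level_budget_pos[OF i_le] by (simp add: A_def)
  have so: "0 < s" "0 < q" "s * s = A" "q * q = \<Omega>" using A \<Omega>_pos by (simp_all add: s_def q_def)
  have \<sigma>: "0 \<le> \<sigma> i" by (rule \<sigma>_nonneg[OF i])
  have tau: "\<tau> = \<sigma> i * (s * s * s) / (2 ^ i * q)"
  proof -
    have "A powr (3 / 2) = A powr 1 * A powr (1 / 2)" using powr_add[of A 1 "1 / 2"] by simp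
    also have "\<dots> = s * s * s" using A so by (simp add: powr_half_sqrt s_def)
    finally have "A powr (3 / 2) = s * s * s" .
    moreover have "2 powr (- real i) = 1 / 2 ^ i" by (simp add: powr_minus_divide powr_realpow)
    moreover have "\<Omega> powr (- 1 / 2) = 1 / q"
      using \<Omega>_pos powr_minus_divide[of \<Omega> "1/2"] by (simp add: q_def powr_half_sqrt)
    ultimately show ?thesis by (simp add: \<tau>_def noise_tau_def A_def)
  qed
  have r: "0 < rate i" "rate i \<le> 2 ^ i / A" "1 / rate i \<le> A"
    using rate_pos rate_le[OF i_le] by (auto simp: A_def)
  have r2: "(rate i)\<^sup>2 \<le> 4 ^ i / A\<^sup>2"
    using power_mono[OF r(2), of 2] r(1) by (simp add: power_divide power_mult[symmetric] mult.commute[of i] power_mult)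
  have two: "(2::real) ^ (2 * i - 1) = 4 ^ i / 2" "(2::real) ^ (i - 1) = 2 ^ i / 2"
  proof -
    obtain j where j: "i = Suc j" using i by (cases i) auto
    show "(2::real) ^ (2 * i - 1) = 4 ^ i / 2" "(2::real) ^ (i - 1) = 2 ^ i / 2"
      unfolding j by (simp_all add: power_mult)
  qed
  have t1: "(rate i)\<^sup>2 * L i / 2 * \<Omega> \<le> 2 ^ (2 * i - 1) * L i * \<Omega> / A\<^sup>2"
    unfolding two using mult_right_mono[OF r2, of "L i / 2 * \<Omega>"] L_nonneg[OF i] \<Omega>_pos by (simp add: mult_ac)
  have t2: "rate i * M i / 2 * \<Omega> \<le> 2 ^ (i - 1) * M i * \<Omega> / A"
    unfolding two using mult_right_mono[OF r(2), of "M i / 2 * \<Omega>"] M_nonneg[OF i] \<Omega>_pos by (simp add: mult_ac)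
  have t3: "(rate i)\<^sup>2 * \<tau> / 2 * \<Omega> \<le> 2 ^ i * \<sigma> i * q / (2 * s)"
  proof -
    have "(rate i)\<^sup>2 * (\<tau> / 2 * \<Omega>) \<le> 4 ^ i / A\<^sup>2 * (\<tau> / 2 * \<Omega>)"
      using \<tau>_nonneg[OF i] \<Omega>_pos by (intro mult_right_mono[OF r2]) (simp add: \<tau>_def)
    also have "\<dots> = 2 ^ i * \<sigma> i * q / (2 * s)"
    proof -
      have "(4::real) ^ i = 2 ^ i * 2 ^ i" by (simp flip: power_mult_distrib)
      then show ?thesis using so(1,2) by (simp add: tau power2_eq_square flip: so(3,4))
    qed
    finally show ?thesis by (simp add: mult.assoc)
  qed
  have t4: "sqrt \<Omega> * (\<sigma> i * sqrt (rate i)) \<le> 2 powr (real i / 2) * \<sigma> i * q / s"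
  proof -
    have "sqrt (rate i) \<le> sqrt (2 ^ i / A)" using r(2) by (rule real_sqrt_le_mono)
    also have "sqrt (2 ^ i / A) = 2 powr (real i / 2) / s"
      by (simp add: s_def real_sqrt_divide powr_half_sqrt[symmetric] powr_powr flip: powr_realpow)
    finally have "q * (\<sigma> i * sqrt (rate i)) \<le> q * (\<sigma> i * (2 powr (real i / 2) / s))"
      using \<sigma> so by (intro mult_left_mono) auto
    then show ?thesis by (simp add: q_def mult_ac)
  qed
  have t5: "(\<sigma> i)\<^sup>2 / (2 * rate i * \<tau>) \<le> 2 ^ i * \<sigma> i * q / (2 * s)"
  proof (cases "\<sigma> i = 0")
    case False
    then have \<sigma>': "0 < \<sigma> i" using \<sigma> by simp
    have tpos: "0 < \<tau>" using \<sigma>' so(1,2) by (simp add: tau)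
    have "(\<sigma> i)\<^sup>2 / (2 * rate i * \<tau>) = (1 / rate i) * ((\<sigma> i)\<^sup>2 / (2 * \<tau>))" by simp
    also have "\<dots> \<le> A * ((\<sigma> i)\<^sup>2 / (2 * \<tau>))" using tpos by (intro mult_right_mono r(3)) auto
    also have "\<dots> = 2 ^ i * \<sigma> i * q / (2 * s)"
      using so(1,2) \<sigma>' by (simp add: tau power2_eq_square flip: so(3))
    finally show ?thesis .
  qed simp
  have "modulus i / 2 * \<Omega> = (rate i)\<^sup>2 * L i / 2 * \<Omega> + (rate i)\<^sup>2 * \<tau> / 2 * \<Omega> + rate i * M i / 2 * \<Omega>"
    by (simp add: modulus_def \<tau>_def algebra_simps add_divide_distrib)
  moreover have "(2 ^ i + 2 powr (real i / 2)) * \<sigma> i * sqrt \<Omega> / sqrt A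
      = 2 ^ i * \<sigma> i * q / (2 * s) + 2 ^ i * \<sigma> i * q / (2 * s) + 2 powr (real i / 2) * \<sigma> i * q / s"
    by (simp add: s_def q_def distrib_right add_divide_distrib)
  ultimately show ?thesis using t1 t2 t3 t4 t5 unfolding \<tau>_def by linarith
qed

lemma expected_gap:
  defines "A \<equiv> \<lambda>i. real (level_budget T i)"
  shows "expectation (\<lambda>\<omega>. gap n Z p Q (zout \<omega>))
    \<le> (\<Sum>i=1..n. 2 ^ (2 * i - 1) * L i * \<Omega> / (A i)\<^sup>2)
      + (\<Sum>i=1..n. 2 ^ (i - 1) * M i * \<Omega> / A i)
      + (\<Sum>i=1..n. (2 ^ i + 2 powr (real i / 2)) * \<sigma> i * sqrt \<Omega> / sqrt (A i))"
proof -
  have int: "integrable Pr (\<lambda>\<omega>. \<Sum>i=1..n. modulus i / 2 * \<Omega> + noise_bound i \<omega>)"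
    using noise_bound_expectation(1) by (intro Bochner_Integration.integrable_sum Bochner_Integration.integrable_add) auto
  have "expectation (\<lambda>\<omega>. gap n Z p Q (zout \<omega>)) \<le> expectation (\<lambda>\<omega>. \<Sum>i=1..n. modulus i / 2 * \<Omega> + noise_bound i \<omega>)"
    by (rule integral_mono_AE[OF gap_integrable int gap_le_noise_bound])
  also have "\<dots> = (\<Sum>i=1..n. modulus i / 2 * \<Omega> + expectation (noise_bound i))"
    using noise_bound_expectation(1) by (simp add: Bochner_Integration.integral_sum prob_space)
  also have "\<dots> \<le> (\<Sum>i=1..n. 2 ^ (2 * i - 1) * L i * \<Omega> / (A i)\<^sup>2 + 2 ^ (i - 1) * M i * \<Omega> / A i
      + (2 ^ i + 2 powr (real i / 2)) * \<sigma> i * sqrt \<Omega> / sqrt (A i))"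
    unfolding A_def
    by (intro sum_mono order.trans[OF add_left_mono[OF noise_bound_expectation(2)] level_error_bound])
  finally show ?thesis by (simp only: sum.distrib)
qed

end


section \<open>Budgets\<close>

lemma (in stochastic_sliding) sliding_oracle:
  "sliding_oracle Pr n T Z P p gradp Q L M \<sigma> \<Omega> S G \<xi> zin"
proof unfold_locales
  show "compact Z" using Z_closed Z_bounded by (simp add: compact_eq_bounded_closed)
  show "0 \<le> noise_tau T \<sigma> \<Omega> i" if "i \<in> {1..n}" for i
    using \<sigma>_nonneg[OF that] by (simp add: noise_tau_def)
  show "unbiased_oracle Pr (node_history n T Pr S zin \<xi> \<nu>) (dual_pnorm P) (\<sigma> i) Z (gradp i) (G i) (\<xi> \<nu>)"
    if "i \<in> {1..n}" "\<nu> \<in> level T i" for i \<nu>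
    using oracle_unbiased[OF that(1)] that nodes_eq_levels by blast
qed (use n_pos T_pos Z_nonempty Z_convex P_spd L_nonneg M_nonneg \<sigma>_nonneg Q_monotone Q_lipschitz p_smooth
    G_measurable \<xi>_measurable zin_measurable zin_in_Z \<Omega>_pos \<Omega>_bound moduli_pos in auto)

lemma budget_const_ge: "1 \<le> n \<Longrightarrow> 1 \<le> budget_const n"
proof -
  assume "1 \<le> n"
  then have "1 \<le> (real n)\<^sup>2" by simp
  moreover have "(1::real) \<le> 4 ^ n" by simp
  ultimately have "1 * 1 \<le> (real n)\<^sup>2 * 4 ^ n" by (intro mult_mono) auto
  then show ?thesis by (simp add: budget_const_def)
qed

text \<open>Each of the three error terms of a level is at most \<open>\<epsilon> / (3n)\<close>.\<close>
lemma error_bound_le_eps: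
  fixes A :: "nat \<Rightarrow> real"
  assumes n: "1 \<le> n" and nn: "\<And>i. i \<in> {1..n} \<Longrightarrow> 0 \<le> L i \<and> 0 \<le> M i \<and> 0 \<le> \<sigma> i"
    and \<Omega>: "0 < \<Omega>" and \<epsilon>: "0 < \<epsilon>"
    and A: "\<And>i. i \<in> {1..n} \<Longrightarrow> budget_const n * target_budget (L i) (M i) (\<sigma> i) \<Omega> \<epsilon> \<le> A i"
  shows "(\<Sum>i=1..n. 2 ^ (2 * i - 1) * L i * \<Omega> / (A i)\<^sup>2) + (\<Sum>i=1..n. 2 ^ (i - 1) * M i * \<Omega> / A i)
      + (\<Sum>i=1..n. (2 ^ i + 2 powr (real i / 2)) * \<sigma> i * sqrt \<Omega> / sqrt (A i)) \<le> \<epsilon>"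
proof -
  define c where "c = budget_const n"
  have c: "1 \<le> c" unfolding c_def by (rule budget_const_ge[OF n])
  have n0: "0 < real n" using n by simp
  have level: "2 ^ (2 * i - 1) * L i * \<Omega> / (A i)\<^sup>2 + 2 ^ (i - 1) * M i * \<Omega> / A i
      + (2 ^ i + 2 powr (real i / 2)) * \<sigma> i * sqrt \<Omega> / sqrt (A i) \<le> \<epsilon> / real n" if i: "i \<in> {1..n}" for i
  proof -
    have LMs: "0 \<le> L i" "0 \<le> M i" "0 \<le> \<sigma> i" using nn[OF i] by auto
    have pos: "0 \<le> sqrt (L i * \<Omega> / \<epsilon>)" "0 \<le> M i * \<Omega> / \<epsilon>" "0 \<le> (\<sigma> i)\<^sup>2 * \<Omega> / \<epsilon>\<^sup>2"
      using LMs \<Omega> \<epsilon> by auto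
    have Ai: "c * x \<le> A i" if "x \<le> target_budget (L i) (M i) (\<sigma> i) \<Omega> \<epsilon>" for x
      using order.trans[OF mult_left_mono[OF that, of c] A[OF i, folded c_def]] c by simp
    have A1: "c \<le> A i" using Ai[of 1] pos unfolding target_budget_def by linarith
    have A0: "0 < A i" using A1 c by linarith
    have pow: "(4::real) ^ i \<le> 4 ^ n" "(2::real) ^ i \<le> 2 ^ n" using i by (auto intro: power_increasing)
    have four: "(4::real) ^ k = 2 ^ k * 2 ^ k" for k by (simp flip: power_mult_distrib)
    have two: "(2::real) ^ (2 * i - 1) = 4 ^ i / 2" "(2::real) ^ (i - 1) = 2 ^ i / 2"
    proof -
      obtain j where j: "i = Suc j" using i by (cases i) auto
      show "(2::real) ^ (2 * i - 1) = 4 ^ i / 2" "(2::real) ^ (i - 1) = 2 ^ i / 2"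
        unfolding j by (simp_all add: power_mult)
    qed
    have cn: "3 * real n * 4 ^ n \<le> c"
    proof -
      have "3 * real n * 4 ^ n \<le> 36 * (real n * real n) * 4 ^ n"
        using n by (intro mult_right_mono) auto
      then show ?thesis by (simp add: c_def budget_const_def power2_eq_square)
    qed
    have T1: "2 ^ (2 * i - 1) * L i * \<Omega> / (A i)\<^sup>2 \<le> \<epsilon> / (3 * real n)"
    proof -
      have "c * sqrt (L i * \<Omega> / \<epsilon>) \<le> A i" by (rule Ai, unfold target_budget_def) (use pos in linarith)
      then have "(c * sqrt (L i * \<Omega> / \<epsilon>))\<^sup>2 \<le> (A i)\<^sup>2" using c pos by (intro power_mono) auto
      then have "c\<^sup>2 * (L i * \<Omega> / \<epsilon>) \<le> (A i)\<^sup>2" using LMs \<Omega> \<epsilon> by (simp add: power_mult_distrib)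
      moreover have "c * 1 \<le> c\<^sup>2" unfolding power2_eq_square using c by (intro mult_left_mono) auto
      ultimately have "c * (L i * \<Omega> / \<epsilon>) \<le> (A i)\<^sup>2"
        using mult_right_mono[of "c * 1" "c\<^sup>2" "L i * \<Omega> / \<epsilon>"] LMs \<Omega> \<epsilon> by simp
      then have *: "c * (L i * \<Omega>) \<le> \<epsilon> * (A i)\<^sup>2" using \<epsilon> by (simp add: field_simps)
      have "(3 * real n * 4 ^ i) * (L i * \<Omega>) \<le> c * (L i * \<Omega>)"
        using LMs \<Omega> n0 pow by (intro mult_right_mono order.trans[OF _ cn] mult_left_mono) auto
      with * have "(3 * real n * 4 ^ i) * (L i * \<Omega>) \<le> \<epsilon> * (A i)\<^sup>2" by linarith
      moreover have "0 \<le> (3 * real n * 4 ^ i) * (L i * \<Omega>)" using LMs \<Omega> by simp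
      ultimately have "(3 * real n) * (4 ^ i / 2 * L i * \<Omega>) \<le> \<epsilon> * (A i)\<^sup>2" by (simp add: mult_ac)
      then show ?thesis unfolding two using A0 n0 by (simp add: pos_divide_le_eq pos_le_divide_eq mult_ac)
    qed
    have T2: "2 ^ (i - 1) * M i * \<Omega> / A i \<le> \<epsilon> / (3 * real n)"
    proof -
      have "c * (M i * \<Omega> / \<epsilon>) \<le> A i" by (rule Ai, unfold target_budget_def) (use pos in linarith)
      then have *: "c * (M i * \<Omega>) \<le> \<epsilon> * A i" using \<epsilon> by (simp add: field_simps)
      have "(2::real) ^ i \<le> 4 ^ n"
        using pow(2) order.trans[OF pow(2), of "4 ^ n"] power_mono[of "2::real" 4 n] by simp
      then have "(3 * real n * 2 ^ i) * (M i * \<Omega>) \<le> c * (M i * \<Omega>)"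
        using LMs \<Omega> n0 by (intro mult_right_mono order.trans[OF _ cn] mult_left_mono) auto
      with * have "(3 * real n * 2 ^ i) * (M i * \<Omega>) \<le> \<epsilon> * A i" by linarith
      moreover have "0 \<le> (3 * real n * 2 ^ i) * (M i * \<Omega>)" using LMs \<Omega> by simp
      ultimately have "(3 * real n) * (2 ^ i / 2 * M i * \<Omega>) \<le> \<epsilon> * A i" by (simp add: mult_ac)
      then show ?thesis unfolding two using A0 n0 by (simp add: pos_divide_le_eq pos_le_divide_eq mult_ac)
    qed
    have T3: "(2 ^ i + 2 powr (real i / 2)) * \<sigma> i * sqrt \<Omega> / sqrt (A i) \<le> \<epsilon> / (3 * real n)"
    proof -
      have "c * ((\<sigma> i)\<^sup>2 * \<Omega> / \<epsilon>\<^sup>2) \<le> A i" by (rule Ai, unfold target_budget_def) (use pos in linarith)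
      then have "sqrt (c * ((\<sigma> i)\<^sup>2 * \<Omega> / \<epsilon>\<^sup>2)) \<le> sqrt (A i)" by (rule real_sqrt_le_mono)
      moreover have "sqrt c = 6 * real n * 2 ^ n"
      proof -
        have "c = (6 * real n * 2 ^ n)\<^sup>2"
          by (simp add: c_def budget_const_def power_mult_distrib four power2_eq_square)
        then show ?thesis by simp
      qed
      ultimately have *: "6 * real n * 2 ^ n * (\<sigma> i * sqrt \<Omega>) \<le> \<epsilon> * sqrt (A i)"
        using LMs \<epsilon> by (simp add: real_sqrt_mult real_sqrt_divide field_simps)
      have "2 powr (real i / 2) \<le> 2 powr real i" by (intro powr_mono) auto
      then have "2 powr (real i / 2) \<le> (2::real) ^ i" by (simp add: powr_realpow)
      then have "2 ^ i + 2 powr (real i / 2) \<le> 2 * (2::real) ^ n" using pow(2) by linarith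
      then have "(3 * real n) * ((2 ^ i + 2 powr (real i / 2)) * (\<sigma> i * sqrt \<Omega>)) \<le> (3 * real n) * ((2 * 2 ^ n) * (\<sigma> i * sqrt \<Omega>))"
        using LMs \<Omega> n0 by (intro mult_left_mono mult_right_mono) auto
      also have "\<dots> \<le> \<epsilon> * sqrt (A i)" using * by (simp add: mult_ac)
      finally show ?thesis using A0 n0 by (simp add: pos_divide_le_eq pos_le_divide_eq mult_ac)
    qed
    have "\<epsilon> / real n = \<epsilon> / (3 * real n) + \<epsilon> / (3 * real n) + \<epsilon> / (3 * real n)"
      using n0 by (simp add: field_simps)
    then show ?thesis using T1 T2 T3 by linarith
  qed
  have "(\<Sum>i=1..n. 2 ^ (2 * i - 1) * L i * \<Omega> / (A i)\<^sup>2 + 2 ^ (i - 1) * M i * \<Omega> / A i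
      + (2 ^ i + 2 powr (real i / 2)) * \<sigma> i * sqrt \<Omega> / sqrt (A i)) \<le> (\<Sum>i=1..n. \<epsilon> / real n)"
    by (rule sum_mono[OF level])
  also have "\<dots> = \<epsilon>" using n0 by simp
  finally show ?thesis by (simp only: sum.distrib)
qed

lemma ex_sorting_permutation:
  fixes b :: "nat \<Rightarrow> real"
  shows "\<exists>\<pi>. \<pi> permutes {1..m} \<and> mono_on {1..m} (b \<circ> \<pi>)"
proof -
  define xs where "xs = sort_key b [1..<Suc m]"
  have xs: "length xs = m" "distinct xs" "set xs = {1..m}" "sorted (map b xs)"
    by (auto simp: xs_def)
  define \<pi> where "\<pi> i = (if i \<in> {1..m} then xs ! (i - 1) else i)" for i
  have "bij_betw (\<lambda>i. xs ! i) {..<m} {1..m}" using bij_betw_nth[OF xs(2)] xs(1,3) by auto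
  moreover have "bij_betw (\<lambda>i. i - 1) {1..m} {..<m}"
    by (rule bij_betw_byWitness[where f'=Suc]) auto
  ultimately have "bij_betw ((\<lambda>i. xs ! i) \<circ> (\<lambda>i. i - 1)) {1..m} {1..m}" by (rule bij_betw_trans[rotated])
  then have "bij_betw \<pi> {1..m} {1..m}"
    by (rule bij_betw_cong[THEN iffD1, rotated]) (auto simp: \<pi>_def)
  then have "\<pi> permutes {1..m}" by (rule bij_imp_permutes) (simp only: \<pi>_def if_False)
  moreover have "mono_on {1..m} (b \<circ> \<pi>)"
  proof (rule mono_onI)
    fix i j assume "i \<in> {1..m}" "j \<in> {1..m}" "i \<le> j"
    then show "(b \<circ> \<pi>) i \<le> (b \<circ> \<pi>) j"
      using sorted_nth_mono[OF xs(4), of "i - 1" "j - 1"] xs(1) by (auto simp: \<pi>_def)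
  qed
  ultimately show ?thesis by blast
qed

text \<open>
  Nondecreasing targets are reached by choosing the iteration numbers greedily. Rounding up costs at
  level \<open>i\<close> at most the budget of level \<open>i - 1\<close>, hence a factor linear in the number of levels.
\<close>
lemma ex_iteration_numbers:
  fixes b :: "nat \<Rightarrow> real"
  assumes c: "0 < c" and b: "\<And>i. i \<in> {1..m} \<Longrightarrow> 1 \<le> b i" and mono: "mono_on {1..m} b"
  shows "\<exists>T. (\<forall>j\<in>{1..m}. 0 < T j) \<and>
    (\<forall>i\<in>{1..m}. c * b i \<le> real (level_budget T i) \<and> real (level_budget T i) \<le> (real m * c + 1) * b i)"
proof -
  define A where "A = rec_nat 1 (\<lambda>i a. a * nat \<lceil>c * b (Suc i) / real a\<rceil>)"
  have A_simps: "A 0 = 1" "A (Suc i) = A i * nat \<lceil>c * b (Suc i) / real (A i)\<rceil>" for i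
    by (simp_all add: A_def)
  define T where "T j = nat \<lceil>c * b j / real (A (j - 1))\<rceil>" for j
  have lb: "level_budget T i = A i" for i
  proof (induction i)
    case (Suc i)
    then show ?case by (simp add: level_budget_def A_simps T_def mult.commute)
  qed (simp add: level_budget_def A_simps)
  have pos: "0 < A i" if "i \<le> m" for i
    using that
  proof (induction i)
    case (Suc i)
    then have "0 < c * b (Suc i) / real (A i)" using c b[of "Suc i"] by simp
    then show ?case using Suc by (simp add: A_simps)
  qed (simp add: A_simps)
  have step: "c * b (Suc i) \<le> real (A (Suc i)) \<and> real (A (Suc i)) \<le> c * b (Suc i) + real (A i)" if i: "Suc i \<le> m" for i
  proof -
    define x where "x = c * b (Suc i) / real (A i)"
    have x: "0 \<le> x" and A: "0 < real (A i)" using c b[of "Suc i"] i pos[of i] by (auto simp: x_def)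
    have "real (A (Suc i)) = real (A i) * of_int \<lceil>x\<rceil>" using x by (simp add: A_simps x_def)
    moreover have "real (A i) * x \<le> real (A i) * of_int \<lceil>x\<rceil>" using A by (intro mult_left_mono) auto
    moreover have "real (A i) * of_int \<lceil>x\<rceil> \<le> real (A i) * (x + 1)" using A by (intro mult_left_mono) linarith+
    moreover have "real (A i) * x = c * b (Suc i)" using A by (simp add: x_def)
    ultimately show ?thesis by (simp add: distrib_left)
  qed
  have upper: "real (A i) \<le> (real i * c + 1) * b i" if "i \<in> {1..m}" for i
    using that
  proof (induction i)
    case (Suc i)
    have "real (A i) \<le> (real i * c + 1) * b (Suc i)"
    proof (cases "i = 0")
      case True then show ?thesis using b[of "Suc i"] Suc.prems by (simp add: A_simps)
    next
      case False
      then have "b i \<le> b (Suc i)" using Suc.prems by (intro mono_onD[OF mono]) auto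
      then have "(real i * c + 1) * b i \<le> (real i * c + 1) * b (Suc i)" using c by (intro mult_left_mono) auto
      then show ?thesis using Suc False by simp
    qed
    then show ?case using step[of i] Suc.prems by (simp add: algebra_simps)
  qed simp
  have "c * b i \<le> real (A i) \<and> real (A i) \<le> (real m * c + 1) * b i" if i: "i \<in> {1..m}" for i
  proof
    show "c * b i \<le> real (A i)" using step[of "i - 1"] i by simp
    have "(real i * c + 1) * b i \<le> (real m * c + 1) * b i"
      using i c b[OF i] by (intro mult_right_mono) auto
    with upper[OF i] show "real (A i) \<le> (real m * c + 1) * b i" by linarith
  qed
  moreover have "0 < T j" if "j \<in> {1..m}" for j
  proof -
    have "j - 1 \<le> m" using that by auto
    then have "0 < real (A (j - 1))" using pos by simp
    then have "0 < c * b j / real (A (j - 1))" using c b[OF that] by simp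
    then show ?thesis by (simp add: T_def)
  qed
  ultimately show ?thesis by (intro exI[of _ T]) (simp add: lb)
qed

lemma target_budget_ge_1: "0 \<le> L \<Longrightarrow> 0 \<le> M \<Longrightarrow> 0 < \<Omega> \<Longrightarrow> 0 < \<epsilon> \<Longrightarrow> 1 \<le> target_budget L M \<sigma> \<Omega> \<epsilon>"
  by (simp add: target_budget_def)

lemma tuned_run_counts:
  assumes "i \<in> {1..n}"
  shows "Gcount (snd (tuned_run n T Z P Q G L M \<sigma> \<Omega> zin x)) i = level_budget T i"
    and "Qcount (snd (tuned_run n T Z P Q G L M \<sigma> \<Omega> zin x)) i = 2 * level_budget T i"
  using assms
  by (simp_all add: tuned_run_def sliding_run_def sliding_rec_counts init_state_def level_budget_def)


lemma (in stochastic_sliding) expected_gap_and_accuracy: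
  "let zout = (\<lambda>\<omega>. fst (tuned_run n T Z P Q G L M \<sigma> \<Omega> (zin \<omega>) (\<lambda>\<nu>. \<xi> \<nu> \<omega>)));
       A = (\<lambda>i. real (level_budget T i))
   in integrable Pr (\<lambda>\<omega>. gap n Z p Q (zout \<omega>)) \<and>
      (\<integral>\<omega>. gap n Z p Q (zout \<omega>) \<partial>Pr)
        \<le> (\<Sum>i=1..n. 2 ^ (2 * i - 1) * L i * \<Omega> / (A i)\<^sup>2)
          + (\<Sum>i=1..n. 2 ^ (i - 1) * M i * \<Omega> / A i)
          + (\<Sum>i=1..n. (2 ^ i + 2 powr (real i / 2)) * \<sigma> i * sqrt \<Omega> / sqrt (A i)) \<and>
      0 < budget_const n \<and>
      (\<forall>\<epsilon>>0. (\<forall>i\<in>{1..n}. A i \<ge> budget_const n * target_budget (L i) (M i) (\<sigma> i) \<Omega> \<epsilon>)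
         \<longrightarrow> (\<integral>\<omega>. gap n Z p Q (zout \<omega>) \<partial>Pr) \<le> \<epsilon>)"
proof -
  interpret O: sliding_oracle Pr n T Z P p gradp Q L M \<sigma> \<Omega> S G \<xi> zin by (rule sliding_oracle)
  have zout: "O.zout = (\<lambda>\<omega>. fst (tuned_run n T Z P Q G L M \<sigma> \<Omega> (zin \<omega>) (\<lambda>\<nu>. \<xi> \<nu> \<omega>)))"
    by (rule ext) (simp add: O.zout_def O.run_def)
  have "(\<integral>\<omega>. gap n Z p Q (O.zout \<omega>) \<partial>Pr) \<le> \<epsilon>"
    if "0 < \<epsilon>" "\<And>i. i \<in> {1..n} \<Longrightarrow> budget_const n * target_budget (L i) (M i) (\<sigma> i) \<Omega> \<epsilon> \<le> real (level_budget T i)" for \<epsilon>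
    by (rule order.trans[OF O.expected_gap error_bound_le_eps])
       (use n_pos L_nonneg M_nonneg \<sigma>_nonneg \<Omega>_pos that in auto)
  moreover have "0 < budget_const n" using budget_const_ge[OF n_pos] by linarith
  ultimately show ?thesis
    unfolding Let_def zout[symmetric] using O.gap_integrable O.expected_gap by blast
qed

lemma budgets_attainable:
  "\<forall>m\<ge>1. \<exists>C>0. \<forall>(L :: nat \<Rightarrow> real) (M :: nat \<Rightarrow> real) (\<sigma> :: nat \<Rightarrow> real) (\<Omega> :: real) (\<epsilon> :: real).
      (\<forall>i\<in>{1..m}. 0 \<le> L i \<and> 0 \<le> M i \<and> 0 \<le> \<sigma> i) \<and> 0 < \<Omega> \<and> 0 < \<epsilon> \<longrightarrow>
      (let b = (\<lambda>i. target_budget (L i) (M i) (\<sigma> i) \<Omega> \<epsilon>)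
       in (\<exists>\<pi>. \<pi> permutes {1..m} \<and> mono_on {1..m} (b \<circ> \<pi>)) \<and>
          (\<forall>\<pi>. \<pi> permutes {1..m} \<and> mono_on {1..m} (b \<circ> \<pi>) \<longrightarrow>
             (\<exists>T'. (\<forall>j\<in>{1..m}. 0 < T' j) \<and>
                (\<forall>i\<in>{1..m}. budget_const m * b (\<pi> i) \<le> real (level_budget T' i) \<and>
                             real (level_budget T' i) \<le> C * b (\<pi> i)))))"
  (is "\<forall>m\<ge>1. \<exists>C>0. \<forall>L M \<sigma> \<Omega> \<epsilon>. ?admissible m L M \<sigma> \<Omega> \<epsilon> \<longrightarrow> ?attainable m C L M \<sigma> \<Omega> \<epsilon>")
proof (intro allI impI)
  fix m :: nat assume m: "1 \<le> m"
  define c where "c = budget_const m"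
  have c: "1 \<le> c" unfolding c_def by (rule budget_const_ge[OF m])
  have "?attainable m (real m * c + 1) L M \<sigma> \<Omega> \<epsilon>" if nn: "?admissible m L M \<sigma> \<Omega> \<epsilon>" for L M \<sigma> \<Omega> \<epsilon>
  proof -
    define b where "b = (\<lambda>i. target_budget (L i) (M i) (\<sigma> i) \<Omega> \<epsilon>)"
    have "\<exists>T'. (\<forall>j\<in>{1..m}. 0 < T' j) \<and>
        (\<forall>i\<in>{1..m}. c * b (\<pi> i) \<le> real (level_budget T' i) \<and> real (level_budget T' i) \<le> (real m * c + 1) * b (\<pi> i))"
      if \<pi>: "\<pi> permutes {1..m}" "mono_on {1..m} (b \<circ> \<pi>)" for \<pi>
    proof -
      have "1 \<le> (b \<circ> \<pi>) i" if "i \<in> {1..m}" for i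
        using permutes_in_image[OF \<pi>(1), of i] that nn unfolding b_def comp_def
        by (intro target_budget_ge_1) auto
      then show ?thesis using ex_iteration_numbers[of c m "b \<circ> \<pi>"] c \<pi>(2) by simp
    qed
    then show ?thesis
      unfolding Let_def b_def[symmetric] c_def[symmetric] using ex_sorting_permutation by blast
  qed
  moreover have "0 < real m * c + 1" using c by (intro add_nonneg_pos) auto
  ultimately show "\<exists>C>0. \<forall>L M \<sigma> \<Omega> \<epsilon>. ?admissible m L M \<sigma> \<Omega> \<epsilon> \<longrightarrow> ?attainable m C L M \<sigma> \<Omega> \<epsilon>" by blast
qed


section \<open>The bilinear problem as an instance\<close>

lemma sym_pos_def_id: "sym_pos_def (id :: 'z::euclidean_space \<Rightarrow> 'z)"
  by (simp add: sym_pos_def_def id_def linear_id[unfolded id_def] inner_gt_zero_iff)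

lemma pnorm_id: "pnorm id z = norm z" and dual_pnorm_id: "dual_pnorm id z = norm z"
  by (simp_all add: pnorm_def dual_pnorm_def norm_eq_sqrt_inner)

lemma dual_pnorm_id': "dual_pnorm id = norm"
  by (rule ext) (rule dual_pnorm_id)

definition bil_grad ::
  "('x::euclidean_space \<Rightarrow> 'x) \<Rightarrow> ('y::euclidean_space \<Rightarrow> 'y) \<Rightarrow> nat \<Rightarrow> 'x \<times> 'y \<Rightarrow> 'x \<times> 'y" where
  "bil_grad gf gg i z = (if i = 1 then (gf (fst z), 0) else if i = 2 then (0, gg (snd z)) else 0)"

lemma real_cond_exp_zero: "real_cond_exp M F (\<lambda>_. 0) \<omega> = 0"
  by (simp add: real_cond_exp_def)

text \<open>
  A projection onto a coordinate block together with the embedding adjoint to it. Functions and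
  oracles of one block become functions and oracles on the whole space by composition.
\<close>
locale block =
  fixes pr :: "'z::euclidean_space \<Rightarrow> 'v::euclidean_space" and em :: "'v \<Rightarrow> 'z"
  assumes pr: "bounded_linear pr" and em: "bounded_linear em"
    and adj: "em a \<bullet> h = a \<bullet> pr h"
    and contraction: "norm (pr h) \<le> norm h" and isometry: "norm (em a) = norm a"
    and pr_Basis: "b \<in> Basis \<Longrightarrow> pr b = 0 \<or> pr b \<in> Basis"
begin

lemma pr_borel: "pr \<in> borel_measurable borel" and em_borel: "em \<in> borel_measurable borel"
  by (intro borel_measurable_continuous_onI linear_continuous_on pr em)+

lemma em_diff: "em a - em b = em (a - b)"
  by (simp add: linear_diff[OF bounded_linear.linear[OF em]])

lemma convex_smooth_pullback:
  assumes f: "convex_smooth id X L f gf" and L: "0 \<le> L" and W: "convex W" "pr ` W \<subseteq> X"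
  shows "convex_smooth id W L (\<lambda>z. f (pr z)) (\<lambda>z. em (gf (pr z)))"
  unfolding convex_smooth_def
proof (intro conjI ballI)
  have cvx: "convex_on X f" using f by (simp add: convex_smooth_def)
  have lin: "linear pr" using pr by (rule bounded_linear.linear)
  show "convex_on W (\<lambda>z. f (pr z))"
  proof (rule convex_onI[OF _ W(1)])
    fix t :: real and u v assume "0 < t" "t < 1" "u \<in> W" "v \<in> W"
    then show "f (pr ((1 - t) *\<^sub>R u + t *\<^sub>R v)) \<le> (1 - t) * f (pr u) + t * f (pr v)"
      using convex_onD[OF cvx, of t "pr u" "pr v"] W(2) by (auto simp: linear_add[OF lin] linear_scale[OF lin])
  qed
  show "((\<lambda>z. f (pr z)) has_derivative (\<lambda>h. em (gf (pr v)) \<bullet> h)) (at v within W)" if v: "v \<in> W" for v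
  proof -
    have "(f has_derivative (\<lambda>h. gf (pr v) \<bullet> h)) (at (pr v) within pr ` W)"
      by (rule has_derivative_subset[OF _ W(2)]) (use f v W(2) in \<open>auto simp: convex_smooth_def\<close>)
    then show ?thesis
      unfolding adj by (rule has_derivative_in_compose[OF bounded_linear_imp_has_derivative[OF pr]])
  qed
  show "lipschitz_op id W L (\<lambda>z. em (gf (pr z)))"
    unfolding lipschitz_op_def pnorm_id dual_pnorm_id em_diff isometry
  proof (intro ballI)
    fix u v assume "u \<in> W" "v \<in> W"
    then have "pr u \<in> X" "pr v \<in> X" using W(2) by auto
    then have "norm (gf (pr u) - gf (pr v)) \<le> L * norm (pr (u - v))"
      using f by (simp add: convex_smooth_def lipschitz_op_def pnorm_id dual_pnorm_id linear_diff[OF lin])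
    also have "\<dots> \<le> L * norm (u - v)" by (intro mult_left_mono contraction L)
    finally show "norm (gf (pr u) - gf (pr v)) \<le> L * norm (u - v)" .
  qed
qed

lemma oracle_measurable_pullback:
  assumes G: "(\<lambda>(v, x). Gf v x) \<in> borel_measurable (restrict_space borel X \<Otimes>\<^sub>M S)" and W: "pr ` W \<subseteq> X"
  shows "(\<lambda>(v, x). em (Gf (pr v) x)) \<in> borel_measurable (restrict_space borel W \<Otimes>\<^sub>M S)"
proof -
  have "pr \<in> measurable (restrict_space borel W) (restrict_space borel X)"
    by (rule measurable_restrict_space3[OF pr_borel]) (use W in auto)
  then have "(\<lambda>(v, x). (pr v, x)) \<in> measurable (restrict_space borel W \<Otimes>\<^sub>M S) (restrict_space borel X \<Otimes>\<^sub>M S)"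
    unfolding case_prod_beta by (intro measurable_Pair measurable_compose[OF measurable_fst] measurable_snd)
  from measurable_compose[OF measurable_compose[OF this G] em_borel] show ?thesis by (simp add: case_prod_beta)
qed

lemma unbiased_oracle_pullback:
  assumes G: "unbiased_oracle Pr F norm s X gf Gf x" and W: "pr ` W \<subseteq> X"
  shows "unbiased_oracle Pr F norm s W (\<lambda>z. em (gf (pr z))) (\<lambda>z x. em (Gf (pr z) x)) x"
  unfolding unbiased_oracle_def
proof (intro ballI impI)
  fix v assume v: "v \<in> borel_measurable F" "\<forall>\<omega>\<in>space Pr. v \<omega> \<in> W"
  have pv: "(\<lambda>\<omega>. pr (v \<omega>)) \<in> borel_measurable F" by (rule measurable_compose[OF v(1) pr_borel])
  have pvX: "\<forall>\<omega>\<in>space Pr. pr (v \<omega>) \<in> X" using v(2) W by auto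
  note * = bspec[OF G[unfolded unbiased_oracle_def] pv, THEN mp, OF pvX]
  have "AE \<omega> in Pr. real_cond_exp Pr F (\<lambda>\<omega>. (Gf (pr (v \<omega>)) (x \<omega>) - gf (pr (v \<omega>))) \<bullet> pr b) \<omega> = 0" if "b \<in> Basis" for b
    using pr_Basis[OF that] * by (auto simp: real_cond_exp_zero)
  with conjunct2[OF *] show "(\<forall>b\<in>Basis. AE \<omega> in Pr. real_cond_exp Pr F (\<lambda>\<omega>. (em (Gf (pr (v \<omega>)) (x \<omega>)) - em (gf (pr (v \<omega>)))) \<bullet> b) \<omega> = 0) \<and>
      (AE \<omega> in Pr. nn_cond_exp Pr F (\<lambda>\<omega>. ennreal ((norm (em (Gf (pr (v \<omega>)) (x \<omega>)) - em (gf (pr (v \<omega>)))))\<^sup>2)) \<omega> \<le> ennreal (s\<^sup>2))"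
    unfolding em_diff isometry adj by blast
qed

end

lemma block_fst: "block (fst :: 'x::euclidean_space \<times> 'y::euclidean_space \<Rightarrow> 'x) (\<lambda>a. (a, 0))"
  and block_snd: "block (snd :: 'x \<times> 'y \<Rightarrow> 'y) (\<lambda>a. (0, a))"
proof -
  show "block (fst :: 'x \<times> 'y \<Rightarrow> 'x) (\<lambda>a. (a, 0))"
  proof (rule block.intro)
    show "norm (fst h) \<le> norm h" for h :: "'x \<times> 'y" using norm_fst_le[of "fst h" "snd h"] by simp
    show "bounded_linear (\<lambda>a. (a :: 'x, 0 :: 'y))"
      by (intro bounded_linear_Pair bounded_linear_ident bounded_linear_zero)
  qed (auto simp: bounded_linear_fst inner_prod_def norm_prod_def Basis_prod_def)
  show "block (snd :: 'x \<times> 'y \<Rightarrow> 'y) (\<lambda>a. (0, a))"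
  proof (rule block.intro)
    show "norm (snd h) \<le> norm h" for h :: "'x \<times> 'y" using norm_snd_le[of "snd h" "fst h"] by simp
    show "bounded_linear (\<lambda>a. (0 :: 'x, a :: 'y))"
      by (intro bounded_linear_Pair bounded_linear_ident bounded_linear_zero)
  qed (auto simp: bounded_linear_snd inner_prod_def norm_prod_def Basis_prod_def)
qed

lemma convex_smooth_zero: "convex Z \<Longrightarrow> convex_smooth id Z 0 (\<lambda>_. 0) (\<lambda>_. 0)"
  by (auto simp: convex_smooth_def lipschitz_op_def pnorm_id dual_pnorm_id convex_on_const)

lemma coupling_lipschitz:
  assumes B: "linear B" and bound: "onorm B \<le> l"
  shows "lipschitz_op id Z l (\<lambda>z. (adjoint B (snd z), - B (fst z)))"
proof -
  have bl: "bounded_linear B" using B by (simp add: linear_conv_bounded_linear)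
  have lin': "linear (adjoint B)" by (rule adjoint_linear[OF B])
  have l: "0 \<le> l" using onorm_pos_le[OF bl] bound by linarith
  have B_le: "norm (B x) \<le> l * norm x" for x
    using onorm[OF bl, of x] mult_right_mono[OF bound, of "norm x"] by simp
  have adj_le: "norm (adjoint B y) \<le> l * norm y" for y
  proof -
    have "norm (adjoint B y) * norm (adjoint B y) = adjoint B y \<bullet> adjoint B y"
      by (simp add: dot_square_norm power2_eq_square)
    also have "\<dots> = B (adjoint B y) \<bullet> y" by (rule adjoint_works[OF B])
    also have "\<dots> \<le> norm (B (adjoint B y)) * norm y" by (rule norm_cauchy_schwarz)
    also have "\<dots> \<le> (l * norm (adjoint B y)) * norm y" by (intro mult_right_mono B_le) auto
    finally show ?thesis by (cases "adjoint B y = 0") (auto simp: l mult_ac)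
  qed
  show ?thesis
    unfolding lipschitz_op_def pnorm_id dual_pnorm_id
  proof (intro ballI)
    fix u v :: "'a \<times> 'b"
    define d where "d = u - v"
    have eq: "(adjoint B (snd u), - B (fst u)) - (adjoint B (snd v), - B (fst v)) = (adjoint B (snd d), - B (fst d))"
      by (simp add: d_def linear_diff[OF B] linear_diff[OF lin'])
    have "(norm (adjoint B (snd d)))\<^sup>2 + (norm (B (fst d)))\<^sup>2 \<le> (l * norm (snd d))\<^sup>2 + (l * norm (fst d))\<^sup>2"
      by (intro add_mono power_mono adj_le B_le) auto
    also have "\<dots> = l\<^sup>2 * ((norm (fst d))\<^sup>2 + (norm (snd d))\<^sup>2)" by (simp add: power_mult_distrib algebra_simps)
    finally have "sqrt ((norm (adjoint B (snd d)))\<^sup>2 + (norm (B (fst d)))\<^sup>2) \<le> sqrt (l\<^sup>2 * ((norm (fst d))\<^sup>2 + (norm (snd d))\<^sup>2))"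
      by (rule real_sqrt_le_mono)
    then show "norm ((adjoint B (snd u), - B (fst u)) - (adjoint B (snd v), - B (fst v))) \<le> l * norm (u - v)"
      unfolding eq d_def[symmetric] using l by (simp add: norm_prod_def real_sqrt_mult)
  qed
qed

text \<open>
  The coupling is skew-symmetric.
\<close>
lemma coupling_monotone:
  assumes B: "linear B"
  shows "monotone_op Z (\<lambda>z. (adjoint B (snd z), - B (fst z)))"
  unfolding monotone_op_def
proof (intro ballI)
  fix u v :: "'a \<times> 'b"
  define d where "d = u - v"
  have eq: "(adjoint B (snd u), - B (fst u)) - (adjoint B (snd v), - B (fst v)) = (adjoint B (snd d), - B (fst d))"
    by (simp add: d_def linear_diff[OF B] linear_diff[OF adjoint_linear[OF B]])
  have "adjoint B (snd d) \<bullet> fst d = B (fst d) \<bullet> snd d"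
    using adjoint_works[OF B, of "fst d" "snd d"] by (simp add: inner_commute)
  then show "0 \<le> ((adjoint B (snd u), - B (fst u)) - (adjoint B (snd v), - B (fst v))) \<bullet> (u - v)"
    unfolding eq d_def[symmetric] by (simp add: inner_prod_def)
qed

lemma (in prob_space) unbiased_oracle_zero:
  assumes "subalgebra M F"
  shows "unbiased_oracle M F norm s V (\<lambda>_. 0) (\<lambda>_ _. 0) x"
proof -
  interpret F: finite_measure_subalgebra M F
    by (intro finite_measure_subalgebra.intro finite_measure_axioms finite_measure_subalgebra_axioms.intro assms)
  have "AE \<omega> in M. 0 = nn_cond_exp M F (\<lambda>_. 0) \<omega>" by (rule F.nn_cond_exp_F_meas) simp
  then have "AE \<omega> in M. nn_cond_exp M F (\<lambda>_. 0) \<omega> \<le> ennreal (s\<^sup>2)" by eventually_elim simp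
  then show ?thesis by (simp add: unbiased_oracle_def real_cond_exp_zero)
qed

context stochastic_bilinear
begin

lemma bilinear_sliding_oracle:
  fixes Pr :: "'w measure"
  assumes \<pi>: "\<pi> permutes {1..3}" and T: "\<And>j. j \<in> {1..3} \<Longrightarrow> 0 < T j"
    and samples: "bilinear_samples Pr \<xi> \<pi> T X Y gradf gradg \<sigma>x \<sigma>y S Gf Gg z0"
  shows "sliding_oracle Pr 3 T (X \<times> Y) id (bil_p f g \<circ> \<pi>) (bil_grad gradf gradg \<circ> \<pi>) (bil_Q B \<circ> \<pi>)
    (bil_const Lx Ly 0 \<circ> \<pi>) (bil_const 0 0 Lxy \<circ> \<pi>) (bil_const \<sigma>x \<sigma>y 0 \<circ> \<pi>) (sq_radius (X \<times> Y) z0)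
    S (bil_G Gf Gg \<circ> \<pi>) \<xi> (\<lambda>_. z0)"
proof -
  define \<Omega> where "\<Omega> = sq_radius (X \<times> Y) z0"
  interpret Pr: prob_space Pr using samples by (simp add: bilinear_samples_def)
  have \<pi>_cases: "\<pi> i = 1 \<or> \<pi> i = 2 \<or> \<pi> i = 3" if "i \<in> {1..3}" for i
    using permutes_in_image[OF \<pi>, of i] that by auto
  have cvx: "convex (X \<times> Y)" using X Y by (intro convex_Times) auto
  have \<sigma>: "0 \<le> bil_const \<sigma>x \<sigma>y 0 j" and L: "0 \<le> bil_const Lx Ly 0 j" and M: "0 \<le> bil_const 0 0 Lxy j" for j
    using constants by (auto simp: bil_const_def)
  have tau: "0 \<le> noise_tau T (bil_const \<sigma>x \<sigma>y 0 \<circ> \<pi>) \<Omega> i" for i using \<sigma> by (simp add: noise_tau_def)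
  have \<xi>: "\<And>\<nu>. \<nu> \<in> nodes 3 T \<Longrightarrow> \<xi> \<nu> \<in> measurable Pr S" using samples by (simp add: bilinear_samples_def)
  interpret fst: block "fst :: 'x \<times> 'y \<Rightarrow> 'x" "\<lambda>a. (a, 0)" by (rule block_fst)
  interpret snd: block "snd :: 'x \<times> 'y \<Rightarrow> 'y" "\<lambda>a. (0, a)" by (rule block_snd)
  have img: "fst ` (X \<times> Y) \<subseteq> X" "snd ` (X \<times> Y) \<subseteq> Y" by auto
  have sub: "subalgebra Pr (node_history 3 T Pr S (\<lambda>_. z0) \<xi> \<nu>)" if "\<nu> \<in> nodes 3 T" for \<nu>
    unfolding node_history_eq[OF that] by (rule subalgebra_history[OF _ \<xi>]) simp
  show ?thesis
    unfolding \<Omega>_def[symmetric]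
  proof unfold_locales
    fix i :: nat assume i: "i \<in> {1..3}"
    note c = \<pi>_cases[OF i]
    show "0 < T i" by (rule T[OF i])
    show "0 \<le> (bil_const Lx Ly 0 \<circ> \<pi>) i" "0 \<le> (bil_const 0 0 Lxy \<circ> \<pi>) i" "0 \<le> (bil_const \<sigma>x \<sigma>y 0 \<circ> \<pi>) i"
      using L M \<sigma> by simp_all
    show "0 \<le> noise_tau T (bil_const \<sigma>x \<sigma>y 0 \<circ> \<pi>) \<Omega> i" by (rule tau)
    show "0 < (bil_const Lx Ly 0 \<circ> \<pi>) i + noise_tau T (bil_const \<sigma>x \<sigma>y 0 \<circ> \<pi>) \<Omega> i + (bil_const 0 0 Lxy \<circ> \<pi>) i"
    proof -
      have "0 < bil_const Lx Ly 0 (\<pi> i) + bil_const 0 0 Lxy (\<pi> i)"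
        using c constants by (auto simp: bil_const_def)
      then show ?thesis using tau[of i] by simp
    qed
    show "monotone_op (X \<times> Y) ((bil_Q B \<circ> \<pi>) i)"
      using c coupling_monotone[OF B(1), of "X \<times> Y"] by (auto simp: bil_Q_def[abs_def] monotone_op_def)
    show "lipschitz_op id (X \<times> Y) ((bil_const 0 0 Lxy \<circ> \<pi>) i) ((bil_Q B \<circ> \<pi>) i)"
      using c coupling_lipschitz[OF B, of "X \<times> Y"]
      by (auto simp: bil_Q_def[abs_def] bil_const_def lipschitz_op_def pnorm_id dual_pnorm_id)
    show "convex_smooth id (X \<times> Y) ((bil_const Lx Ly 0 \<circ> \<pi>) i) ((bil_p f g \<circ> \<pi>) i) ((bil_grad gradf gradg \<circ> \<pi>) i)"
      using c fst.convex_smooth_pullback[OF f_smooth _ cvx img(1)] snd.convex_smooth_pullback[OF g_smooth _ cvx img(2)] convex_smooth_zero[OF cvx] constants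
      by (auto simp: bil_p_def[abs_def] bil_grad_def[abs_def] bil_const_def)
    show "(\<lambda>(v, x). (bil_G Gf Gg \<circ> \<pi>) i v x) \<in> borel_measurable (restrict_space borel (X \<times> Y) \<Otimes>\<^sub>M S)"
      using c fst.oracle_measurable_pullback[OF Gf_measurable img(1)] snd.oracle_measurable_pullback[OF Gg_measurable img(2)]
      by (auto simp: bil_G_def)
    fix \<nu> assume \<nu>: "\<nu> \<in> level T i"
    have node: "\<nu> \<in> nodes 3 T" using \<nu> i by (auto simp: nodes_eq_levels)
    have len: "length \<nu> = i" using \<nu> by (auto dest: length_extensions)
    show "unbiased_oracle Pr (node_history 3 T Pr S (\<lambda>_. z0) \<xi> \<nu>) (dual_pnorm id) ((bil_const \<sigma>x \<sigma>y 0 \<circ> \<pi>) i) (X \<times> Y)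
            ((bil_grad gradf gradg \<circ> \<pi>) i) ((bil_G Gf Gg \<circ> \<pi>) i) (\<xi> \<nu>)"
      using c
    proof (elim disjE)
      assume p: "\<pi> i = 1"
      then have "unbiased_oracle Pr (node_history 3 T Pr S (\<lambda>_. z0) \<xi> \<nu>) norm \<sigma>x X gradf Gf (\<xi> \<nu>)"
        using samples node len by (auto simp: bilinear_samples_def)
      from fst.unbiased_oracle_pullback[OF this img(1)] show ?thesis
        by (simp add: p dual_pnorm_id' bil_const_def bil_grad_def[abs_def] bil_G_def[abs_def])
    next
      assume p: "\<pi> i = 2"
      then have "unbiased_oracle Pr (node_history 3 T Pr S (\<lambda>_. z0) \<xi> \<nu>) norm \<sigma>y Y gradg Gg (\<xi> \<nu>)"
        using samples node len by (auto simp: bilinear_samples_def)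
      from snd.unbiased_oracle_pullback[OF this img(2)] show ?thesis
        by (simp add: p dual_pnorm_id' bil_const_def bil_grad_def[abs_def] bil_G_def[abs_def])
    next
      assume p: "\<pi> i = 3"
      then show ?thesis
        using Pr.unbiased_oracle_zero[OF sub[OF node], of 0 "X \<times> Y" "\<xi> \<nu>"]
        by (simp add: dual_pnorm_id' bil_const_def bil_grad_def[abs_def] bil_G_def[abs_def])
    qed
  next
    show "compact (X \<times> Y)" using X Y by (intro compact_Times) (auto simp: compact_eq_bounded_closed)
    show "X \<times> Y \<noteq> {}" using X Y by auto
    show "0 < \<Omega>" using radius_pos by (simp add: \<Omega>_def)
    show "AE \<omega> in Pr. (SUP z\<in>X \<times> Y. (pnorm id (z0 - z))\<^sup>2) \<le> \<Omega>"
      by (simp add: \<Omega>_def sq_radius_def pnorm_id)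
  qed (use cvx sym_pos_def_id z0 \<xi> in auto)
qed

lemma bilinear_complexity:
  "\<exists>\<epsilon>0>0. \<forall>\<epsilon>. 0 < \<epsilon> \<and> \<epsilon> \<le> \<epsilon>0 \<longrightarrow>
     (\<exists>\<pi> T. \<pi> permutes {1..3} \<and> (\<forall>j\<in>{1..3}. 0 < T j) \<and>
        (let run = bilinear_run \<pi> T X Y B Gf Gg Lx Ly Lxy \<sigma>x \<sigma>y z0;
             \<Omega> = sq_radius (X \<times> Y) z0
         in (\<forall>x. let s = snd (run x) in
                real (f_samples \<pi> s) \<le> bilinear_const * (sqrt (Lx * \<Omega> / \<epsilon>) + \<sigma>x\<^sup>2 * \<Omega> / \<epsilon>\<^sup>2) \<and>
                real (g_samples \<pi> s) \<le> bilinear_const * (sqrt (Ly * \<Omega> / \<epsilon>) + \<sigma>y\<^sup>2 * \<Omega> / \<epsilon>\<^sup>2) \<and>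
                real (B_products \<pi> s) \<le> bilinear_const * (Lxy * \<Omega> / \<epsilon>)) \<and>
            (\<forall>(Pr :: 'w measure) \<xi>.
               bilinear_samples Pr \<xi> \<pi> T X Y gradf gradg \<sigma>x \<sigma>y S Gf Gg z0 \<longrightarrow>
               integrable Pr (\<lambda>\<omega>. gap 3 (X \<times> Y) (bil_p f g \<circ> \<pi>) (bil_Q B \<circ> \<pi>) (fst (run (\<lambda>\<nu>. \<xi> \<nu> \<omega>)))) \<and>
               (\<integral>\<omega>. gap 3 (X \<times> Y) (bil_p f g \<circ> \<pi>) (bil_Q B \<circ> \<pi>) (fst (run (\<lambda>\<nu>. \<xi> \<nu> \<omega>))) \<partial>Pr) \<le> \<epsilon>)))"
  (is "\<exists>\<epsilon>0>0. \<forall>\<epsilon>. _ \<longrightarrow> ?attained \<epsilon>")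
proof -
  define \<Omega> where "\<Omega> = sq_radius (X \<times> Y) z0"
  have \<Omega>: "0 < \<Omega>" using radius_pos by (simp add: \<Omega>_def)
  \<comment> \<open>below this accuracy the additive \<open>1\<close> in each target budget is dominated by its deterministic term\<close>
  define \<epsilon>0 where "\<epsilon>0 = Min {Lx * \<Omega>, Ly * \<Omega>, Lxy * \<Omega>}"
  have \<epsilon>0: "0 < \<epsilon>0" using constants \<Omega> by (simp add: \<epsilon>0_def)
  have main: "?attained \<epsilon>"
    if \<epsilon>: "0 < \<epsilon>" "\<epsilon> \<le> \<epsilon>0" for \<epsilon>
  proof -
    define b where "b i = target_budget (bil_const Lx Ly 0 i) (bil_const 0 0 Lxy i) (bil_const \<sigma>x \<sigma>y 0 i) \<Omega> \<epsilon>" for i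
    have nn: "0 \<le> bil_const Lx Ly 0 i" "0 \<le> bil_const 0 0 Lxy i" "0 \<le> bil_const \<sigma>x \<sigma>y 0 i" for i
      using constants by (auto simp: bil_const_def)
    have b1: "1 \<le> b i" for i unfolding b_def by (rule target_budget_ge_1[OF nn(1,2) \<Omega> \<epsilon>(1)])
    define c where "c = budget_const 3"
    have c: "1 \<le> c" unfolding c_def by (rule budget_const_ge) simp
    obtain \<pi> where \<pi>: "\<pi> permutes {1..3}" "mono_on {1..3} (b \<circ> \<pi>)" using ex_sorting_permutation by blast
    have "\<exists>T. (\<forall>j\<in>{1..3}. 0 < T j) \<and> (\<forall>i\<in>{1..3}. c * (b \<circ> \<pi>) i \<le> real (level_budget T i) \<and>
        real (level_budget T i) \<le> (real 3 * c + 1) * (b \<circ> \<pi>) i)"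
      by (rule ex_iteration_numbers[OF _ _ \<pi>(2)]) (use c b1 in auto)
    then obtain T where T: "\<And>j. j \<in> {1..3} \<Longrightarrow> 0 < T j"
      "\<And>i. i \<in> {1..3} \<Longrightarrow> c * (b \<circ> \<pi>) i \<le> real (level_budget T i)"
      "\<And>i. i \<in> {1..3} \<Longrightarrow> real (level_budget T i) \<le> (real 3 * c + 1) * (b \<circ> \<pi>) i"
      by blast
    define run where "run = bilinear_run \<pi> T X Y B Gf Gg Lx Ly Lxy \<sigma>x \<sigma>y z0"
    have inv: "inv \<pi> j \<in> {1..3}" "\<pi> (inv \<pi> j) = j" if "j \<in> {1..3}" for j
      using permutes_in_image[OF permutes_inv[OF \<pi>(1)], of j] permutes_inverses(1)[OF \<pi>(1), of j] that by simp_all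
    have level: "real (level_budget T (inv \<pi> j)) \<le> (3 * c + 1) * b j" if "j \<in> {1..3}" for j
      using T(3)[OF inv(1)[OF that]] inv(2)[OF that] by simp
    have counts: "Gcount (snd (run x)) (inv \<pi> j) = level_budget T (inv \<pi> j)"
      "Qcount (snd (run x)) (inv \<pi> j) = 2 * level_budget T (inv \<pi> j)" if "j \<in> {1..3}" for j x
      unfolding run_def bilinear_run_def by (rule tuned_run_counts[OF inv(1)[OF that]])+
    have ratio: "1 \<le> l * \<Omega> / \<epsilon>" if "l \<in> {Lx, Ly, Lxy}" for l
    proof -
      have "\<epsilon> \<le> l * \<Omega>" using that \<epsilon>(2) by (auto simp: \<epsilon>0_def)
      then show ?thesis using \<epsilon>(1) by simp
    qed
    have root: "1 \<le> sqrt (l * \<Omega> / \<epsilon>)" if "l \<in> {Lx, Ly, Lxy}" for l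
      using real_sqrt_le_mono[OF ratio[OF that]] by simp
    have grad: "(3 * c + 1) * (1 + sqrt (l * \<Omega> / \<epsilon>) + s\<^sup>2 * \<Omega> / \<epsilon>\<^sup>2)
        \<le> bilinear_const * (sqrt (l * \<Omega> / \<epsilon>) + s\<^sup>2 * \<Omega> / \<epsilon>\<^sup>2)" if "l \<in> {Lx, Ly, Lxy}" for l s
    proof -
      have "1 + r + a \<le> 8 * (r + a)" if "1 \<le> r" "0 \<le> a" for r a :: real using that by simp
      moreover have "0 \<le> s\<^sup>2 * \<Omega> / \<epsilon>\<^sup>2" using \<Omega> by simp
      ultimately have "1 + sqrt (l * \<Omega> / \<epsilon>) + s\<^sup>2 * \<Omega> / \<epsilon>\<^sup>2 \<le> 8 * (sqrt (l * \<Omega> / \<epsilon>) + s\<^sup>2 * \<Omega> / \<epsilon>\<^sup>2)"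
        using root[OF that] by blast
      then have "(3 * c + 1) * (1 + sqrt (l * \<Omega> / \<epsilon>) + s\<^sup>2 * \<Omega> / \<epsilon>\<^sup>2)
          \<le> (3 * c + 1) * (8 * (sqrt (l * \<Omega> / \<epsilon>) + s\<^sup>2 * \<Omega> / \<epsilon>\<^sup>2))"
        using c by (intro mult_left_mono) auto
      then show ?thesis by (simp only: bilinear_const_def c_def mult_ac)
    qed
    have f_count: "real (f_samples \<pi> (snd (run x))) \<le> bilinear_const * (sqrt (Lx * \<Omega> / \<epsilon>) + \<sigma>x\<^sup>2 * \<Omega> / \<epsilon>\<^sup>2)" for x
      using level[of 1] grad[of Lx \<sigma>x] by (simp add: f_samples_def counts b_def bil_const_def target_budget_def)
    have g_count: "real (g_samples \<pi> (snd (run x))) \<le> bilinear_const * (sqrt (Ly * \<Omega> / \<epsilon>) + \<sigma>y\<^sup>2 * \<Omega> / \<epsilon>\<^sup>2)" for x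
      using level[of 2] grad[of Ly \<sigma>y] by (simp add: g_samples_def counts b_def bil_const_def target_budget_def)
    have B_count: "real (B_products \<pi> (snd (run x))) \<le> bilinear_const * (Lxy * \<Omega> / \<epsilon>)" for x
    proof -
      have "real (B_products \<pi> (snd (run x))) \<le> 4 * ((3 * c + 1) * (1 + Lxy * \<Omega> / \<epsilon>))"
        using level[of 3] by (simp add: B_products_def counts b_def bil_const_def target_budget_def)
      also have "\<dots> \<le> 4 * ((3 * c + 1) * (2 * (Lxy * \<Omega> / \<epsilon>)))"
        using ratio[of Lxy] c by (intro mult_left_mono) auto
      finally show ?thesis by (simp add: bilinear_const_def c_def mult_ac)
    qed
    have gap: "integrable Pr (\<lambda>\<omega>. gap 3 (X \<times> Y) (bil_p f g \<circ> \<pi>) (bil_Q B \<circ> \<pi>) (fst (run (\<lambda>\<nu>. \<xi> \<nu> \<omega>)))) \<and>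
         (\<integral>\<omega>. gap 3 (X \<times> Y) (bil_p f g \<circ> \<pi>) (bil_Q B \<circ> \<pi>) (fst (run (\<lambda>\<nu>. \<xi> \<nu> \<omega>))) \<partial>Pr) \<le> \<epsilon>"
      if samples: "bilinear_samples Pr \<xi> \<pi> T X Y gradf gradg \<sigma>x \<sigma>y S Gf Gg z0" for Pr :: "'w measure" and \<xi>
    proof -
      interpret O: sliding_oracle Pr 3 T "X \<times> Y" id "bil_p f g \<circ> \<pi>" "bil_grad gradf gradg \<circ> \<pi>" "bil_Q B \<circ> \<pi>"
        "bil_const Lx Ly 0 \<circ> \<pi>" "bil_const 0 0 Lxy \<circ> \<pi>" "bil_const \<sigma>x \<sigma>y 0 \<circ> \<pi>" "sq_radius (X \<times> Y) z0"
        S "bil_G Gf Gg \<circ> \<pi>" \<xi> "\<lambda>_. z0"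
        by (rule bilinear_sliding_oracle[OF \<pi>(1) T(1) samples])
      have zout: "O.zout \<omega> = fst (run (\<lambda>\<nu>. \<xi> \<nu> \<omega>))" for \<omega>
        by (simp add: O.zout_def O.run_def run_def bilinear_run_def)
      have "O.expectation (\<lambda>\<omega>. gap 3 (X \<times> Y) (bil_p f g \<circ> \<pi>) (bil_Q B \<circ> \<pi>) (O.zout \<omega>)) \<le> \<epsilon>"
        by (rule order.trans[OF O.expected_gap error_bound_le_eps])
           (use nn radius_pos \<epsilon>(1) T(2) in \<open>auto simp: c_def b_def \<Omega>_def\<close>)
      then show ?thesis using O.gap_integrable by (simp add: zout)
    qed
    show ?thesis
      by (rule exI[of _ \<pi>], rule exI[of _ T]) (use \<pi>(1) T(1) f_count g_count B_count gap in \<open>simp add: Let_def run_def[symmetric] \<Omega>_def[symmetric]\<close>)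
  qed
  with \<epsilon>0 show ?thesis by blast
qed

end


section \<open>Expected gap and complexity of the stochastic sliding algorithm\<close>

theorem corollaryK9:
  fixes Pr :: "'w measure"
    and n :: nat and T :: "nat \<Rightarrow> nat"
    and Z :: "'z::euclidean_space set" and P :: "'z \<Rightarrow> 'z"
    and p :: "nat \<Rightarrow> 'z \<Rightarrow> real" and gradp Q :: "nat \<Rightarrow> 'z \<Rightarrow> 'z"
    and L M \<sigma> :: "nat \<Rightarrow> real" and \<Omega> :: real
    and S :: "'s measure" and G :: "nat \<Rightarrow> 'z \<Rightarrow> 's \<Rightarrow> 'z"
    and \<xi> :: "nat list \<Rightarrow> 'w \<Rightarrow> 's" and zin :: "'w \<Rightarrow> 'z"
    and X :: "'x::euclidean_space set" and Y :: "'y::euclidean_space set"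
    and f :: "'x \<Rightarrow> real" and gradf :: "'x \<Rightarrow> 'x"
    and g :: "'y \<Rightarrow> real" and gradg :: "'y \<Rightarrow> 'y"
    and B :: "'x \<Rightarrow> 'y"
    and Lx Ly Lxy \<sigma>x \<sigma>y :: real
    and S' :: "'t measure"
    and Gf :: "'x \<Rightarrow> 't \<Rightarrow> 'x" and Gg :: "'y \<Rightarrow> 't \<Rightarrow> 'y"
    and z0 :: "'x \<times> 'y"
  shows
    "(stochastic_sliding Pr n T Z P p gradp Q L M \<sigma> \<Omega> S G \<xi> zin \<longrightarrow>
        (let zout = (\<lambda>\<omega>. fst (tuned_run n T Z P Q G L M \<sigma> \<Omega> (zin \<omega>) (\<lambda>\<nu>. \<xi> \<nu> \<omega>)));
             A = (\<lambda>i. real (level_budget T i))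
         in integrable Pr (\<lambda>\<omega>. gap n Z p Q (zout \<omega>)) \<and>
            (\<integral>\<omega>. gap n Z p Q (zout \<omega>) \<partial>Pr)
              \<le> (\<Sum>i=1..n. 2 ^ (2 * i - 1) * L i * \<Omega> / (A i)\<^sup>2)
                + (\<Sum>i=1..n. 2 ^ (i - 1) * M i * \<Omega> / A i)
                + (\<Sum>i=1..n. (2 ^ i + 2 powr (real i / 2)) * \<sigma> i * sqrt \<Omega> / sqrt (A i)) \<and>
            0 < budget_const n \<and>
            (\<forall>\<epsilon>>0. (\<forall>i\<in>{1..n}. A i \<ge> budget_const n * target_budget (L i) (M i) (\<sigma> i) \<Omega> \<epsilon>)
               \<longrightarrow> (\<integral>\<omega>. gap n Z p Q (zout \<omega>) \<partial>Pr) \<le> \<epsilon>)))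
     \<and>
     (\<forall>m\<ge>1. \<exists>C>0. \<forall>(L :: nat \<Rightarrow> real) (M :: nat \<Rightarrow> real) (\<sigma> :: nat \<Rightarrow> real) (\<Omega> :: real) (\<epsilon> :: real).
        (\<forall>i\<in>{1..m}. 0 \<le> L i \<and> 0 \<le> M i \<and> 0 \<le> \<sigma> i) \<and> 0 < \<Omega> \<and> 0 < \<epsilon> \<longrightarrow>
        (let b = (\<lambda>i. target_budget (L i) (M i) (\<sigma> i) \<Omega> \<epsilon>)
         in (\<exists>\<pi>. \<pi> permutes {1..m} \<and> mono_on {1..m} (b \<circ> \<pi>)) \<and>
            (\<forall>\<pi>. \<pi> permutes {1..m} \<and> mono_on {1..m} (b \<circ> \<pi>) \<longrightarrow>
               (\<exists>T'. (\<forall>j\<in>{1..m}. 0 < T' j) \<and>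
                  (\<forall>i\<in>{1..m}. budget_const m * b (\<pi> i) \<le> real (level_budget T' i) \<and>
                               real (level_budget T' i) \<le> C * b (\<pi> i))))))
     \<and>
     (stochastic_bilinear X Y f gradf g gradg B Lx Ly Lxy \<sigma>x \<sigma>y S' Gf Gg z0 \<longrightarrow>
        (\<exists>\<epsilon>0>0. \<forall>\<epsilon>. 0 < \<epsilon> \<and> \<epsilon> \<le> \<epsilon>0 \<longrightarrow>
           (\<exists>\<pi> T'. \<pi> permutes {1..3} \<and> (\<forall>j\<in>{1..3}. 0 < T' j) \<and>
              (let run = bilinear_run \<pi> T' X Y B Gf Gg Lx Ly Lxy \<sigma>x \<sigma>y z0;
                   \<Omega> = sq_radius (X \<times> Y) z0
               in (\<forall>x. let s = snd (run x) in
                      real (f_samples \<pi> s)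
                        \<le> bilinear_const * (sqrt (Lx * \<Omega> / \<epsilon>) + \<sigma>x\<^sup>2 * \<Omega> / \<epsilon>\<^sup>2) \<and>
                      real (g_samples \<pi> s)
                        \<le> bilinear_const * (sqrt (Ly * \<Omega> / \<epsilon>) + \<sigma>y\<^sup>2 * \<Omega> / \<epsilon>\<^sup>2) \<and>
                      real (B_products \<pi> s) \<le> bilinear_const * (Lxy * \<Omega> / \<epsilon>)) \<and>
                  (\<forall>(Pr :: 'v measure) \<xi>.
                     bilinear_samples Pr \<xi> \<pi> T' X Y gradf gradg \<sigma>x \<sigma>y S' Gf Gg z0 \<longrightarrow>
                     integrable Pr (\<lambda>\<omega>. gap 3 (X \<times> Y) (bil_p f g \<circ> \<pi>) (bil_Q B \<circ> \<pi>)
                                          (fst (run (\<lambda>\<nu>. \<xi> \<nu> \<omega>)))) \<and>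
                     (\<integral>\<omega>. gap 3 (X \<times> Y) (bil_p f g \<circ> \<pi>) (bil_Q B \<circ> \<pi>)
                             (fst (run (\<lambda>\<nu>. \<xi> \<nu> \<omega>))) \<partial>Pr) \<le> \<epsilon>)))))"
  by (intro conjI impI budgets_attainable;
      (erule stochastic_sliding.expected_gap_and_accuracy | erule stochastic_bilinear.bilinear_complexity))

end
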